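(* Let $z_0\in(0,1)$, $0<\varepsilon<1$, $L>0$, $L^*>0$, $0<\underline\alpha<\overline\alpha<1$, $\underline\beta=1+\underline\alpha$, $\overline\beta=1+\overline\alpha$, and let $\check\lambda>\check\lambda_*=4\sqrt2\left(\frac{\overline\beta-\underline\beta}{(2\underline\beta+1)(2\overline\beta+1)}\right)^{1/2}$ be a constant. Suppose the noise variables $\xi_k$ are i.i.d. standard Gaussian $\mathcal N(0,1)$. Then the adaptive sequential estimator $\hat S_{a,n}$ defined in the context satisfies $$\limsup_{n\to\infty}\ \sup_{\beta\in[\underline\beta,\overline\beta]}\ \sup_{S\in\mathcal H^{(\beta)}(\varepsilon,L,L^* )}\ N(\beta)\,\mathbf E_S\big|\hat S_{a,n}-S(z_0)\big|\ <\ \infty,$$ where $N(\beta)=d_n^{\beta/(2\beta+1)}$ and $d_n=n/\ln n$.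
   Context: Model: for each $n$, one observes $y_1,\dots,y_n$ with $y_k=S(x_k)y_{k-1}+\xi_k$, $1\le k\le n$, $x_k=k/n$, where the initial value $y_0$ is a fixed (nonrandom) real number, $S:[0,1]\to\mathbb R$ is unknown and the $\xi_k$ are i.i.d. $\mathcal N(0,1)$. $\mathbf E_S$ denotes expectation under the law of the observations corresponding to $S$. Stability set: $\Theta_{\varepsilon,L}=\{S\in C^1([0,1],\mathbb R):\ \sup_{0\le x\le 1}|S(x)|\le1-\varepsilon,\ \sup_{0\le x\le 1}|\dot S(x)|\le L\}$. Strong stable local Hölder class at $z_0$, for $\beta=1+\alpha$: $\mathcal H^{(\beta)}(\varepsilon,L,L^* )=\{S\in\Theta_{\varepsilon,L}:\ \sup_{x\in[0,1],\,x\ne z_0}|\dot S(x)-\dot S(z_0)|/|x-z_0|^\alpha\le L^*\}$. Sequential kernel estimator $S^*_{h,\alpha}$ (with parameters $n,h,\alpha$; $n$ large). Let $Q=\mathbf 1_{[-1,1]}$, $u_j=(x_j-z_0)/h$, $[\cdot]$ the integer part, $A_{k,m}=\sum_{j=k+1}^mQ(u_j)y_{j-1}^2$, $k_*=[nz_0-nh]+1$, $\tilde\epsilon=h^\alpha/\ln n$, $\iota=[\tilde\epsilon nh]+1$, $\nu=k_*+\iota$. Preliminary estimator: $\hat S_\nu=A_{0,\nu}^{-1}\sum_{j=1}^\nu Q(u_j)y_{j-1}y_j$, with truncation $\tilde S_\nu=\min(\max(\hat S_\nu,-1+\varepsilon),1-\varepsilon)$. Threshold: $H=\phi nh$ with $\phi=2(1-\tilde\epsilon)/(1-\tilde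 S_\nu^2)$. Stopping time: $\tau_H=\inf\{k\ge\nu+1:\ A_{\nu,k}\ge H\}$, with $\tau_H=n$ if no such $k\le n$ exists. Correction coefficient: on $\{A_{\nu,\tau_H}\ge H\}$, $\varkappa_H$ is defined by $A_{\nu,\tau_H-1}+\varkappa_HQ(u_{\tau_H})y_{\tau_H-1}^2=H$; on $\{A_{\nu,\tau_H}<H\}$, $\varkappa_H=1$. Then $$S^*_{h,\alpha}=\frac1H\Big(\sum_{j=\nu+1}^{\tau_H-1}Q(u_j)y_{j-1}y_j+\varkappa_HQ(u_{\tau_H})y_{\tau_H-1}y_{\tau_H}\Big)\mathbf 1_{\{A_{\nu,n}\ge H\}}.$$ Adaptive estimator. Let $m=[\ln d_n]+1$ and, for $0\le k\le m$, $\beta_k=\underline\beta+\frac km(\overline\beta-\underline\beta)$, $\alpha_k=\underline\alpha+\frac km(\overline\alpha-\underline\alpha)$, $N_k=N(\beta_k)$, $\check h_k=d_n^{-1/(2\beta_k+1)}$, and $\check S_k=S^*_{\check h_k,\alpha_k}$. Put $$\check\omega_k=\max_{0\le j\le k}\Big(|\check S_j-\check S_k|-\frac{\check\lambda}{N_j}\Big),\qquad \check k=\max\Big\{0\le k\le m:\ \check\omega_k\le\frac{\check\lambda}{N_k}\Big\},\qquad \hat S_{a,n}=\check S_{\check k}.$$ *)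

theory Defs
  imports "HOL-Probability.Probability"
begin

section \<open>Observations\<close>

text \<open>
  \<open>obs S y0 n \<xi> k\<close> is \<open>y\<^sub>k\<close>, computed from a realisation \<open>\<xi>\<close> of the noise.
  Only \<open>\<xi> 1, \<dots>, \<xi> n\<close> enter \<open>y\<^sub>1, \<dots>, y\<^sub>n\<close>; \<open>\<xi> 0\<close> is never used.
\<close>

primrec obs :: "(real \<Rightarrow> real) \<Rightarrow> real \<Rightarrow> nat \<Rightarrow> (nat \<Rightarrow> real) \<Rightarrow> nat \<Rightarrow> real" where
  "obs S y0 n \<xi> 0 = y0"
| "obs S y0 n \<xi> (Suc k) = S (real (Suc k) / real n) * obs S y0 n \<xi> k + \<xi> (Suc k)"

section \<open>Function classes\<close>

text \<open>
  Functions on \<open>[0,1]\<close> are total functions of which only the values on \<open>[0,1]\<close> matter.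
  Hence the derivative is taken within \<open>[0,1]\<close>, one-sided at the end points.
\<close>

definition deriv01 :: "(real \<Rightarrow> real) \<Rightarrow> real \<Rightarrow> real" where
  "deriv01 S x = vector_derivative S (at x within {0..1})"

definition stable_set :: "real \<Rightarrow> real \<Rightarrow> (real \<Rightarrow> real) set" where
  "stable_set \<epsilon> L = {S. S differentiable_on {0..1} \<and> continuous_on {0..1} (deriv01 S) \<and>
     (\<forall>x\<in>{0..1}. \<bar>S x\<bar> \<le> 1 - \<epsilon>) \<and> (\<forall>x\<in>{0..1}. \<bar>deriv01 S x\<bar> \<le> L)}"

definition holder_class ::
    "real \<Rightarrow> real \<Rightarrow> real \<Rightarrow> real \<Rightarrow> real \<Rightarrow> (real \<Rightarrow> real) set" where
  "holder_class z0 \<beta> \<epsilon> L Ls = {S \<in> stable_set \<epsilon> L.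
     \<forall>x\<in>{0..1} - {z0}. \<bar>deriv01 S x - deriv01 S z0\<bar> / \<bar>x - z0\<bar> powr (\<beta> - 1) \<le> Ls}"

section \<open>The sequential kernel estimator\<close>

text \<open>
  Throughout, \<open>y\<close> is the observed sequence and \<open>n\<close> the sample size.  The construction is meant
  for large \<open>n\<close>, when \<open>n * z0 - n * h\<close> is positive and \<open>\<nu> < n\<close>; the values which the definitions
  give for other \<open>n\<close>, such as those caused by \<open>nat\<close> truncating negative integers, carry no meaning.
\<close>

definition kern :: "real \<Rightarrow> nat \<Rightarrow> real \<Rightarrow> nat \<Rightarrow> real" where
  "kern z0 n h j = indicator {-1..1} ((real j / real n - z0) / h)"

definition energy :: "real \<Rightarrow> nat \<Rightarrow> real \<Rightarrow> (nat \<Rightarrow> real) \<Rightarrow> nat \<Rightarrow> nat \<Rightarrow> real" where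
  "energy z0 n h y k m = (\<Sum>j=k+1..m. kern z0 n h j * (y (j - 1))\<^sup>2)"

definition eps_tilde :: "nat \<Rightarrow> real \<Rightarrow> real \<Rightarrow> real" where
  "eps_tilde n h \<alpha> = h powr \<alpha> / ln (real n)"

definition k_star :: "real \<Rightarrow> nat \<Rightarrow> real \<Rightarrow> nat" where
  "k_star z0 n h = nat \<lfloor>real n * z0 - real n * h\<rfloor> + 1"

definition iota :: "nat \<Rightarrow> real \<Rightarrow> real \<Rightarrow> nat" where
  "iota n h \<alpha> = nat \<lfloor>eps_tilde n h \<alpha> * real n * h\<rfloor> + 1"

definition nu :: "real \<Rightarrow> nat \<Rightarrow> real \<Rightarrow> real \<Rightarrow> nat" where
  "nu z0 n h \<alpha> = k_star z0 n h + iota n h \<alpha>"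

definition S_hat :: "real \<Rightarrow> nat \<Rightarrow> real \<Rightarrow> real \<Rightarrow> (nat \<Rightarrow> real) \<Rightarrow> real" where
  "S_hat z0 n h \<alpha> y =
     (\<Sum>j=1..nu z0 n h \<alpha>. kern z0 n h j * y (j - 1) * y j) / energy z0 n h y 0 (nu z0 n h \<alpha>)"

definition S_tilde :: "real \<Rightarrow> real \<Rightarrow> nat \<Rightarrow> real \<Rightarrow> real \<Rightarrow> (nat \<Rightarrow> real) \<Rightarrow> real" where
  "S_tilde z0 \<epsilon> n h \<alpha> y = min (max (S_hat z0 n h \<alpha> y) (-1 + \<epsilon>)) (1 - \<epsilon>)"

definition threshold :: "real \<Rightarrow> real \<Rightarrow> nat \<Rightarrow> real \<Rightarrow> real \<Rightarrow> (nat \<Rightarrow> real) \<Rightarrow> real" where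
  "threshold z0 \<epsilon> n h \<alpha> y =
     2 * (1 - eps_tilde n h \<alpha>) / (1 - (S_tilde z0 \<epsilon> n h \<alpha> y)\<^sup>2) * real n * h"

definition tau :: "real \<Rightarrow> real \<Rightarrow> nat \<Rightarrow> real \<Rightarrow> real \<Rightarrow> (nat \<Rightarrow> real) \<Rightarrow> nat" where
  "tau z0 \<epsilon> n h \<alpha> y =
     (let \<nu> = nu z0 n h \<alpha>; H = threshold z0 \<epsilon> n h \<alpha> y;
          K = {k. \<nu> + 1 \<le> k \<and> k \<le> n \<and> energy z0 n h y \<nu> k \<ge> H}
      in if K = {} then n else Inf K)"

text \<open>
  In the first case \<open>\<kappa>\<close> solves the equation
  \<open>energy \<nu> (\<tau> - 1) + \<kappa> * kern \<tau> * (y (\<tau> - 1))\<^sup>2 = H\<close>.  If \<open>H > 0\<close> and \<open>\<nu> < n\<close>, then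
  \<open>energy \<nu> (\<tau> - 1) < H \<le> energy \<nu> \<tau>\<close> there, so the coefficient of \<open>\<kappa>\<close> is positive.
\<close>

definition kappa :: "real \<Rightarrow> real \<Rightarrow> nat \<Rightarrow> real \<Rightarrow> real \<Rightarrow> (nat \<Rightarrow> real) \<Rightarrow> real" where
  "kappa z0 \<epsilon> n h \<alpha> y =
     (let \<nu> = nu z0 n h \<alpha>; H = threshold z0 \<epsilon> n h \<alpha> y; \<tau> = tau z0 \<epsilon> n h \<alpha> y
      in if energy z0 n h y \<nu> \<tau> \<ge> H
         then (H - energy z0 n h y \<nu> (\<tau> - 1)) / (kern z0 n h \<tau> * (y (\<tau> - 1))\<^sup>2)
         else 1)"

definition S_star :: "real \<Rightarrow> real \<Rightarrow> nat \<Rightarrow> real \<Rightarrow> real \<Rightarrow> (nat \<Rightarrow> real) \<Rightarrow> real" where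
  "S_star z0 \<epsilon> n h \<alpha> y =
     (let \<nu> = nu z0 n h \<alpha>; H = threshold z0 \<epsilon> n h \<alpha> y; \<tau> = tau z0 \<epsilon> n h \<alpha> y
      in if energy z0 n h y \<nu> n \<ge> H
         then 1 / H * ((\<Sum>j=\<nu>+1..\<tau>-1. kern z0 n h j * y (j - 1) * y j)
                       + kappa z0 \<epsilon> n h \<alpha> y * kern z0 n h \<tau> * y (\<tau> - 1) * y \<tau>)
         else 0)"

section \<open>The adaptive estimator\<close>

definition d_seq :: "nat \<Rightarrow> real" where
  "d_seq n = real n / ln (real n)"

definition rate :: "nat \<Rightarrow> real \<Rightarrow> real" where
  "rate n \<beta> = d_seq n powr (\<beta> / (2 * \<beta> + 1))"

definition grid_size :: "nat \<Rightarrow> nat" where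
  "grid_size n = nat \<lfloor>ln (d_seq n)\<rfloor> + 1"

definition grid :: "real \<Rightarrow> real \<Rightarrow> nat \<Rightarrow> nat \<Rightarrow> real" where
  "grid a b n k = a + real k / real (grid_size n) * (b - a)"

text \<open>The constants below take the bounds \<open>al\<close>, \<open>au\<close> of the range of \<open>\<alpha>\<close>; those of \<open>\<beta>\<close>
  are \<open>1 + al\<close>, \<open>1 + au\<close>.\<close>

definition beta_grid :: "real \<Rightarrow> real \<Rightarrow> nat \<Rightarrow> nat \<Rightarrow> real" where
  "beta_grid al au n k = grid (1 + al) (1 + au) n k"

definition h_grid :: "real \<Rightarrow> real \<Rightarrow> nat \<Rightarrow> nat \<Rightarrow> real" where
  "h_grid al au n k = d_seq n powr (- 1 / (2 * beta_grid al au n k + 1))"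

definition S_check ::
    "real \<Rightarrow> real \<Rightarrow> real \<Rightarrow> real \<Rightarrow> nat \<Rightarrow> (nat \<Rightarrow> real) \<Rightarrow> nat \<Rightarrow> real" where
  "S_check z0 \<epsilon> al au n y k = S_star z0 \<epsilon> n (h_grid al au n k) (grid al au n k) y"

definition omega_check ::
    "real \<Rightarrow> real \<Rightarrow> real \<Rightarrow> real \<Rightarrow> real \<Rightarrow> nat \<Rightarrow> (nat \<Rightarrow> real) \<Rightarrow> nat \<Rightarrow> real" where
  "omega_check z0 \<epsilon> al au lam n y k =
     Max ((\<lambda>j. \<bar>S_check z0 \<epsilon> al au n y j - S_check z0 \<epsilon> al au n y k\<bar>
               - lam / rate n (beta_grid al au n j)) ` {0..k})"

definition k_check ::
    "real \<Rightarrow> real \<Rightarrow> real \<Rightarrow> real \<Rightarrow> real \<Rightarrow> nat \<Rightarrow> (nat \<Rightarrow> real) \<Rightarrow> nat" where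
  "k_check z0 \<epsilon> al au lam n y =
     Max {k. k \<le> grid_size n \<and>
             omega_check z0 \<epsilon> al au lam n y k \<le> lam / rate n (beta_grid al au n k)}"

definition S_adaptive ::
    "real \<Rightarrow> real \<Rightarrow> real \<Rightarrow> real \<Rightarrow> real \<Rightarrow> nat \<Rightarrow> (nat \<Rightarrow> real) \<Rightarrow> real" where
  "S_adaptive z0 \<epsilon> al au lam n y =
     S_check z0 \<epsilon> al au n y (k_check z0 \<epsilon> al au lam n y)"

section \<open>The risk\<close>

text \<open>
  The expected absolute error is an extended nonnegative integral, so that it is infinite, and
  not \<open>0\<close>, should the error fail to be integrable.
\<close>

definition abs_risk ::
    "'a measure \<Rightarrow> (nat \<Rightarrow> 'a \<Rightarrow> real) \<Rightarrow> real \<Rightarrow> real \<Rightarrow> nat \<Rightarrow> ((nat \<Rightarrow> real) \<Rightarrow> real)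
      \<Rightarrow> (real \<Rightarrow> real) \<Rightarrow> ennreal" where
  "abs_risk M \<xi> y0 z0 n T S =
     (\<integral>\<^sup>+ \<omega>. ennreal \<bar>T (obs S y0 n (\<lambda>k. \<xi> k \<omega>)) - S z0\<bar> \<partial>M)"

end

theory Submission
  imports Defs "HOL-Real_Asymp.Real_Asymp"
begin

text \<open>
  The stopping time makes the weights of the sequential estimator sum to exactly \<open>H\<close>, so its noise
  part is a sum \<open>\<Sum> a\<^sub>k \<xi>\<^sub>k\<close> with predictable \<open>a\<^sub>k\<close> and \<open>\<Sum> a\<^sub>k\<^sup>2 \<le> 1/H \<le> 1/(n h)\<close> surely; it is therefore
  sub-Gaussian, although \<open>H\<close> and the stopping time are random.  Multiplying
  \<open>(1 - S(z\<^sub>0)\<^sup>2) y\<^sub>j\<^sub>-\<^sub>1\<^sup>2 = 1 + (y\<^sub>j\<^sub>-\<^sub>1\<^sup>2 - y\<^sub>j\<^sup>2) + (S(x\<^sub>j)\<^sup>2 - S(z\<^sub>0)\<^sup>2) y\<^sub>j\<^sub>-\<^sub>1\<^sup>2 + 2 S(x\<^sub>j) y\<^sub>j\<^sub>-\<^sub>1 \<xi>\<^sub>j + (\<xi>\<^sub>j\<^sup>2 - 1)\<close>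
  by a weight and summing over the window gives a law of large numbers for weighted energies.  Outside
  an event of probability \<open>O(1/n)\<close> it shows that the threshold is reached while only a fraction of order
  \<open>h\<^sup>\<alpha> / ln n\<close> of the window is left over, hence that the linear term of the bias cancels up to
  \<open>O(h\<^sup>\<beta> / ln n)\<close>.

  For Lepski's selection, take a grid point a fixed multiple of \<open>1 / ln d\<^sub>n\<close> below the true \<open>\<beta>\<close>: there,
  and at all smaller grid points, the bias is at most \<open>\<lambda> / 8N\<^sub>k\<close> besides the vanishing term, and the rate
  loses only a constant.  The selection then fails only if some noise part exceeds \<open>3\<lambda> / 4N\<^sub>k\<close>, which has
  probability of order \<open>n\<^sup>-\<^sup>p ln n\<close> with \<open>p = 9\<lambda>\<^sup>2/128\<close>.  The condition on \<open>\<lambda>\<close> makes \<open>p > 2\<Delta>\<close>, where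
  \<open>d\<^sub>n\<^sup>\<Delta>\<close> is the ratio of the largest to the smallest rate, and this absorbs the loss on that event, where
  the error is compared with that of the coarsest estimator.
\<close>

section \<open>Exponential moments of Gaussian linear-quadratic forms\<close>

text \<open>Separating linear from quadratic noise costs a factor 4 in the exponent: a noise part
  whose squared weights sum to at most c has tail 2 exp (- x^2 / (8c)). With c = 1/(n h) = 1/(N^2 ln
  n) and x = 3\<lambda>/(4N) this is 2 n^(-p), and the hypothesis \<lambda>^2 > 32\<Delta> still
  leaves p > (9/4)\<Delta>. The bound to beat is 2\<Delta>, not \<Delta>, because the noise of the
  coarsest estimator is unbounded on the failure event and its product with the ratio of rates is
  split into two squares.

  The delicate point is precision. With e = h powr \<alpha> / ln n, the energies and the preliminary
  estimate of S(z0), which rests on about e n h observations, must be accurate to order e. So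
  fluctuations of order sqrt (n h), times logarithms from the unbounded observations, have to be
  small against e^2 n h, and L h against e. Both come down to the power (1 - \<alpha>)/(3 +
  2\<alpha>) of d_n, which is where \<alpha> < 1 enters.\<close>

definition gauss :: "real measure" where
  "gauss = density lborel (\<lambda>x. ennreal (std_normal_density x))"

lemma sets_gauss [measurable_cong, simp]: "sets gauss = sets borel"
  by (simp add: gauss_def)

lemma space_gauss [simp]: "space gauss = UNIV"
  by (simp add: gauss_def)

lemma prob_space_gauss: "prob_space gauss"
  unfolding gauss_def by (rule prob_space_normal_density) simp

lemma nn_integral_normal_density:
  assumes "0 < \<sigma>"
  shows "(\<integral>\<^sup>+x. ennreal (normal_density \<mu> \<sigma> x) \<partial>lborel) = 1"
  using prob_space.emeasure_space_1[OF prob_space_normal_density[OF assms, of \<mu>]]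
  by (simp add: emeasure_density)

lemma nn_integral_gauss:
  assumes [measurable]: "f \<in> borel_measurable borel"
  shows "(\<integral>\<^sup>+x. f x \<partial>gauss) = (\<integral>\<^sup>+x. ennreal (std_normal_density x) * f x \<partial>lborel)"
  unfolding gauss_def by (subst nn_integral_density) auto

lemma gauss_exp_linear: "(\<integral>\<^sup>+x. ennreal (exp (c * x)) \<partial>gauss) = ennreal (exp (c\<^sup>2 / 2))"
proof -
  have "std_normal_density x * exp (c * x) = exp (c\<^sup>2 / 2) * normal_density c 1 x" for x
    by (simp add: normal_density_def exp_add[symmetric] power2_eq_square field_simps)
  then have "(\<integral>\<^sup>+x. ennreal (exp (c * x)) \<partial>gauss)
      = (\<integral>\<^sup>+x. ennreal (exp (c\<^sup>2 / 2)) * ennreal (normal_density c 1 x) \<partial>lborel)"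
    by (simp add: nn_integral_gauss ennreal_mult[symmetric])
  also have "\<dots> = ennreal (exp (c\<^sup>2 / 2))"
    by (simp add: nn_integral_cmult nn_integral_normal_density)
  finally show ?thesis .
qed

text \<open>Tilting by the square turns the standard normal law into a centred one of variance 1/(1
  - 2t), so the integral equals exp (-t) / sqrt (1 - 2t); for |t| \<le> 1/4 the logarithm of this is
  at most 4 t^2.\<close>

lemma gauss_exp_square_le:
  assumes "\<bar>t\<bar> \<le> 1 / 4"
  shows "(\<integral>\<^sup>+x. ennreal (exp (t * (x\<^sup>2 - 1))) \<partial>gauss) \<le> ennreal (exp (4 * t\<^sup>2))"
proof -
  define u where "u = 1 - 2 * t"
  define \<sigma> where "\<sigma> = 1 / sqrt u"
  have u: "0 < u" and \<sigma>: "0 < \<sigma>"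
    using assms by (auto simp: u_def \<sigma>_def)
  have s2: "\<sigma>\<^sup>2 = 1 / u"
    using u by (simp add: \<sigma>_def power_divide)
  have "std_normal_density x * exp (t * (x\<^sup>2 - 1)) = exp (- t) * \<sigma> * normal_density 0 \<sigma> x" for x
  proof -
    have e: "- x\<^sup>2 / 2 + t * (x\<^sup>2 - 1) = - t + - x\<^sup>2 / (2 * \<sigma>\<^sup>2)"
      using u unfolding s2 u_def by (simp add: field_simps)
    have "std_normal_density x * exp (t * (x\<^sup>2 - 1)) = 1 / sqrt (2 * pi) * exp (- x\<^sup>2 / 2 + t * (x\<^sup>2 - 1))"
      by (simp only: std_normal_density_def exp_add mult.assoc)
    also have "\<dots> = 1 / sqrt (2 * pi) * (exp (- t) * exp (- x\<^sup>2 / (2 * \<sigma>\<^sup>2)))"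
      by (simp only: e exp_add)
    also have "\<dots> = exp (- t) * \<sigma> * normal_density 0 \<sigma> x"
      using \<sigma> by (simp add: normal_density_def real_sqrt_mult)
    finally show ?thesis .
  qed
  then have "(\<integral>\<^sup>+x. ennreal (exp (t * (x\<^sup>2 - 1))) \<partial>gauss)
      = (\<integral>\<^sup>+x. ennreal (exp (- t) * \<sigma>) * ennreal (normal_density 0 \<sigma> x) \<partial>lborel)"
    using \<sigma> by (simp add: nn_integral_gauss ennreal_mult[symmetric])
  also have "\<dots> = ennreal (exp (- t) * \<sigma>)"
    using \<sigma> by (simp add: nn_integral_cmult nn_integral_normal_density)
  also have "exp (- t) * \<sigma> \<le> exp (4 * t\<^sup>2)"
  proof -
    have "\<bar>ln (1 + (- 2 * t)) - (- 2 * t)\<bar> \<le> 2 * (- 2 * t)\<^sup>2"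
      using assms by (intro abs_ln_one_plus_x_minus_x_bound) auto
    then have "- ln u / 2 \<le> t + 4 * t\<^sup>2"
      by (simp add: u_def power2_eq_square abs_le_iff)
    moreover have "\<sigma> = exp (- ln u / 2)"
      using u by (simp add: \<sigma>_def ln_sqrt[symmetric] exp_minus inverse_eq_divide)
    ultimately show ?thesis
      by (simp add: exp_add[symmetric])
  qed
  finally show ?thesis
    by (simp add: ennreal_leI)
qed

text \<open>The inequality 2AB \<le> A^2 + B^2 separates the linear from the quadratic factor at the
  price of doubling both coefficients. This produces 2 a^2 = (2a)^2/2 and 16 b^2 = 4 (2b)^2, and
  halves the admissible range of \<open>b\<close>.\<close>

lemma gauss_exp_le:
  assumes "\<bar>b\<bar> \<le> 1 / 8"
  shows "(\<integral>\<^sup>+x. ennreal (exp (a * x + b * (x\<^sup>2 - 1) - 2 * a\<^sup>2 - 16 * b\<^sup>2)) \<partial>gauss) \<le> 1"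
proof -
  define E where "E = exp (- (2 * a\<^sup>2 + 16 * b\<^sup>2))"
  have pw: "exp (a * x + b * (x\<^sup>2 - 1) - 2 * a\<^sup>2 - 16 * b\<^sup>2)
      \<le> E / 2 * (exp (2 * a * x) + exp (2 * b * (x\<^sup>2 - 1)))" for x
  proof -
    have "2 * (exp (a * x) * exp (b * (x\<^sup>2 - 1))) \<le> (exp (a * x))\<^sup>2 + (exp (b * (x\<^sup>2 - 1)))\<^sup>2"
      using sum_squares_bound[of "exp (a * x)" "exp (b * (x\<^sup>2 - 1))"] by simp
    also have "\<dots> = exp (2 * a * x) + exp (2 * b * (x\<^sup>2 - 1))"
      by (simp only: exp_double[symmetric] mult.assoc)
    finally have "exp (a * x) * exp (b * (x\<^sup>2 - 1)) \<le> (exp (2 * a * x) + exp (2 * b * (x\<^sup>2 - 1))) / 2"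
      by simp
    from mult_left_mono[OF this, of E]
    have "E * (exp (a * x) * exp (b * (x\<^sup>2 - 1))) \<le> E / 2 * (exp (2 * a * x) + exp (2 * b * (x\<^sup>2 - 1)))"
      by (simp add: E_def)
    moreover have "exp (a * x + b * (x\<^sup>2 - 1) - 2 * a\<^sup>2 - 16 * b\<^sup>2) = E * (exp (a * x) * exp (b * (x\<^sup>2 - 1)))"
      unfolding E_def exp_add[symmetric] by (simp add: algebra_simps)
    ultimately show ?thesis by simp
  qed
  have "(\<integral>\<^sup>+x. ennreal (exp (a * x + b * (x\<^sup>2 - 1) - 2 * a\<^sup>2 - 16 * b\<^sup>2)) \<partial>gauss)
      \<le> (\<integral>\<^sup>+x. ennreal (E / 2) * (ennreal (exp ((2 * a) * x)) + ennreal (exp ((2 * b) * (x\<^sup>2 - 1)))) \<partial>gauss)"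
    using pw by (intro nn_integral_mono)
      (simp add: ennreal_mult[symmetric] ennreal_plus[symmetric] E_def ennreal_leI del: ennreal_plus)
  also have "\<dots> = ennreal (E / 2) * ((\<integral>\<^sup>+x. ennreal (exp ((2 * a) * x)) \<partial>gauss)
      + (\<integral>\<^sup>+x. ennreal (exp ((2 * b) * (x\<^sup>2 - 1))) \<partial>gauss))"
    by (subst nn_integral_cmult, simp, subst nn_integral_add) simp_all
  also have "\<dots> \<le> ennreal (E / 2) * (ennreal (exp (2 * a\<^sup>2)) + ennreal (exp (16 * b\<^sup>2)))"
    using gauss_exp_square_le[of "2 * b"] assms
    by (intro mult_left_mono add_mono) (simp_all add: gauss_exp_linear power2_eq_square)
  also have "\<dots> = ennreal (E / 2 * (exp (2 * a\<^sup>2) + exp (16 * b\<^sup>2)))"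
    by (simp add: E_def ennreal_mult[symmetric] ennreal_plus[symmetric] del: ennreal_plus)
  also have "\<dots> \<le> ennreal 1"
  proof (rule ennreal_leI)
    have "E * exp (2 * a\<^sup>2) \<le> 1" "E * exp (16 * b\<^sup>2) \<le> 1"
      unfolding E_def exp_add[symmetric] by simp_all
    then show "E / 2 * (exp (2 * a\<^sup>2) + exp (16 * b\<^sup>2)) \<le> 1"
      by (simp add: algebra_simps)
  qed
  finally show ?thesis by simp
qed

section \<open>Predictable weights and the exponential supermartingale\<close>

definition gauss_seq :: "nat \<Rightarrow> (nat \<Rightarrow> real) measure" where
  "gauss_seq n = PiM {1..n} (\<lambda>_. gauss)"

lemma sets_gauss_seq [measurable_cong]: "sets (gauss_seq n) = sets (PiM {1..n} (\<lambda>_. borel))"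
  unfolding gauss_seq_def by (rule sets_PiM_cong) auto

text \<open>Redrawing one coordinate independently preserves the product law. This plays the part of
  conditioning on the past, without a filtration.\<close>

lemma resample:
  assumes k: "k \<in> {1..n}" and f [measurable]: "f \<in> borel_measurable (gauss_seq n)"
  shows "(\<integral>\<^sup>+w. f w \<partial>(gauss_seq n)) = (\<integral>\<^sup>+w. (\<integral>\<^sup>+x. f (w(k := x)) \<partial>gauss) \<partial>(gauss_seq n))"
proof -
  interpret g: prob_space gauss by (rule prob_space_gauss)
  interpret p: product_prob_space "\<lambda>_. gauss" UNIV ..
  define I where "I = {1..n} - {k}"
  have I: "finite I" "k \<notin> I" and ins: "insert k I = {1..n}"
    using k by (auto simp: I_def)
  have meas: "h \<in> borel_measurable (PiM (insert k I) (\<lambda>_. gauss)) \<longleftrightarrow> h \<in> borel_measurable (gauss_seq n)"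
    for h :: "(nat \<Rightarrow> real) \<Rightarrow> ennreal"
    by (simp add: ins gauss_seq_def)
  have f2: "(\<lambda>(w, x). f (w(k := x))) \<in> borel_measurable (gauss_seq n \<Otimes>\<^sub>M gauss)"
  proof -
    have "(\<lambda>p. (fst p)(k := snd p)) \<in> measurable (gauss_seq n \<Otimes>\<^sub>M gauss) (gauss_seq n)"
      unfolding gauss_seq_def using k
      by (intro measurable_fun_upd[where J = "{1..n}"]) auto
    from measurable_compose[OF this f] show ?thesis
      by (simp add: case_prod_beta)
  qed
  have m2: "(\<lambda>w. \<integral>\<^sup>+x. f (w(k := x)) \<partial>gauss) \<in> borel_measurable (gauss_seq n)"
    using f2 by (rule g.borel_measurable_nn_integral)
  have "(\<integral>\<^sup>+w. (\<integral>\<^sup>+x. f (w(k := x)) \<partial>gauss) \<partial>(gauss_seq n))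
      = (\<integral>\<^sup>+w. (\<integral>\<^sup>+y. (\<integral>\<^sup>+x. f ((w(k := y))(k := x)) \<partial>gauss) \<partial>gauss) \<partial>(PiM I (\<lambda>_. gauss)))"
    using p.product_nn_integral_insert[OF I, of "\<lambda>w. \<integral>\<^sup>+x. f (w(k := x)) \<partial>gauss"] m2
    unfolding meas by (simp add: ins gauss_seq_def)
  also have "\<dots> = (\<integral>\<^sup>+w. (\<integral>\<^sup>+x. f (w(k := x)) \<partial>gauss) \<partial>(PiM I (\<lambda>_. gauss)))"
    by (simp add: g.emeasure_space_1[simplified])
  also have "\<dots> = (\<integral>\<^sup>+w. f w \<partial>(gauss_seq n))"
    using p.product_nn_integral_insert[OF I, of f] f unfolding meas[symmetric]
    by (simp add: ins gauss_seq_def)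
  finally show ?thesis by simp
qed

text \<open>Dependence on the past is expressed as invariance under changes of the coordinates from
  \<open>k\<close> on, the form in which it is applied to the update \<open>w(k := x)\<close> of
  \<open>resample\<close>.\<close>

definition predictable :: "nat \<Rightarrow> (nat \<Rightarrow> (nat \<Rightarrow> real) \<Rightarrow> real) \<Rightarrow> bool" where
  "predictable n a \<longleftrightarrow> (\<forall>k\<in>{1..n}. a k \<in> borel_measurable (PiM {1..n} (\<lambda>_. borel)) \<and>
     (\<forall>w w'. (\<forall>i\<in>{1..<k}. w i = w' i) \<longrightarrow> a k w = a k w'))"

lemma predictable_cmult: "predictable n a \<Longrightarrow> predictable n (\<lambda>k w. c * a k w)"
  unfolding predictable_def by (intro ballI conjI allI impI) (auto intro!: borel_measurable_times | metis)+

text \<open>Redrawing the last coordinate changes no earlier summand and leaves its own weight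
  fixed, so the inner integral is the one bounded in \<open>gauss_exp_le\<close>; induction removes
  the coordinates one by one.\<close>

lemma exp_supermartingale:
  assumes a: "predictable n a" and b: "\<And>k. k \<in> {1..n} \<Longrightarrow> \<bar>b k\<bar> \<le> 1 / 8"
  shows "(\<integral>\<^sup>+w. ennreal (exp (\<Sum>k=1..n. a k w * w k + b k * ((w k)\<^sup>2 - 1)
            - 2 * (a k w)\<^sup>2 - 16 * (b k)\<^sup>2)) \<partial>(gauss_seq n)) \<le> 1"
proof -
  interpret g: prob_space gauss by (rule prob_space_gauss)
  have ps: "prob_space (gauss_seq n)"
    unfolding gauss_seq_def by (intro prob_space_PiM prob_space_gauss)
  let ?z = "\<lambda>w k. a k w * w k + b k * ((w k)\<^sup>2 - 1) - 2 * (a k w)\<^sup>2 - 16 * (b k)\<^sup>2"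
  have am: "a k \<in> borel_measurable (gauss_seq n)" if "k \<in> {1..n}" for k
    using a that unfolding predictable_def
    by (simp cong: measurable_cong_sets add: sets_gauss_seq)
  have au: "a k w = a k w'" if "k \<in> {1..n}" "\<forall>i\<in>{1..<k}. w i = w' i" for k w w'
    using a that unfolding predictable_def by blast
  have cm: "(\<lambda>w. w k) \<in> borel_measurable (gauss_seq n)" if "k \<in> {1..n}" for k
    unfolding gauss_seq_def
    using measurable_component_singleton[OF that, of "\<lambda>_. gauss"]
    by (simp cong: measurable_cong_sets)
  have zm: "(\<lambda>w. ?z w k) \<in> borel_measurable (gauss_seq n)" if "k \<in> {1..n}" for k
    using am[OF that] cm[OF that] by measurable
  have "m \<le> n \<Longrightarrow> (\<integral>\<^sup>+w. ennreal (exp (\<Sum>k=1..m. ?z w k)) \<partial>(gauss_seq n)) \<le> 1" for m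
  proof (induction m)
    case 0
    then show ?case
      using prob_space.emeasure_space_1[OF ps] by simp
  next
    case (Suc m)
    let ?k = "Suc m"
    have k: "?k \<in> {1..n}" using Suc.prems by auto
    have "(\<integral>\<^sup>+w. ennreal (exp (\<Sum>k=1..?k. ?z w k)) \<partial>(gauss_seq n))
        = (\<integral>\<^sup>+w. (\<integral>\<^sup>+x. ennreal (exp (\<Sum>k=1..?k. ?z (w(?k := x)) k)) \<partial>gauss) \<partial>(gauss_seq n))"
      using Suc.prems
      by (intro resample[OF k] measurable_compose[OF _ measurable_ennreal] borel_measurable_exp
          measurable_compose[OF _ borel_measurable_exp] borel_measurable_sum zm) auto
    also have "\<dots> \<le> (\<integral>\<^sup>+w. ennreal (exp (\<Sum>k=1..m. ?z w k)) \<partial>(gauss_seq n))"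
    proof (rule nn_integral_mono)
      fix w :: "nat \<Rightarrow> real"
      have e: "(\<Sum>k=1..?k. ?z (w(?k := x)) k) = (\<Sum>k=1..m. ?z w k)
          + (a ?k w * x + b ?k * (x\<^sup>2 - 1) - 2 * (a ?k w)\<^sup>2 - 16 * (b ?k)\<^sup>2)" for x
      proof -
        have "a k (w(?k := x)) = a k w" if "k \<in> {1..?k}" for k
          using that Suc.prems by (intro au) auto
        then have "(\<Sum>k=1..m. ?z (w(?k := x)) k) = (\<Sum>k=1..m. ?z w k)"
            and "a ?k (w(?k := x)) = a ?k w"
          by (auto intro!: sum.cong)
        then show ?thesis by simp
      qed
      have "(\<integral>\<^sup>+x. ennreal (exp (\<Sum>k=1..?k. ?z (w(?k := x)) k)) \<partial>gauss)
          = (\<integral>\<^sup>+x. ennreal (exp (\<Sum>k=1..m. ?z w k)) * ennreal (exp (a ?k w * x + b ?k * (x\<^sup>2 - 1)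
              - 2 * (a ?k w)\<^sup>2 - 16 * (b ?k)\<^sup>2)) \<partial>gauss)"
        by (simp only: e exp_add ennreal_mult exp_ge_zero)
      also have "\<dots> = ennreal (exp (\<Sum>k=1..m. ?z w k)) * (\<integral>\<^sup>+x. ennreal (exp (a ?k w * x + b ?k * (x\<^sup>2 - 1)
              - 2 * (a ?k w)\<^sup>2 - 16 * (b ?k)\<^sup>2)) \<partial>gauss)"
        by (rule nn_integral_cmult) measurable
      also have "\<dots> \<le> ennreal (exp (\<Sum>k=1..m. ?z w k)) * 1"
        by (intro mult_left_mono gauss_exp_le b k) auto
      finally show "(\<integral>\<^sup>+x. ennreal (exp (\<Sum>k=1..?k. ?z (w(?k := x)) k)) \<partial>gauss)
          \<le> ennreal (exp (\<Sum>k=1..m. ?z w k))" by simp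
    qed
    also have "\<dots> \<le> 1" using Suc by simp
    finally show ?case .
  qed
  then show ?thesis by blast
qed

definition lin_quad :: "nat \<Rightarrow> (nat \<Rightarrow> (nat \<Rightarrow> real) \<Rightarrow> real) \<Rightarrow> (nat \<Rightarrow> real) \<Rightarrow> (nat \<Rightarrow> real) \<Rightarrow> real" where
  "lin_quad n a b w = (\<Sum>k=1..n. a k w * w k + b k * ((w k)\<^sup>2 - 1))"

lemma lin_quad_scale:
  "lin_quad n (\<lambda>k w. t * a k w) (\<lambda>k. t * b k) w = t * lin_quad n a b w"
  by (simp add: lin_quad_def sum_distrib_left algebra_simps)

text \<open>The compensator for which exp (\<open>lin_quad\<close> - \<open>lin_quad_var\<close>)
  has integral at most 1; up to constants it is the sum of conditional variances.\<close>

definition lin_quad_var :: "nat \<Rightarrow> (nat \<Rightarrow> (nat \<Rightarrow> real) \<Rightarrow> real) \<Rightarrow> (nat \<Rightarrow> real) \<Rightarrow> (nat \<Rightarrow> real) \<Rightarrow> real" where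
  "lin_quad_var n a b w = (\<Sum>k=1..n. 2 * (a k w)\<^sup>2 + 16 * (b k)\<^sup>2)"

lemma lin_quad_var_scale:
  "lin_quad_var n (\<lambda>k w. t * a k w) (\<lambda>k. t * b k) w = t\<^sup>2 * lin_quad_var n a b w"
  by (simp add: lin_quad_var_def sum_distrib_left algebra_simps)

section \<open>Tails and second moments of predictable Gaussian sums\<close>

locale gaussian_noise = prob_space M for M :: "'a measure" +
  fixes \<xi> :: "nat \<Rightarrow> 'a \<Rightarrow> real"
  assumes indep: "indep_vars (\<lambda>_. borel) \<xi> {1..}"
    and dist_normal: "\<And>k. 1 \<le> k \<Longrightarrow> distributed M lborel (\<xi> k) (\<lambda>x. ennreal (std_normal_density x))"
begin

abbreviation noise :: "'a \<Rightarrow> nat \<Rightarrow> real" where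
  "noise w \<equiv> (\<lambda>k. \<xi> k w)"

lemma measurable_noise: "1 \<le> k \<Longrightarrow> \<xi> k \<in> borel_measurable M"
  using distributed_measurable[OF dist_normal[of k]] by simp

lemma measurable_noise_restrict:
  "(\<lambda>w. restrict (noise w) {1..n}) \<in> measurable M (PiM {1..n} (\<lambda>_. borel))"
  by (intro measurable_restrict measurable_noise) auto

lemma predictable_restrict:
  "predictable n a \<Longrightarrow> k \<in> {1..n} \<Longrightarrow> a k (restrict w {1..n}) = a k w"
  unfolding predictable_def by (drule bspec, assumption) (auto simp: restrict_def)

lemma measurable_predictable:
  assumes "predictable n a" "k \<in> {1..n}"
  shows "(\<lambda>w. a k (noise w)) \<in> borel_measurable M"
proof -
  have "a k \<in> borel_measurable (PiM {1..n} (\<lambda>_. borel))"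
    using assms by (auto simp: predictable_def)
  from measurable_compose[OF measurable_noise_restrict this] show ?thesis
    unfolding predictable_restrict[OF assms] .
qed

lemma measurable_lin_quad:
  "predictable n a \<Longrightarrow> (\<lambda>w. lin_quad n a b (noise w)) \<in> borel_measurable M"
  unfolding lin_quad_def
  by (intro borel_measurable_sum borel_measurable_add borel_measurable_times borel_measurable_diff
      borel_measurable_power measurable_predictable measurable_noise borel_measurable_const) auto

lemma measurable_lin_quad_var:
  "predictable n a \<Longrightarrow> (\<lambda>w. lin_quad_var n a b (noise w)) \<in> borel_measurable M"
  unfolding lin_quad_var_def
  by (intro borel_measurable_sum borel_measurable_add borel_measurable_times
      borel_measurable_power measurable_predictable borel_measurable_const) auto

lemma distr_noise:
  assumes "1 \<le> n"
  shows "distr M (PiM {1..n} (\<lambda>_. borel)) (\<lambda>w. restrict (noise w) {1..n}) = gauss_seq n"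
proof -
  have iv: "indep_vars (\<lambda>_. borel) \<xi> {1..n}"
    using indep by (rule indep_vars_subset) auto
  have "distr M (PiM {1..n} (\<lambda>_. borel)) (\<lambda>w. \<lambda>i\<in>{1..n}. \<xi> i w)
      = (\<Pi>\<^sub>M i\<in>{1..n}. distr M borel (\<xi> i))"
    using indep_vars_iff_distr_eq_PiM'[of "{1..n}" \<xi> "\<lambda>_. borel"] iv assms
    by (auto simp: measurable_noise)
  also have "\<dots> = gauss_seq n"
  proof -
    have "distr M borel (\<xi> i) = gauss" if "i \<in> {1..n}" for i
    proof -
      have "distr M borel (\<xi> i) = distr M lborel (\<xi> i)"
        by (rule distr_cong) auto
      also have "\<dots> = gauss"
        using that distributed_distr_eq_density[OF dist_normal[of i]] by (simp add: gauss_def)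
      finally show ?thesis .
    qed
    then show ?thesis
      unfolding gauss_seq_def by (intro PiM_cong) auto
  qed
  finally show ?thesis by (simp add: restrict_def)
qed

lemma exp_lin_quad_le:
  assumes a: "predictable n a" and b: "\<And>k. k \<in> {1..n} \<Longrightarrow> \<bar>b k\<bar> \<le> 1 / 8"
  shows "(\<integral>\<^sup>+w. ennreal (exp (lin_quad n a b (noise w) - lin_quad_var n a b (noise w))) \<partial>M) \<le> 1"
proof (cases "n = 0")
  case True
  then show ?thesis
    by (simp add: lin_quad_def lin_quad_var_def emeasure_space_1)
next
  case False
  let ?F = "\<lambda>w. exp (\<Sum>k=1..n. a k w * w k + b k * ((w k)\<^sup>2 - 1) - 2 * (a k w)\<^sup>2 - 16 * (b k)\<^sup>2)"
  have "(\<lambda>w. a k w) \<in> borel_measurable (PiM {1..n} (\<lambda>_. borel))" if "k \<in> {1..n}" for k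
    using a that by (auto simp: predictable_def)
  moreover have "(\<lambda>w. w k) \<in> borel_measurable (PiM {1..n} (\<lambda>_. borel))" if "k \<in> {1..n}" for k
    using that by (rule measurable_component_singleton)
  ultimately have m: "(\<lambda>w. ennreal (?F w)) \<in> borel_measurable (PiM {1..n} (\<lambda>_. borel))"
    by (intro measurable_compose[OF _ measurable_ennreal] measurable_compose[OF _ borel_measurable_exp]
        borel_measurable_sum borel_measurable_add borel_measurable_times borel_measurable_diff
        borel_measurable_power borel_measurable_const) auto
  have eq: "?F (restrict w {1..n}) = exp (lin_quad n a b w - lin_quad_var n a b w)" for w
    unfolding lin_quad_def lin_quad_var_def sum_subtractf[symmetric]
    by (intro arg_cong[where f = exp] sum.cong refl)
      (simp only: predictable_restrict[OF a] restrict_apply' diff_diff_eq)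
  have "(\<integral>\<^sup>+w. ennreal (exp (lin_quad n a b (noise w) - lin_quad_var n a b (noise w))) \<partial>M)
      = (\<integral>\<^sup>+w. ennreal (?F (restrict (noise w) {1..n})) \<partial>M)"
    by (simp only: eq)
  also have "\<dots> = (\<integral>\<^sup>+w. ennreal (?F w) \<partial>distr M (PiM {1..n} (\<lambda>_. borel)) (\<lambda>w. restrict (noise w) {1..n}))"
    using m by (intro nn_integral_distr[symmetric] measurable_noise_restrict) simp
  also have "\<dots> \<le> 1"
    using False by (subst distr_noise) (simp, rule exp_supermartingale[OF a b])
  finally show ?thesis .
qed

text \<open>Chernoff's bound with a random compensator: intersecting with the event that it is at
  most \<open>v\<close> replaces it by a constant.\<close>

lemma exp_tail:
  fixes x v :: real
  assumes a: "predictable n a" and b: "\<And>k. k \<in> {1..n} \<Longrightarrow> \<bar>b k\<bar> \<le> 1 / 8"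
  defines "A \<equiv> {w\<in>space M. x \<le> lin_quad n a b (noise w) \<and> lin_quad_var n a b (noise w) \<le> v}"
  shows "A \<in> sets M" "emeasure M A \<le> ennreal (exp (v - x))"
proof -
  note [measurable] = measurable_lin_quad[OF a] measurable_lin_quad_var[OF a]
  show A [measurable]: "A \<in> sets M"
    unfolding A_def by measurable
  let ?F = "\<lambda>w. exp (lin_quad n a b (noise w) - lin_quad_var n a b (noise w))"
  have "emeasure M A = (\<integral>\<^sup>+w. indicator A w \<partial>M)" by simp
  also have "\<dots> \<le> (\<integral>\<^sup>+w. ennreal (exp (v - x)) * ennreal (?F w) \<partial>M)"
  proof (rule nn_integral_mono)
    fix w
    have "1 \<le> exp (v - x) * ?F w" if "w \<in> A"
      using that unfolding A_def exp_add[symmetric] by simp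
    then show "indicator A w \<le> ennreal (exp (v - x)) * ennreal (?F w)"
      by (auto simp: indicator_def ennreal_mult[symmetric])
  qed
  also have "\<dots> = ennreal (exp (v - x)) * (\<integral>\<^sup>+w. ennreal (?F w) \<partial>M)"
    by (rule nn_integral_cmult) measurable
  also have "\<dots> \<le> ennreal (exp (v - x)) * 1"
    by (intro mult_left_mono exp_lin_quad_le a b) auto
  finally show "emeasure M A \<le> ennreal (exp (v - x))" by simp
qed

text \<open>The scale \<open>t\<close> stays free, to be optimised at each use; the two signs of the
  sum are covered by the weights scaled with t and with -t.\<close>

lemma lin_quad_tail:
  fixes x v :: real
  assumes a: "predictable n a" and t: "0 < t" and b: "\<And>k. k \<in> {1..n} \<Longrightarrow> \<bar>t * b k\<bar> \<le> 1 / 8"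
  defines "A \<equiv> {w\<in>space M. x \<le> \<bar>lin_quad n a b (noise w)\<bar> \<and> lin_quad_var n a b (noise w) \<le> v}"
  shows "A \<in> sets M" "emeasure M A \<le> ennreal (2 * exp (t\<^sup>2 * v - t * x))"
proof -
  note [measurable] = measurable_lin_quad[OF a] measurable_lin_quad_var[OF a]
  show A [measurable]: "A \<in> sets M"
    unfolding A_def by measurable
  define B where "B s = {w\<in>space M. t * x \<le> lin_quad n (\<lambda>k w. s * t * a k w) (\<lambda>k. s * t * b k) (noise w)
      \<and> lin_quad_var n (\<lambda>k w. s * t * a k w) (\<lambda>k. s * t * b k) (noise w) \<le> t\<^sup>2 * v}" for s
  have "B s \<in> sets M" "emeasure M (B s) \<le> ennreal (exp (t\<^sup>2 * v - t * x))" if "\<bar>s\<bar> = 1" for s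
  proof -
    have bb: "\<bar>s * t * b k\<bar> \<le> 1 / 8" if "k \<in> {1..n}" for k
      using b[OF that] \<open>\<bar>s\<bar> = 1\<close> by (simp add: abs_mult)
    show "B s \<in> sets M" "emeasure M (B s) \<le> ennreal (exp (t\<^sup>2 * v - t * x))"
      unfolding B_def by (intro exp_tail predictable_cmult a bb; simp)+
  qed
  note B = this[of 1] this[of "-1"]
  have "A \<subseteq> B 1 \<union> B (- 1)"
  proof
    fix w assume w: "w \<in> A"
    have v: "t\<^sup>2 * lin_quad_var n a b (noise w) \<le> t\<^sup>2 * v"
      using w by (intro mult_left_mono) (auto simp: A_def)
    have "t * x \<le> t * \<bar>lin_quad n a b (noise w)\<bar>"
      using w t by (auto simp: A_def)
    then consider "t * x \<le> t * lin_quad n a b (noise w)" | "t * x \<le> - t * lin_quad n a b (noise w)"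
      by (cases "0 \<le> lin_quad n a b (noise w)") auto
    then show "w \<in> B 1 \<union> B (- 1)"
      using w v lin_quad_scale[of n t a b] lin_quad_scale[of n "- t" a b]
        lin_quad_var_scale[of n t a b] lin_quad_var_scale[of n "- t" a b]
      by cases (auto simp: A_def B_def)
  qed
  then have "emeasure M A \<le> emeasure M (B 1) + emeasure M (B (- 1))"
    using B by (intro order_trans[OF emeasure_mono emeasure_subadditive]) auto
  also have "\<dots> \<le> ennreal (exp (t\<^sup>2 * v - t * x)) + ennreal (exp (t\<^sup>2 * v - t * x))"
    using B by (intro add_mono) auto
  finally show "emeasure M A \<le> ennreal (2 * exp (t\<^sup>2 * v - t * x))"
    by (simp add: ennreal_plus[symmetric] del: ennreal_plus)
qed

lemma lin_quad_tail_sqrt: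
  assumes a: "predictable n a" and b: "\<And>k. k \<in> {1..n} \<Longrightarrow> \<bar>b k\<bar> \<le> 1"
    and l: "0 < l" and V: "64 * l \<le> V"
  defines "A \<equiv> {w\<in>space M. 3 * sqrt (V * l) \<le> \<bar>lin_quad n a b (noise w)\<bar> \<and> lin_quad_var n a b (noise w) \<le> V}"
  shows "A \<in> sets M" "emeasure M A \<le> ennreal (2 * exp (- 2 * l))"
proof -
  \<comment> \<open>This choice turns t^2 V - 3 t sqrt (V l) into l - 3l, and 64 l \<le> V is
    exactly t \<le> 1/8.\<close>
  define t where "t = sqrt (l / V)"
  have V0: "0 < V" using l V by linarith
  have t: "0 < t" using l V0 by (simp add: t_def)
  have "l / V \<le> 1 / 64"
    using V V0 by (simp add: field_simps)
  then have "t \<le> sqrt (1 / 64)"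
    unfolding t_def by (rule real_sqrt_le_mono)
  also have "sqrt (1 / 64) = sqrt ((1 / 8)\<^sup>2)"
    by (simp add: power2_eq_square)
  also have "\<dots> = 1 / 8" by (rule real_sqrt_unique) auto
  finally have t8: "t \<le> 1 / 8" .
  have tb: "\<bar>t * b k\<bar> \<le> 1 / 8" if "k \<in> {1..n}" for k
    using mult_mono[OF t8 b[OF that]] t by (simp add: abs_mult)
  have "t\<^sup>2 * V = l"
    using l V0 by (simp add: t_def)
  moreover have "t * (3 * sqrt (V * l)) = 3 * l"
    using l V0 by (simp add: t_def real_sqrt_mult[symmetric])
  ultimately have e: "t\<^sup>2 * V - t * (3 * sqrt (V * l)) = - 2 * l" by simp
  show "A \<in> sets M" "emeasure M A \<le> ennreal (2 * exp (- 2 * l))"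
    using lin_quad_tail[OF a t tb, where x = "3 * sqrt (V * l)" and v = V] unfolding A_def e by auto
qed

lemma lin_tail:
  assumes a: "predictable n a" and c: "0 < c" and x: "0 < x"
    and var: "\<And>w. (\<Sum>k=1..n. (a k w)\<^sup>2) \<le> c"
  defines "A \<equiv> {w\<in>space M. x \<le> \<bar>lin_quad n a (\<lambda>_. 0) (noise w)\<bar>}"
  shows "A \<in> sets M" "emeasure M A \<le> ennreal (2 * exp (- x\<^sup>2 / (8 * c)))"
proof -
  have v: "lin_quad_var n a (\<lambda>_. 0) w \<le> 2 * c" for w
    using var[of w] by (simp add: lin_quad_var_def sum_distrib_left[symmetric])
  \<comment> \<open>The minimiser of 2 c t^2 - t x.\<close>
  define t where "t = x / (4 * c)"
  have t: "0 < t" using c x by (simp add: t_def)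
  have e: "t\<^sup>2 * (2 * c) - t * x = - x\<^sup>2 / (8 * c)"
    using c by (simp add: t_def field_simps power2_eq_square)
  show "A \<in> sets M" "emeasure M A \<le> ennreal (2 * exp (- x\<^sup>2 / (8 * c)))"
    using lin_quad_tail[OF a t, where b = "\<lambda>_. 0" and x = x and v = "2 * c"] unfolding A_def e by (auto simp: v)
qed

lemma square_le_exp: "x\<^sup>2 \<le> 2 * (exp x + exp (- x))" for x :: real
proof -
  have "1 + \<bar>x\<bar> + \<bar>x\<bar>\<^sup>2 / 2 \<le> exp \<bar>x\<bar>"
    by (rule exp_lower_Taylor_quadratic) simp
  moreover have "exp \<bar>x\<bar> \<le> exp x + exp (- x)"
    by (cases "0 \<le> x") (auto simp: less_imp_le)
  ultimately show ?thesis by simp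
qed

text \<open>Orthogonality of the increments would give the bound \<open>c\<close>; the exponential
  moments at scale 1 / sqrt c, already at hand, give it up to the factor 4 exp 2.\<close>

lemma lin_second_moment:
  assumes a: "predictable n a" and c: "0 < c"
    and var: "\<And>w. (\<Sum>k=1..n. (a k w)\<^sup>2) \<le> c"
  shows "(\<integral>\<^sup>+w. ennreal ((lin_quad n a (\<lambda>_. 0) (noise w))\<^sup>2) \<partial>M) \<le> ennreal (4 * exp 2 * c)"
proof -
  let ?s = "\<lambda>w. lin_quad n a (\<lambda>_. 0) (noise w)"
  define t where "t = 1 / sqrt c"
  have t2: "t\<^sup>2 * c = 1"
    using c by (simp add: t_def power_divide)
  have ex: "(\<integral>\<^sup>+w. ennreal (exp (u * ?s w)) \<partial>M) \<le> ennreal (exp 2)" if "u\<^sup>2 = t\<^sup>2" for u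
  proof -
    let ?F = "\<lambda>w. exp (lin_quad n (\<lambda>k w. u * a k w) (\<lambda>_. 0) (noise w)
        - lin_quad_var n (\<lambda>k w. u * a k w) (\<lambda>_. 0) (noise w))"
    note [measurable] = measurable_lin_quad[OF predictable_cmult[OF a]]
      measurable_lin_quad_var[OF predictable_cmult[OF a]]
    have "exp (u * ?s w) \<le> exp 2 * ?F w" for w
    proof -
      have "u\<^sup>2 * lin_quad_var n a (\<lambda>_. 0) (noise w) \<le> u\<^sup>2 * (2 * c)"
        using var[of "noise w"]
        by (intro mult_left_mono) (simp_all add: lin_quad_var_def sum_distrib_left[symmetric])
      then have "u\<^sup>2 * lin_quad_var n a (\<lambda>_. 0) (noise w) \<le> 2"
        using t2 that by (simp add: mult.left_commute)
      then show ?thesis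
        using lin_quad_scale[of n u a "\<lambda>_. 0"] lin_quad_var_scale[of n u a "\<lambda>_. 0"]
        by (simp add: exp_add[symmetric])
    qed
    then have "(\<integral>\<^sup>+w. ennreal (exp (u * ?s w)) \<partial>M) \<le> (\<integral>\<^sup>+w. ennreal (exp 2) * ennreal (?F w) \<partial>M)"
      by (intro nn_integral_mono) (simp add: ennreal_mult[symmetric] ennreal_leI)
    also have "\<dots> = ennreal (exp 2) * (\<integral>\<^sup>+w. ennreal (?F w) \<partial>M)"
      by (rule nn_integral_cmult) measurable
    also have "\<dots> \<le> ennreal (exp 2) * 1"
      by (intro mult_left_mono exp_lin_quad_le predictable_cmult a) auto
    finally show ?thesis by simp
  qed
  note [measurable] = measurable_lin_quad[OF a]
  have "(?s w)\<^sup>2 \<le> 2 * c * (exp (t * ?s w) + exp (- t * ?s w))" for w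
  proof -
    have "(?s w)\<^sup>2 = c * (t * ?s w)\<^sup>2"
      using t2 by (simp add: power_mult_distrib algebra_simps)
    also have "\<dots> \<le> c * (2 * (exp (t * ?s w) + exp (- (t * ?s w))))"
      using c by (intro mult_left_mono square_le_exp) auto
    finally show ?thesis by (simp add: algebra_simps)
  qed
  then have "(\<integral>\<^sup>+w. ennreal ((?s w)\<^sup>2) \<partial>M)
      \<le> (\<integral>\<^sup>+w. ennreal (2 * c) * (ennreal (exp (t * ?s w)) + ennreal (exp (- t * ?s w))) \<partial>M)"
    using c by (intro nn_integral_mono)
      (simp add: ennreal_mult[symmetric] ennreal_plus[symmetric] ennreal_leI del: ennreal_plus)
  also have "\<dots> = ennreal (2 * c) * ((\<integral>\<^sup>+w. ennreal (exp (t * ?s w)) \<partial>M) + (\<integral>\<^sup>+w. ennreal (exp (- t * ?s w)) \<partial>M))"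
    by (subst nn_integral_cmult, measurable, subst nn_integral_add) simp_all
  also have "\<dots> \<le> ennreal (2 * c) * (ennreal (exp 2) + ennreal (exp 2))"
    by (intro mult_left_mono add_mono ex) auto
  also have "\<dots> = ennreal (4 * exp 2 * c)"
    using c by (simp add: ennreal_mult[symmetric] ennreal_plus[symmetric] algebra_simps del: ennreal_plus)
  finally show ?thesis .
qed

end

section \<open>The sequential estimator as a weighted sum\<close>

lemma kern_cases: "kern z0 n h j = 0 \<or> kern z0 n h j = 1"
  by (simp add: kern_def indicator_def)

lemma kern_nonneg [simp]: "0 \<le> kern z0 n h j"
  and kern_le_1 [simp]: "kern z0 n h j \<le> 1"
  using kern_cases[of z0 n h j] by auto

lemma energy_self [simp]: "energy z0 n h y k k = 0"
  by (simp add: energy_def)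

lemma energy_Suc:
  "k \<le> m \<Longrightarrow> energy z0 n h y k (Suc m) = energy z0 n h y k m + kern z0 n h (Suc m) * (y m)\<^sup>2"
  by (simp add: energy_def)

lemma energy_mono: "m \<le> m' \<Longrightarrow> energy z0 n h y k m \<le> energy z0 n h y k m'"
  unfolding energy_def by (intro sum_mono2) auto

lemma energy_nonneg: "0 \<le> energy z0 n h y k m"
  unfolding energy_def by (intro sum_nonneg) auto

text \<open>
  The weight of \<open>y (j - 1) * y j\<close> in the sequential estimator, times \<open>(y (j - 1))\<^sup>2\<close>.  Clipping the energy
  at \<open>H\<close> reproduces the stopping time and the correction \<open>\<kappa>\<close> without mentioning either, so that
  predictability and measurability are immediate.
\<close>

definition clip :: "real \<Rightarrow> nat \<Rightarrow> real \<Rightarrow> (nat \<Rightarrow> real) \<Rightarrow> nat \<Rightarrow> real \<Rightarrow> nat \<Rightarrow> real" where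
  "clip z0 n h y \<nu> H j = min (kern z0 n h j * (y (j - 1))\<^sup>2) (max 0 (H - energy z0 n h y \<nu> (j - 1)))"

lemma clip_nonneg [simp]: "0 \<le> clip z0 n h y \<nu> H j"
  by (simp add: clip_def)

lemma clip_le: "clip z0 n h y \<nu> H j \<le> kern z0 n h j * (y (j - 1))\<^sup>2"
  by (simp add: clip_def)

text \<open>The summands are the increments of the energy truncated at \<open>H\<close>.\<close>

lemma sum_clip:
  assumes "0 \<le> H" "\<nu> \<le> m"
  shows "(\<Sum>j=\<nu>+1..m. clip z0 n h y \<nu> H j) = min (energy z0 n h y \<nu> m) H"
  using assms(2)
proof (induction m rule: dec_induct)
  case base
  then show ?case using assms(1) by simp
next
  case (step m)
  define q where "q = kern z0 n h (Suc m) * (y m)\<^sup>2"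
  define e where "e = energy z0 n h y \<nu> m"
  have "0 \<le> q" by (simp add: q_def)
  then have "min e H + min q (max 0 (H - e)) = min (e + q) H"
    by (auto simp: min_def max_def)
  then show ?case
    using step by (simp add: energy_Suc clip_def q_def e_def)
qed

text \<open>Up to \<tau> - 1 the clipping is inactive; at \<tau> it leaves \<open>H\<close> minus
  the energy already collected, which is what \<kappa> is defined to supply; afterwards nothing is
  left.\<close>

lemma S_star_eq_clip:
  fixes z0 \<epsilon> h \<alpha> :: real and n :: nat and y :: "nat \<Rightarrow> real"
  defines "\<nu> \<equiv> nu z0 n h \<alpha>" and "H \<equiv> threshold z0 \<epsilon> n h \<alpha> y"
  assumes "\<nu> < n" "0 < H" and full: "H \<le> energy z0 n h y \<nu> n"
  shows "S_star z0 \<epsilon> n h \<alpha> y = (\<Sum>j=\<nu>+1..n. clip z0 n h y \<nu> H j / y (j - 1) * y j) / H"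
proof -
  define E where "E = energy z0 n h y \<nu>"
  define K where "K = {k. \<nu> + 1 \<le> k \<and> k \<le> n \<and> E k \<ge> H}"
  define \<tau> where "\<tau> = tau z0 \<epsilon> n h \<alpha> y"
  have "n \<in> K"
    using assms by (auto simp: K_def E_def)
  then have \<tau>: "\<tau> = Inf K"
    unfolding \<tau>_def tau_def Let_def K_def E_def \<nu>_def H_def by auto
  have \<tau>K: "\<tau> \<in> K"
    unfolding \<tau> using \<open>n \<in> K\<close> by (intro Inf_nat_def1) auto
  then have \<tau>1: "\<nu> + 1 \<le> \<tau>" "\<tau> \<le> n" "H \<le> E \<tau>"
    by (auto simp: K_def)
  have before: "E j < H" if "\<nu> \<le> j" "j < \<tau>" for j
  proof (cases "j = \<nu>")
    case True
    then show ?thesis using \<open>0 < H\<close> by (simp add: E_def)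
  next
    case False
    have "j \<notin> K"
      using that cInf_lower[of j K] unfolding \<tau> by (auto simp: bdd_below_def)
    then show ?thesis
      using that False \<tau>1 by (auto simp: K_def)
  qed
  define q where "q = kern z0 n h \<tau> * (y (\<tau> - 1))\<^sup>2"
  have E\<tau>: "E \<tau> = E (\<tau> - 1) + q"
    using energy_Suc[of \<nu> "\<tau> - 1" z0 n h y] \<tau>1(1) by (simp add: E_def q_def)
  have b: "E (\<tau> - 1) < H"
    using before[of "\<tau> - 1"] \<tau>1(1) by simp
  \<comment> \<open>Positivity rules out \<open>y (\<tau> - 1) = 0\<close>, so the divisions at
    \<tau> are genuine.\<close>
  have q: "0 < q" using b E\<tau> \<tau>1(3) by simp
  have kap: "kappa z0 \<epsilon> n h \<alpha> y = (H - E (\<tau> - 1)) / q"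
    using \<tau>1(3) unfolding kappa_def Let_def q_def E_def \<nu>_def H_def \<tau>_def by simp
  let ?t = "\<lambda>j. clip z0 n h y \<nu> H j / y (j - 1) * y j"
  have t1: "?t j = kern z0 n h j * y (j - 1) * y j" if "j \<in> {\<nu>+1..\<tau>-1}" for j
  proof -
    have "E j = E (j - 1) + kern z0 n h j * (y (j - 1))\<^sup>2"
      using energy_Suc[of \<nu> "j - 1" z0 n h y] that by (cases j) (auto simp: E_def)
    moreover have "E j < H" using before[of j] that by auto
    ultimately have "clip z0 n h y \<nu> H j = kern z0 n h j * (y (j - 1))\<^sup>2"
      by (simp add: clip_def E_def min_def)
    \<comment> \<open>For \<open>y (j - 1) = 0\<close> both sides are 0, division by zero being
      0.\<close>
    then show ?thesis by (simp add: power2_eq_square)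
  qed
  have t2: "?t \<tau> = kappa z0 \<epsilon> n h \<alpha> y * kern z0 n h \<tau> * y (\<tau> - 1) * y \<tau>"
  proof -
    have "clip z0 n h y \<nu> H \<tau> = H - E (\<tau> - 1)"
      using b E\<tau> \<tau>1(3) by (simp add: clip_def E_def q_def min_def max_def)
    moreover have "kern z0 n h \<tau> \<noteq> 0" "y (\<tau> - 1) \<noteq> 0"
      using q by (auto simp: q_def)
    ultimately show ?thesis
      unfolding kap q_def by (simp add: power2_eq_square)
  qed
  have t3: "?t j = 0" if "j \<in> {\<tau>+1..n}" for j
  proof -
    have "E \<tau> \<le> E (j - 1)"
      using that unfolding E_def by (intro energy_mono) auto
    then have "max 0 (H - E (j - 1)) = 0"
      using \<tau>1(3) by simp
    then have "clip z0 n h y \<nu> H j = 0"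
      unfolding clip_def E_def by simp
    then show ?thesis by simp
  qed
  have "{\<nu>+1..n} = {\<nu>+1..\<tau>-1} \<union> insert \<tau> {\<tau>+1..n}"
    using \<tau>1 by auto
  then have "sum ?t {\<nu>+1..n} = sum ?t {\<nu>+1..\<tau>-1} + (?t \<tau> + sum ?t {\<tau>+1..n})"
    using \<tau>1 by (simp only:) (subst sum.union_disjoint; auto)
  also have "\<dots> = (\<Sum>j=\<nu>+1..\<tau>-1. kern z0 n h j * y (j - 1) * y j)
      + kappa z0 \<epsilon> n h \<alpha> y * kern z0 n h \<tau> * y (\<tau> - 1) * y \<tau>"
  proof -
    have "sum ?t {\<nu>+1..\<tau>-1} = (\<Sum>j=\<nu>+1..\<tau>-1. kern z0 n h j * y (j - 1) * y j)"
      by (rule sum.cong[OF refl t1])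
    moreover have "sum ?t {\<tau>+1..n} = 0"
      by (rule sum.neutral) (use t3 in blast)
    ultimately show ?thesis using t2 by simp
  qed
  finally show ?thesis
    using full unfolding S_star_def Let_def \<nu>_def H_def \<tau>_def by simp
qed

lemma S_star_zero:
  "energy z0 n h y (nu z0 n h \<alpha>) n < threshold z0 \<epsilon> n h \<alpha> y \<Longrightarrow> S_star z0 \<epsilon> n h \<alpha> y = 0"
  by (simp add: S_star_def Let_def)

section \<open>Regularity of the regression function\<close>

lemma stable_has_deriv:
  assumes "S \<in> stable_set \<epsilon> L" "x \<in> {0..1}"
  shows "(S has_vector_derivative deriv01 S x) (at x within {0..1})"
  using assms by (auto simp: stable_set_def differentiable_on_def deriv01_def vector_derivative_works)

lemma stable_lipschitz:
  assumes "S \<in> stable_set \<epsilon> L" "x \<in> {0..1}" "x' \<in> {0..1}"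
  shows "\<bar>S x - S x'\<bar> \<le> L * \<bar>x - x'\<bar>"
proof -
  have "norm (S x - S x') \<le> L * norm (x - x')"
  proof (rule field_differentiable_bound[of "{0..1}" S "deriv01 S"])
    fix t :: real assume t: "t \<in> {0..1}"
    show "(S has_field_derivative deriv01 S t) (at t within {0..1})"
      using stable_has_deriv[OF assms(1) t]
      by (simp add: has_real_derivative_iff_has_vector_derivative)
    show "norm (deriv01 S t) \<le> L"
      using assms(1) t by (auto simp: stable_set_def)
  qed (use assms in auto)
  then show ?thesis by simp
qed

lemma holder_taylor:
  assumes S: "S \<in> holder_class z0 \<beta> \<epsilon> L Ls" and z0: "z0 \<in> {0..1}" and x: "x \<in> {0..1}"
    and \<beta>: "1 < \<beta>" and Ls: "0 \<le> Ls"
  shows "\<bar>S x - S z0 - (x - z0) * deriv01 S z0\<bar> \<le> Ls * \<bar>x - z0\<bar> powr \<beta>"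
proof -
  have st: "S \<in> stable_set \<epsilon> L"
    using S by (simp add: holder_class_def)
  have seg: "closed_segment z0 x \<subseteq> {0..1}"
    using z0 x by (intro closed_segment_subset) auto
  have "norm (S x - S z0 - (x - z0) *\<^sub>R deriv01 S z0) \<le> norm (x - z0) * (Ls * \<bar>x - z0\<bar> powr (\<beta> - 1))"
  proof (rule vector_differentiable_bound_linearization[where S = "closed_segment z0 x" and f' = "deriv01 S"])
    fix t assume t: "t \<in> closed_segment z0 x"
    then have t01: "t \<in> {0..1}" using seg by blast
    show "(S has_vector_derivative deriv01 S t) (at t within closed_segment z0 x)"
      using stable_has_deriv[OF st t01] seg by (rule has_vector_derivative_within_subset)
    show "norm (deriv01 S t - deriv01 S z0) \<le> Ls * \<bar>x - z0\<bar> powr (\<beta> - 1)"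
    proof (cases "t = z0")
      case True
      then show ?thesis using Ls by simp
    next
      case False
      then have "\<bar>deriv01 S t - deriv01 S z0\<bar> / \<bar>t - z0\<bar> powr (\<beta> - 1) \<le> Ls"
        using S t01 by (auto simp: holder_class_def)
      then have "\<bar>deriv01 S t - deriv01 S z0\<bar> \<le> Ls * \<bar>t - z0\<bar> powr (\<beta> - 1)"
        using False by (simp add: pos_divide_le_eq)
      also have "\<bar>t - z0\<bar> \<le> \<bar>x - z0\<bar>"
        using t by (auto simp: closed_segment_eq_real_ivl split: if_splits)
      then have "Ls * \<bar>t - z0\<bar> powr (\<beta> - 1) \<le> Ls * \<bar>x - z0\<bar> powr (\<beta> - 1)"
        using \<beta> Ls by (intro mult_left_mono powr_mono2) auto
      finally show ?thesis by simp
    qed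
  qed auto
  also have "\<dots> = Ls * \<bar>x - z0\<bar> powr \<beta>"
    by (cases "x = z0") (simp_all add: powr_diff)
  finally show ?thesis by simp
qed

section \<open>Energies over the window, for a fixed realisation\<close>

text \<open>Abel summation: the weights have total variation at most 2, so the telescoping squares
  contribute a multiple of \<open>Y\<close> that does not grow with the window. The induction
  carries the boundary term \<open>g k * v k\<close>, so that each step adds a single
  variation.\<close>

lemma summation_by_parts_bound:
  fixes g v :: "nat \<Rightarrow> real"
  assumes lm: "1 \<le> l" "l \<le> m" and v: "\<And>j. j \<le> m \<Longrightarrow> 0 \<le> v j \<and> v j \<le> Y"
    and g: "\<And>j. j \<in> {l..m} \<Longrightarrow> \<bar>g j\<bar> \<le> 1"
    and D: "\<And>j. j \<in> {l..<m} \<Longrightarrow> \<bar>g (Suc j) - g j\<bar> \<le> D" and D2: "D * real (m - l) \<le> 2"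
  shows "\<bar>\<Sum>j=l..m. g j * (v (j - 1) - v j)\<bar> \<le> 4 * Y"
proof -
  have "k \<le> m \<Longrightarrow> \<bar>(\<Sum>j=l..k. g j * (v (j - 1) - v j)) + g k * v k\<bar> \<le> Y * (1 + D * real (k - l))" if "l \<le> k" for k
    using that
  proof (induction k rule: dec_induct)
    case base
    have "\<bar>g l * v (l - 1)\<bar> \<le> 1 * Y"
      using v[of "l - 1"] g[of l] lm unfolding abs_mult by (intro mult_mono) auto
    then show ?case by (simp add: algebra_simps)
  next
    case (step k)
    have "\<bar>(g (Suc k) - g k) * v k\<bar> \<le> D * Y"
      using v[of k] D[of k] step unfolding abs_mult by (intro mult_mono) auto
    moreover have "(\<Sum>j=l..Suc k. g j * (v (j - 1) - v j)) + g (Suc k) * v (Suc k)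
        = ((\<Sum>j=l..k. g j * (v (j - 1) - v j)) + g k * v k) + (g (Suc k) - g k) * v k"
      using step by (simp add: algebra_simps)
    moreover have "Y * (1 + D * real (Suc k - l)) = Y * (1 + D * real (k - l)) + D * Y"
      using step by (simp add: Suc_diff_le algebra_simps)
    ultimately show ?case
      using step by linarith
  qed
  from this[OF lm(2)] have "\<bar>(\<Sum>j=l..m. g j * (v (j - 1) - v j)) + g m * v m\<bar> \<le> Y * (1 + D * real (m - l))"
    by simp
  also have "\<dots> \<le> Y * 3"
    using D2 v[of 0] by (intro mult_left_mono) auto
  finally have "\<bar>(\<Sum>j=l..m. g j * (v (j - 1) - v j)) + g m * v m\<bar> \<le> Y * 3" .
  moreover have "\<bar>g m * v m\<bar> \<le> 1 * Y"
    using v[of m] g[of m] lm unfolding abs_mult by (intro mult_mono) auto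
  ultimately show ?thesis by linarith
qed

text \<open>Only the midpoint of the interval enters. For the window it differs from n z0 by at most
  1, which makes the linear weights nearly cancel.\<close>

lemma sum_interval_minus_const:
  "l \<le> m \<Longrightarrow> (\<Sum>j=l..m. real j - c) = (real m - real l + 1) * ((real l + real m) / 2 - c)"
proof (induction m rule: dec_induct)
  case (step m)
  then show ?case by (simp add: field_simps)
qed (simp add: field_simps)

text \<open>One realisation is fixed here, with noise \<open>z\<close> and a bound \<open>Y\<close>
  on the squared observations. Probability returns later, through bounds on a few sums over
  \<open>z\<close>.\<close>

locale regression_window =
  fixes z0 \<epsilon> L h Y :: real and n :: nat and S :: "real \<Rightarrow> real" and y z :: "nat \<Rightarrow> real"
  assumes h: "0 < h" "0 < z0 - h" "z0 + h \<le> 1" and n: "0 < n"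
    and eps: "0 < \<epsilon>" "\<epsilon> < 1" and L: "0 \<le> L"
    and S_bound: "\<And>x. x \<in> {0..1} \<Longrightarrow> \<bar>S x\<bar> \<le> 1 - \<epsilon>"
    and S_lip: "\<And>x. x \<in> {0..1} \<Longrightarrow> \<bar>S x - S z0\<bar> \<le> L * \<bar>x - z0\<bar>"
    and y_rec: "\<And>j. j \<in> {1..n} \<Longrightarrow> y j = S (real j / real n) * y (j - 1) + z j"
    and y_bound: "\<And>j. j \<le> n \<Longrightarrow> (y j)\<^sup>2 \<le> Y"
begin

definition P where "P = real n * h"
definition q where "q = kern z0 n h"
definition lo where "lo = nat \<lceil>real n * z0 - P\<rceil>"
definition hi where "hi = nat \<lfloor>real n * z0 + P\<rfloor>"
text \<open>Its reciprocal is the stationary variance of the autoregression with constant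
  coefficient S(z0), so the energy of the window is close to 2P / \<delta>.\<close>

definition \<delta> where "\<delta> = 1 - (S z0)\<^sup>2"

lemma z0_in: "z0 \<in> {0..1}" using h by auto

lemma P_pos: "0 < P" using h n by (simp add: P_def)

lemma P_lt: "P < real n * z0"
  using h n by (simp add: P_def)

lemma lo_bounds: "real n * z0 - P \<le> real lo" "real lo < real n * z0 - P + 1" "1 \<le> lo"
  using P_lt unfolding lo_def by linarith+

lemma hi_bounds: "real hi \<le> real n * z0 + P" "real n * z0 + P < real hi + 1" "hi \<le> n"
proof -
  show 1: "real hi \<le> real n * z0 + P" "real n * z0 + P < real hi + 1"
    using P_pos P_lt unfolding hi_def by linarith+
  have "real n * z0 + P = real n * (z0 + h)"
    by (simp add: P_def algebra_simps)
  also have "\<dots> \<le> real n * 1"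
    using h by (intro mult_left_mono) auto
  finally show "hi \<le> n" using 1 by linarith
qed

lemma q_eq: "q j = (if lo \<le> j \<and> j \<le> hi then 1 else 0)"
proof -
  have "-1 \<le> (real j / real n - z0) / h \<longleftrightarrow> real n * z0 - P \<le> real j"
    using h n by (simp add: P_def field_simps)
  also have "\<dots> \<longleftrightarrow> lo \<le> j"
    using lo_bounds by linarith
  finally have 1: "-1 \<le> (real j / real n - z0) / h \<longleftrightarrow> lo \<le> j" .
  have "(real j / real n - z0) / h \<le> 1 \<longleftrightarrow> real j \<le> real n * z0 + P"
    using h n by (simp add: P_def field_simps)
  also have "\<dots> \<longleftrightarrow> j \<le> hi"
    using hi_bounds by linarith
  finally have 2: "(real j / real n - z0) / h \<le> 1 \<longleftrightarrow> j \<le> hi" .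
  show ?thesis using 1 2 by (simp add: q_def kern_def indicator_def)
qed

lemma window_dist: "lo \<le> j \<Longrightarrow> j \<le> hi \<Longrightarrow> \<bar>real j / real n - z0\<bar> \<le> h"
  using h n lo_bounds(1) hi_bounds(1) unfolding abs_le_iff P_def by (simp add: field_simps)

lemma delta_bounds: "\<epsilon> \<le> \<delta>" "\<delta> \<le> 1"
proof -
  have "\<bar>S z0\<bar>\<^sup>2 \<le> (1 - \<epsilon>)\<^sup>2"
    using S_bound[OF z0_in] by (intro power_mono) auto
  moreover have "(1 - \<epsilon>)\<^sup>2 \<le> 1 - \<epsilon>"
    using eps by (simp add: power2_eq_square mult_left_le)
  ultimately show "\<epsilon> \<le> \<delta>" by (simp add: \<delta>_def)
qed (simp add: \<delta>_def)

lemma S_diff: "j \<in> {lo..hi} \<Longrightarrow> \<bar>S (real j / real n) - S z0\<bar> \<le> L * h"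
proof -
  assume j: "j \<in> {lo..hi}"
  have "real j / real n \<in> {0..1}"
    using j hi_bounds(3) n by auto
  from S_lip[OF this] have "\<bar>S (real j / real n) - S z0\<bar> \<le> L * \<bar>real j / real n - z0\<bar>" .
  also have "\<dots> \<le> L * h"
    using j L by (intro mult_left_mono window_dist) auto
  finally show ?thesis .
qed

text \<open>The noise left after squaring the recursion and weighting it with \<open>g\<close>: a
  linear-quadratic form whose linear weights are predictable.\<close>

abbreviation R :: "(nat \<Rightarrow> real) \<Rightarrow> real" where
  "R g \<equiv> (\<Sum>j=1..n. 2 * g j * S (real j / real n) * y (j - 1) * z j + g j * ((z j)\<^sup>2 - 1))"

text \<open>The telescoping squares are handled by Abel summation. The drift of S^2 across the
  window costs 2 L h times the energy of the window itself, which is not yet bounded and therefore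
  stays on the right.\<close>

lemma weighted_energy:
  assumes m: "lo \<le> m" "m \<le> hi" and out: "\<And>j. j \<notin> {lo..m} \<Longrightarrow> g j = 0"
    and g: "\<And>j. j \<in> {lo..m} \<Longrightarrow> \<bar>g j\<bar> \<le> 1"
    and D: "\<And>j. j \<in> {lo..<m} \<Longrightarrow> \<bar>g (Suc j) - g j\<bar> \<le> D" and D2: "D * real (m - lo) \<le> 2"
  shows "\<bar>\<delta> * (\<Sum>j=1..n. g j * (y (j - 1))\<^sup>2) - (\<Sum>j=1..n. g j)\<bar>
           \<le> 4 * Y + \<bar>R g\<bar> + 2 * (L * h) * energy z0 n h y 0 n"
proof -
  let ?s = "\<lambda>j. S (real j / real n)"
  have sub: "{lo..m} \<subseteq> {1..n}" using m lo_bounds(3) hi_bounds(3) by auto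
  have red: "(\<Sum>j=1..n. f j) = (\<Sum>j=lo..m. f j)" if "\<And>j. j \<notin> {lo..m} \<Longrightarrow> f j = 0" for f :: "nat \<Rightarrow> real"
    using sub that by (intro sum.mono_neutral_right) auto
  have pt: "\<delta> * (g j * (y (j - 1))\<^sup>2) - g j = g j * ((y (j - 1))\<^sup>2 - (y j)\<^sup>2)
      + (2 * g j * ?s j * y (j - 1) * z j + g j * ((z j)\<^sup>2 - 1))
      + g j * ((?s j)\<^sup>2 - (S z0)\<^sup>2) * (y (j - 1))\<^sup>2" if "j \<in> {lo..m}" for j
    using sub that unfolding \<delta>_def
    by (subst (2) y_rec) (auto simp: algebra_simps power2_eq_square)
  have "\<delta> * (\<Sum>j=1..n. g j * (y (j - 1))\<^sup>2) - (\<Sum>j=1..n. g j)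
      = (\<Sum>j=1..n. \<delta> * (g j * (y (j - 1))\<^sup>2) - g j)"
    by (simp add: sum_subtractf sum_distrib_left)
  also have "\<dots> = (\<Sum>j=lo..m. \<delta> * (g j * (y (j - 1))\<^sup>2) - g j)"
    by (rule red) (simp add: out)
  also have "\<dots> = (\<Sum>j=lo..m. g j * ((y (j - 1))\<^sup>2 - (y j)\<^sup>2)) + R g
      + (\<Sum>j=lo..m. g j * ((?s j)\<^sup>2 - (S z0)\<^sup>2) * (y (j - 1))\<^sup>2)"
  proof -
    have "R g = (\<Sum>j=lo..m. 2 * g j * ?s j * y (j - 1) * z j + g j * ((z j)\<^sup>2 - 1))"
      by (rule red) (simp add: out)
    then show ?thesis
      by (simp only: sum.cong[OF refl pt] sum.distrib)
  qed
  finally have eq: "\<delta> * (\<Sum>j=1..n. g j * (y (j - 1))\<^sup>2) - (\<Sum>j=1..n. g j)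
      = (\<Sum>j=lo..m. g j * ((y (j - 1))\<^sup>2 - (y j)\<^sup>2)) + R g
      + (\<Sum>j=lo..m. g j * ((?s j)\<^sup>2 - (S z0)\<^sup>2) * (y (j - 1))\<^sup>2)" .
  have 1: "\<bar>\<Sum>j=lo..m. g j * ((y (j - 1))\<^sup>2 - (y j)\<^sup>2)\<bar> \<le> 4 * Y"
    using m lo_bounds(3) hi_bounds(3) y_bound g D D2
    by (intro summation_by_parts_bound[where D = D and v = "\<lambda>j. (y j)\<^sup>2"]) auto
  have "\<bar>\<Sum>j=lo..m. g j * ((?s j)\<^sup>2 - (S z0)\<^sup>2) * (y (j - 1))\<^sup>2\<bar>
      \<le> (\<Sum>j=lo..m. 2 * (L * h) * (q j * (y (j - 1))\<^sup>2))"
  proof (rule order_trans[OF sum_abs sum_mono])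
    fix j assume j: "j \<in> {lo..m}"
    then have j01: "real j / real n \<in> {0..1}" using sub n by auto
    have "\<bar>?s j + S z0\<bar> \<le> 2"
      using S_bound[OF j01] S_bound[OF z0_in] eps by linarith
    moreover have "\<bar>?s j - S z0\<bar> \<le> L * h"
      using j m by (intro S_diff) auto
    ultimately have "\<bar>?s j + S z0\<bar> * \<bar>?s j - S z0\<bar> \<le> 2 * (L * h)"
      by (intro mult_mono) auto
    then have "\<bar>(?s j)\<^sup>2 - (S z0)\<^sup>2\<bar> \<le> 2 * (L * h)"
      by (simp add: abs_mult[symmetric] power2_eq_square algebra_simps)
    then have "\<bar>g j\<bar> * \<bar>(?s j)\<^sup>2 - (S z0)\<^sup>2\<bar> \<le> 1 * (2 * (L * h))"
      using g[OF j] by (intro mult_mono) auto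
    then have "\<bar>g j\<bar> * \<bar>(?s j)\<^sup>2 - (S z0)\<^sup>2\<bar> * (y (j - 1))\<^sup>2 \<le> 2 * (L * h) * (y (j - 1))\<^sup>2"
      by (intro mult_right_mono) auto
    then show "\<bar>g j * ((?s j)\<^sup>2 - (S z0)\<^sup>2) * (y (j - 1))\<^sup>2\<bar> \<le> 2 * (L * h) * (q j * (y (j - 1))\<^sup>2)"
      using j m by (simp add: abs_mult q_eq)
  qed
  also have "\<dots> = 2 * (L * h) * (\<Sum>j=lo..m. q j * (y (j - 1))\<^sup>2)"
    by (simp add: sum_distrib_left)
  also have "\<dots> \<le> 2 * (L * h) * energy z0 n h y 0 n"
  proof (rule mult_left_mono)
    show "(\<Sum>j=lo..m. q j * (y (j - 1))\<^sup>2) \<le> energy z0 n h y 0 n"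
      unfolding energy_def add_0 q_def[symmetric] using sub
      by (intro sum_mono2) (auto simp: q_def)
  qed (use L h in auto)
  finally show ?thesis using eq 1 by linarith
qed

end

lemma clamp_dist: "a \<le> x \<Longrightarrow> x \<le> b \<Longrightarrow> \<bar>min (max t a) b - x\<bar> \<le> \<bar>t - x\<bar>" for a b t x :: real
  by linarith

context regression_window
begin

text \<open>A bootstrap with the weight \<open>q\<close>: as L h is small compared with \<epsilon>,
  the drift term is absorbed on the left, which first gives energy at most 6P / \<epsilon>;
  inserting this makes the drift term itself of order e P.\<close>

lemma weighted_energy_q:
  assumes small: "4 * Y + r + 10 \<le> \<rho> * e\<^sup>2 * P" "L * h \<le> \<rho> * e"
    and e: "0 < e" "e \<le> 1 / 2" and \<rho>: "\<rho> = \<epsilon> / 50"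
    and R: "\<bar>R q\<bar> \<le> r"
  shows "10 \<le> P" "\<bar>\<delta> * energy z0 n h y 0 n - 2 * P\<bar> \<le> 13 * (\<rho> * e * P / \<epsilon>)"
    "4 * Y + r + 2 * (L * h) * energy z0 n h y 0 n + 3 \<le> 13 * (\<rho> * e * P / \<epsilon>)"
proof -
  define A where "A = energy z0 n h y 0 n"
  \<comment> \<open>The unit of error. The 50 in \<rho> makes it e P / 50, so that 13 T, the error
    of each energy, is about a quarter of e P.\<close>
  define T where "T = \<rho> * e * P / \<epsilon>"
  have Te: "T = e * P / 50" using eps by (simp add: T_def \<rho>)
  have Y0: "0 \<le> Y" using y_bound[of 0] by (metis le0 order_trans zero_le_power2)
  have r0: "0 \<le> r" using R by linarith
  have A0: "0 \<le> A" by (simp add: A_def energy_nonneg)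
  have \<rho>0: "0 < \<rho>" "\<rho> \<le> 1" using eps by (simp_all add: \<rho>)
  have "e\<^sup>2 \<le> e" using e by (simp add: power2_eq_square mult_left_le)
  then have "\<rho> * e\<^sup>2 * P \<le> \<rho> * e * P"
    using \<rho>0 P_pos by (intro mult_right_mono mult_left_mono) auto
  then have \<sigma>: "4 * Y + r + 10 \<le> \<epsilon> * T"
    using small eps by (simp add: T_def)
  have \<epsilon>T: "\<epsilon> * T \<le> T"
    using e P_pos eps by (intro mult_left_le_one_le) (auto simp: Te)
  have "e * P \<le> 1 / 2 * P" using e P_pos by (intro mult_right_mono) auto
  then have TP: "T \<le> P / 100" by (simp add: Te)
  show P10: "10 \<le> P" using \<sigma> \<epsilon>T TP Y0 r0 by linarith
  have lh: "lo \<le> hi"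
    using lo_bounds hi_bounds P10 by linarith
  have sumq: "(\<Sum>j=1..n. q j) = real hi - real lo + 1"
  proof -
    have "(\<Sum>j=1..n. q j) = (\<Sum>j=lo..hi. (1::real))"
      using lo_bounds(3) hi_bounds(3) by (intro sum.mono_neutral_cong_right) (auto simp: q_eq)
    then show ?thesis using lh by (simp add: of_nat_diff)
  qed
  have "\<bar>\<delta> * A - (\<Sum>j=1..n. q j)\<bar> \<le> 4 * Y + \<bar>R q\<bar> + 2 * (L * h) * A"
    unfolding A_def energy_def
    using weighted_energy[of hi q 0] lh by (simp add: q_eq energy_def q_def[symmetric])
  then have 1: "\<bar>\<delta> * A - 2 * P\<bar> \<le> 1 + 4 * Y + r + 2 * (L * h) * A"
    using R lo_bounds hi_bounds unfolding sumq by linarith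
  have LA: "2 * (L * h) * A \<le> 2 * (\<rho> * e) * A"
    using small(2) A0 by (intro mult_right_mono) auto
  have "2 * (\<rho> * e) \<le> \<epsilon> / 2"
    using e eps mult_mono[of \<rho> "\<epsilon> / 50" e "1 / 2"] \<rho>0 by (simp add: \<rho>)
  then have "2 * (\<rho> * e) * A \<le> \<epsilon> / 2 * A"
    using A0 by (intro mult_right_mono) auto
  moreover have "\<epsilon> * A \<le> \<delta> * A"
    using delta_bounds A0 by (intro mult_right_mono) auto
  ultimately have "\<epsilon> * A \<le> 6 * P"
    using 1 LA \<sigma> \<epsilon>T TP P10 by linarith
  then have "A \<le> 6 * P / \<epsilon>"
    using eps by (simp add: pos_le_divide_eq mult.commute)
  then have "2 * (\<rho> * e) * A \<le> 2 * (\<rho> * e) * (6 * P / \<epsilon>)"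
    using \<rho>0 e by (intro mult_left_mono) auto
  also have "\<dots> = 12 * T" by (simp add: T_def)
  finally have LA2: "2 * (L * h) * A \<le> 12 * T" using LA by linarith
  show "\<bar>\<delta> * energy z0 n h y 0 n - 2 * P\<bar> \<le> 13 * (\<rho> * e * P / \<epsilon>)"
    using 1 LA2 \<sigma> \<epsilon>T unfolding A_def[symmetric] T_def[symmetric] by linarith
  show "4 * Y + r + 2 * (L * h) * energy z0 n h y 0 n + 3 \<le> 13 * (\<rho> * e * P / \<epsilon>)"
    using LA2 \<sigma> \<epsilon>T unfolding A_def[symmetric] T_def[symmetric] by linarith
qed

lemma sequential_estimator_window:
  fixes \<alpha> r e :: real
  defines "e \<equiv> eps_tilde n h \<alpha>" and "\<nu> \<equiv> nu z0 n h \<alpha>"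
  defines "H \<equiv> threshold z0 \<epsilon> n h \<alpha> y"
  defines "c \<equiv> clip z0 n h y \<nu> H"
  assumes small: "4 * Y + r + 10 \<le> \<epsilon> / 50 * e\<^sup>2 * P" "L * h \<le> \<epsilon> / 50 * e"
    and e: "0 < e" "e \<le> 1 / 2"
    and R1: "\<bar>R q\<bar> \<le> r"
    and R2: "\<bar>R (\<lambda>j. q j * of_bool (j \<le> \<nu>))\<bar> \<le> r"
    and R3: "\<bar>R (\<lambda>j. q j * ((real j / real n - z0) / h))\<bar> \<le> r"
    and R4: "\<bar>\<Sum>j=1..n. q j * of_bool (j \<le> \<nu>) * y (j - 1) * z j\<bar> \<le> r"
  shows "H \<le> energy z0 n h y \<nu> n"
    and "\<bar>\<Sum>j=\<nu>+1..n. c j * ((real j / real n - z0) / h)\<bar> \<le> 5 * e / \<epsilon> * P"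
proof -
  define \<rho> where "\<rho> = \<epsilon> / 50"
  define T where "T = e * P / 50"
  define A where "A = energy z0 n h y 0 n"
  define B where "B = energy z0 n h y 0 \<nu>"
  define u where "u j = (real j / real n - z0) / h" for j
  have \<rho>: "\<rho> * e * P / \<epsilon> = T"
    using eps by (simp add: \<rho>_def T_def)
  note base = weighted_energy_q[of r \<rho> e, OF small[folded \<rho>_def] e \<rho>_def R1, folded A_def, unfolded \<rho>]
  have P10: "10 \<le> P" and A1: "\<bar>\<delta> * A - 2 * P\<bar> \<le> 13 * T"
    and \<sigma>: "4 * Y + r + 2 * (L * h) * A + 3 \<le> 13 * T"
    using base by auto
  have Y0: "0 \<le> Y" using y_bound[of 0] by (metis le0 order_trans zero_le_power2)
  have r0: "0 \<le> r" using R1 by linarith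
  have A0: "0 \<le> A" by (simp add: A_def energy_nonneg)
  have B0: "0 \<le> B" by (simp add: B_def energy_nonneg)
  have eP: "0 < e * P" "e * P \<le> P / 2"
    using e P_pos mult_right_mono[of e "1/2" P] by auto
  have T0: "0 < T" using eP by (simp add: T_def)
  have \<nu>: "real n * z0 - P + e * P < real \<nu>" "real \<nu> \<le> real n * z0 - P + e * P + 2"
  proof -
    have k: "real n * z0 - P < real (k_star z0 n h)" "real (k_star z0 n h) \<le> real n * z0 - P + 1"
      using P_lt unfolding k_star_def P_def by linarith+
    have "iota n h \<alpha> = nat \<lfloor>e * P\<rfloor> + 1"
      unfolding iota_def e_def P_def by (simp add: mult.assoc)
    then have "e * P < real (iota n h \<alpha>)" "real (iota n h \<alpha>) \<le> e * P + 1"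
      using eP(1) by linarith+
    then show "real n * z0 - P + e * P < real \<nu>" "real \<nu> \<le> real n * z0 - P + e * P + 2"
      using k unfolding \<nu>_def nu_def by linarith+
  qed
  have lo\<nu>: "lo \<le> \<nu>" and \<nu>hi: "\<nu> < hi" and \<nu>n: "\<nu> < n"
    using lo_bounds hi_bounds \<nu> P10 eP by linarith+
  have "\<bar>\<delta> * B - (\<Sum>j=1..n. q j * of_bool (j \<le> \<nu>))\<bar> \<le> 4 * Y + r + 2 * (L * h) * A"
  proof -
    have Beq: "B = (\<Sum>j=1..n. q j * of_bool (j \<le> \<nu>) * (y (j - 1))\<^sup>2)"
      unfolding B_def energy_def using \<nu>n
      by (intro sum.mono_neutral_cong_left) (auto simp: q_def)
    moreover have "\<bar>\<delta> * (\<Sum>j=1..n. q j * of_bool (j \<le> \<nu>) * (y (j - 1))\<^sup>2) - (\<Sum>j=1..n. q j * of_bool (j \<le> \<nu>))\<bar>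
        \<le> 4 * Y + \<bar>R (\<lambda>j. q j * of_bool (j \<le> \<nu>))\<bar> + 2 * (L * h) * A"
      unfolding A_def using lo\<nu> \<nu>hi by (intro weighted_energy[of \<nu> _ 0]) (auto simp: q_eq)
    ultimately show ?thesis unfolding Beq using R2 by linarith
  qed
  moreover have cnt: "(\<Sum>j=1..n. q j * of_bool (j \<le> \<nu>)) = real \<nu> - real lo + 1"
  proof -
    have "(\<Sum>j=1..n. q j * of_bool (j \<le> \<nu>)) = (\<Sum>j=lo..\<nu>. (1::real))"
      using lo_bounds(3) \<nu>n \<nu>hi by (intro sum.mono_neutral_cong_right) (auto simp: q_eq)
    then show ?thesis using lo\<nu> by (simp add: of_nat_diff)
  qed
  ultimately have B1: "\<bar>\<delta> * B - (real \<nu> - real lo + 1)\<bar> \<le> 4 * Y + r + 2 * (L * h) * A"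
    by simp
  have cb: "e * P < real \<nu> - real lo + 1" "real \<nu> - real lo + 1 \<le> e * P + 3"
    using \<nu> lo_bounds by linarith+
  have Bup: "\<delta> * B \<le> e * P + 13 * T"
    using B1 cb \<sigma> by linarith
  have "13 * T \<le> e * P / 2" using eP by (simp add: T_def)
  have "e * P / 2 \<le> \<delta> * B"
    using B1 cb \<sigma> \<open>13 * T \<le> e * P / 2\<close> by linarith
  also have "\<dots> \<le> 1 * B"
    using delta_bounds B0 by (intro mult_right_mono) auto
  finally have Blow: "e * P / 2 \<le> B" by simp
  have Bpos: "0 < B" using Blow eP by linarith
  \<comment> \<open>The preliminary energy is only of order e P and the error has to be of order e,
    which is the reason for e^2 in \<open>small\<close>.\<close>
  have Shat: "\<bar>S_hat z0 n h \<alpha> y - S z0\<bar> \<le> \<epsilon> * (e / 10)"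
  proof -
    define \<Delta> where "\<Delta> j = S (real j / real n) - S z0" for j
    have "(\<Sum>j=1..\<nu>. q j * y (j - 1) * y j)
        = (\<Sum>j=1..\<nu>. S z0 * (q j * (y (j - 1))\<^sup>2) + \<Delta> j * (q j * (y (j - 1))\<^sup>2) + q j * y (j - 1) * z j)"
    proof (rule sum.cong[OF refl])
      fix j assume "j \<in> {1..\<nu>}"
      then have "j \<in> {1..n}" using \<nu>n by auto
      then show "q j * y (j - 1) * y j = S z0 * (q j * (y (j - 1))\<^sup>2) + \<Delta> j * (q j * (y (j - 1))\<^sup>2) + q j * y (j - 1) * z j"
        by (subst y_rec) (auto simp: \<Delta>_def algebra_simps power2_eq_square)
    qed
    also have "\<dots> = S z0 * B + (\<Sum>j=1..\<nu>. \<Delta> j * (q j * (y (j - 1))\<^sup>2)) + (\<Sum>j=1..\<nu>. q j * y (j - 1) * z j)"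
      by (simp add: sum.distrib sum_distrib_left B_def energy_def q_def)
    finally have num: "(\<Sum>j=1..\<nu>. q j * y (j - 1) * y j) - S z0 * B
        = (\<Sum>j=1..\<nu>. \<Delta> j * (q j * (y (j - 1))\<^sup>2)) + (\<Sum>j=1..\<nu>. q j * y (j - 1) * z j)" by simp
    have "(\<Sum>j=1..\<nu>. q j * y (j - 1) * z j) = (\<Sum>j=1..n. q j * of_bool (j \<le> \<nu>) * y (j - 1) * z j)"
      using \<nu>n by (intro sum.mono_neutral_cong_left) auto
    then have n2: "\<bar>\<Sum>j=1..\<nu>. q j * y (j - 1) * z j\<bar> \<le> r" using R4 by simp
    have n1: "\<bar>\<Sum>j=1..\<nu>. \<Delta> j * (q j * (y (j - 1))\<^sup>2)\<bar> \<le> L * h * B"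
    proof -
      have "\<bar>\<Sum>j=1..\<nu>. \<Delta> j * (q j * (y (j - 1))\<^sup>2)\<bar> \<le> (\<Sum>j=1..\<nu>. L * h * (q j * (y (j - 1))\<^sup>2))"
      proof (rule order_trans[OF sum_abs sum_mono])
        fix j assume "j \<in> {1..\<nu>}"
        show "\<bar>\<Delta> j * (q j * (y (j - 1))\<^sup>2)\<bar> \<le> L * h * (q j * (y (j - 1))\<^sup>2)"
          using S_diff[of j] by (auto simp: abs_mult q_eq \<Delta>_def intro!: mult_right_mono)
      qed
      then show ?thesis by (simp add: sum_distrib_left B_def energy_def q_def)
    qed
    have "S_hat z0 n h \<alpha> y - S z0 = ((\<Sum>j=1..\<nu>. q j * y (j - 1) * y j) - S z0 * B) / B"
      using Bpos by (simp add: S_hat_def \<nu>_def[symmetric] B_def q_def field_simps)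
    also have "\<bar>\<dots>\<bar> \<le> (L * h * B + r) / B"
      unfolding num using n1 n2 Bpos by (simp add: divide_right_mono abs_le_iff)
    also have "\<dots> = L * h + r / B" using Bpos by (simp add: field_simps)
    also have "\<dots> \<le> \<epsilon> * (e / 10)"
    proof -
      have "r \<le> \<epsilon> / 50 * e\<^sup>2 * P" using small Y0 by linarith
      also have "\<dots> = \<epsilon> / 25 * e * (e * P / 2)" by (simp add: power2_eq_square)
      also have "\<dots> \<le> \<epsilon> / 25 * e * B"
        using eps e Blow by (intro mult_left_mono) auto
      finally have "r / B \<le> \<epsilon> / 25 * e" using Bpos by (simp add: pos_divide_le_eq)
      moreover have "0 < \<epsilon> * e" using eps e by simp
      ultimately show ?thesis using small(2) by linarith
    qed
    finally show ?thesis .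
  qed
  define s where "s = S_tilde z0 \<epsilon> n h \<alpha> y"
  have Sz: "\<bar>S z0\<bar> \<le> 1 - \<epsilon>" using S_bound[OF z0_in] .
  have s1: "\<bar>s\<bar> \<le> 1 - \<epsilon>"
    using eps unfolding s_def S_tilde_def by linarith
  have "\<bar>s - S z0\<bar> \<le> \<bar>S_hat z0 n h \<alpha> y - S z0\<bar>"
    using Sz unfolding s_def S_tilde_def by (intro clamp_dist) auto
  then have s2: "\<bar>s - S z0\<bar> \<le> \<epsilon> * (e / 10)" using Shat by simp
  define d where "d = 1 - s\<^sup>2"
  have d: "\<epsilon> \<le> d" "d \<le> 1"
  proof -
    have "\<bar>s\<bar>\<^sup>2 \<le> (1 - \<epsilon>)\<^sup>2" using s1 by (intro power_mono) auto
    moreover have "(1 - \<epsilon>)\<^sup>2 \<le> 1 - \<epsilon>" using eps by (simp add: power2_eq_square mult_left_le)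
    ultimately show "\<epsilon> \<le> d" by (simp add: d_def)
  qed (simp add: d_def)
  have "\<bar>\<delta> - d\<bar> \<le> \<epsilon> * (e / 5)"
  proof -
    have "\<bar>s + S z0\<bar> \<le> 2" using s1 Sz eps by linarith
    then have "\<bar>s + S z0\<bar> * \<bar>s - S z0\<bar> \<le> 2 * (\<epsilon> * (e / 10))"
      using s2 by (intro mult_mono) auto
    moreover have "\<delta> - d = (s + S z0) * (s - S z0)"
      by (simp add: \<delta>_def d_def power2_eq_square algebra_simps)
    ultimately show ?thesis
      by (simp add: abs_mult)
  qed
  moreover have "\<bar>\<delta> / d - 1\<bar> * d = \<bar>\<delta> - d\<bar>"
  proof -
    have "(\<delta> / d - 1) * d = \<delta> - d" using d eps by (simp add: field_simps)
    then have "\<bar>\<delta> / d - 1\<bar> * \<bar>d\<bar> = \<bar>\<delta> - d\<bar>" by (simp only: abs_mult[symmetric])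
    then show ?thesis using d eps by simp
  qed
  ultimately have "\<bar>\<delta> / d - 1\<bar> * d \<le> (e / 5) * \<epsilon>" by (simp add: mult.commute)
  also have "\<dots> \<le> (e / 5) * d" using d e by (intro mult_left_mono) auto
  finally have ratio: "\<bar>\<delta> / d - 1\<bar> \<le> e / 5" using d eps by simp
  have H: "\<delta> * H = 2 * (1 - e) * P * (\<delta> / d)"
    by (simp add: H_def threshold_def e_def s_def d_def P_def)
  have X: "0 \<le> 2 * (1 - e) * P" "2 * (1 - e) * P \<le> 2 * P" using e P_pos by auto
  have Xe: "2 * (1 - e) * P = 2 * P - 2 * (e * P)" by (simp add: algebra_simps)
  have HX: "\<bar>\<delta> * H - 2 * (1 - e) * P\<bar> \<le> 2 * (e * P) / 5"
  proof -
    have "\<bar>\<delta> * H - 2 * (1 - e) * P\<bar> = \<bar>2 * (1 - e) * P * (\<delta> / d - 1)\<bar>"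
      unfolding H by (simp only: right_diff_distrib mult_1_right)
    also have "\<dots> = (2 * (1 - e) * P) * \<bar>\<delta> / d - 1\<bar>"
      unfolding abs_mult[of "2 * (1 - e) * P" "\<delta> / d - 1"] using X by (simp only: abs_of_nonneg)
    also have "\<dots> \<le> (2 * P) * (e / 5)" using X ratio P_pos e by (intro mult_mono) auto
    finally show ?thesis by (simp add: mult.commute)
  qed
  have H0: "0 < H"
    using e P_pos d eps unfolding H_def threshold_def e_def[symmetric] s_def[symmetric] d_def[symmetric]
    using h n by (intro mult_pos_pos divide_pos_pos) auto
  have split: "energy z0 n h y \<nu> n = A - B"
  proof -
    have "{1..n} = {1..\<nu>} \<union> {\<nu>+1..n}" using \<nu>n by auto
    then have "A = B + energy z0 n h y \<nu> n"
      unfolding A_def B_def energy_def by (simp only: add_0) (subst sum.union_disjoint; auto)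
    then show ?thesis by simp
  qed
  \<comment> \<open>The 2 e P missing in the threshold pay for e P of the preliminary stretch, 26 T
    = 0.52 e P of errors in the two energies and 0.4 e P from estimating \<delta>.\<close>
  have dAB: "\<delta> * (A - B) \<ge> \<delta> * H"
  proof -
    have "\<delta> * (A - B) = \<delta> * A - \<delta> * B" by (simp add: algebra_simps)
    moreover have "T = e * P / 50" by (simp add: T_def)
    ultimately show ?thesis
      using A1 Bup HX Xe eP unfolding abs_le_iff by linarith
  qed
  then show full: "H \<le> energy z0 n h y \<nu> n"
    unfolding split using delta_bounds eps by (simp add: mult_le_cancel_left)
  \<comment> \<open>As \<open>A\<close> is the energy of the whole window, this counts both the
    preliminary stretch and what is left after stopping.\<close>
  have AH: "A - H \<le> 4 * (e * P) / \<epsilon>"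
  proof -
    have AH0: "0 \<le> A - H" using full B0 unfolding split by linarith
    have "\<epsilon> * (A - H) \<le> \<delta> * (A - H)"
      using AH0 delta_bounds by (intro mult_right_mono) auto
    also have "\<dots> = \<delta> * A - \<delta> * H" by (simp add: algebra_simps)
    also have "\<dots> \<le> 4 * (e * P)"
      using A1 HX Xe eP \<open>13 * T \<le> e * P / 2\<close> by linarith
    finally show ?thesis using eps by (simp add: pos_le_divide_eq mult.commute)
  qed
  have sumc: "(\<Sum>j=\<nu>+1..n. c j) = H"
    using sum_clip[of H \<nu> n z0 n h y] full H0 \<nu>n by (simp add: c_def)
  have u1: "\<bar>u j\<bar> \<le> 1" if "j \<in> {lo..hi}" for j
    using window_dist[of j] that h by (simp add: u_def abs_divide)
  \<comment> \<open>Over the complete window the linear term cancels by symmetry about z0, up to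
    rounding at the ends. The weight \<open>q j * u j\<close> has increments 1/P over at most 2P
    steps, just the variation that Abel summation allows.\<close>
  have W: "\<epsilon> * \<bar>\<Sum>j=1..n. q j * u j * (y (j - 1))\<^sup>2\<bar> \<le> e * P"
  proof -
    have lh: "lo \<le> hi" using lo\<nu> \<nu>hi by simp
    have qu: "(\<Sum>j=1..n. q j * u j) = (\<Sum>j=lo..hi. u j)"
      using lo_bounds(3) hi_bounds(3) by (intro sum.mono_neutral_cong_right) (auto simp: q_eq)
    have "u j = (real j - real n * z0) / P" for j
      using n h by (simp add: u_def P_def field_simps)
    then have "(\<Sum>j=lo..hi. u j) = (\<Sum>j=lo..hi. real j - real n * z0) / P"
      by (simp add: sum_divide_distrib)
    also have "\<dots> = (real hi - real lo + 1) * ((real lo + real hi) / 2 - real n * z0) / P"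
      using lh by (subst sum_interval_minus_const) auto
    finally have eq: "(\<Sum>j=lo..hi. u j) = (real hi - real lo + 1) * ((real lo + real hi) / 2 - real n * z0) / P" .
    have "\<bar>real hi - real lo + 1\<bar> \<le> 3 * P"
      using lo_bounds hi_bounds lh P10 by linarith
    moreover have "\<bar>(real lo + real hi) / 2 - real n * z0\<bar> \<le> 1"
    proof -
      have "real lo + real hi \<le> 2 * (real n * z0) + 2" "2 * (real n * z0) - 2 \<le> real lo + real hi"
        using lo_bounds hi_bounds by linarith+
      then show ?thesis by (simp add: abs_le_iff field_simps)
    qed
    ultimately have "\<bar>(real hi - real lo + 1) * ((real lo + real hi) / 2 - real n * z0)\<bar> \<le> (3 * P) * 1"
      unfolding abs_mult using P_pos by (intro mult_mono) auto
    then have su: "\<bar>\<Sum>j=1..n. q j * u j\<bar> \<le> 3"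
      unfolding qu eq using P_pos by (simp add: abs_divide pos_divide_le_eq)
    have "\<bar>\<delta> * (\<Sum>j=1..n. q j * u j * (y (j - 1))\<^sup>2) - (\<Sum>j=1..n. q j * u j)\<bar>
        \<le> 4 * Y + \<bar>R (\<lambda>j. q j * u j)\<bar> + 2 * (L * h) * A"
      unfolding A_def
    proof (rule weighted_energy[of hi _ "1 / P"])
      fix j assume j: "j \<in> {lo..<hi}"
      have "u (Suc j) - u j = 1 / P"
        using n h by (simp add: u_def P_def field_simps)
      then show "\<bar>q (Suc j) * u (Suc j) - q j * u j\<bar> \<le> 1 / P"
        using j P_pos by (simp add: q_eq)
    next
      have "real (hi - lo) \<le> 2 * P"
        using lo_bounds hi_bounds lh by (simp add: of_nat_diff)
      then show "1 / P * real (hi - lo) \<le> 2" using P_pos by (simp add: field_simps)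
    qed (use lh u1 in \<open>auto simp: q_eq\<close>)
    then have "\<bar>\<delta> * (\<Sum>j=1..n. q j * u j * (y (j - 1))\<^sup>2)\<bar> \<le> 13 * T"
      using su R3[folded u_def] \<sigma> by linarith
    then have "\<delta> * \<bar>\<Sum>j=1..n. q j * u j * (y (j - 1))\<^sup>2\<bar> \<le> 13 * T"
      using delta_bounds eps by (simp add: abs_mult)
    moreover have "\<epsilon> * \<bar>\<Sum>j=1..n. q j * u j * (y (j - 1))\<^sup>2\<bar> \<le> \<delta> * \<bar>\<Sum>j=1..n. q j * u j * (y (j - 1))\<^sup>2\<bar>"
      using delta_bounds by (intro mult_right_mono) auto
    ultimately show ?thesis using \<open>13 * T \<le> e * P / 2\<close> eP by linarith
  qed
  define c' where "c' j = (if \<nu> < j then c j else 0)" for j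
  have c'n: "(\<Sum>j=1..n. c' j * f j) = (\<Sum>j=\<nu>+1..n. c j * f j)" for f :: "nat \<Rightarrow> real"
    by (intro sum.mono_neutral_cong_right) (auto simp: c'_def)
  have c'le: "0 \<le> c' j" "c' j \<le> q j * (y (j - 1))\<^sup>2" for j
    using clip_le[of z0 n h y \<nu> H j] by (auto simp: c'_def c_def q_def)
  have "(\<Sum>j=1..n. c' j * u j)
      = (\<Sum>j=1..n. q j * u j * (y (j - 1))\<^sup>2) - (\<Sum>j=1..n. (q j * (y (j - 1))\<^sup>2 - c' j) * u j)"
    by (simp add: sum_subtractf[symmetric] algebra_simps)
  \<comment> \<open>Clipping only removes energy, A - H in total, and |u| \<le> 1 on the
    window.\<close>
  moreover have "\<bar>\<Sum>j=1..n. (q j * (y (j - 1))\<^sup>2 - c' j) * u j\<bar> \<le> A - H"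
  proof -
    have "\<bar>\<Sum>j=1..n. (q j * (y (j - 1))\<^sup>2 - c' j) * u j\<bar> \<le> (\<Sum>j=1..n. q j * (y (j - 1))\<^sup>2 - c' j)"
    proof (rule order_trans[OF sum_abs sum_mono])
      fix j
      have z: "0 \<le> q j * (y (j - 1))\<^sup>2 - c' j" using c'le by simp
      show "\<bar>(q j * (y (j - 1))\<^sup>2 - c' j) * u j\<bar> \<le> q j * (y (j - 1))\<^sup>2 - c' j"
      proof (cases "j \<in> {lo..hi}")
        case True
        then show ?thesis using z u1 by (simp add: abs_mult mult_left_le)
      next
        case False
        then have "q j = 0" by (auto simp: q_eq)
        then have "q j * (y (j - 1))\<^sup>2 - c' j = 0"
          using c'le[of j] by simp
        then show ?thesis by simp
      qed
    qed
    also have "\<dots> = A - H"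
      using c'n[of "\<lambda>_. 1"] sumc by (simp add: sum_subtractf A_def energy_def q_def)
    finally show ?thesis .
  qed
  moreover have "\<bar>\<Sum>j=1..n. q j * u j * (y (j - 1))\<^sup>2\<bar> \<le> e * P / \<epsilon>"
    using W eps by (simp add: pos_le_divide_eq mult.commute)
  moreover have "\<bar>a\<bar> \<le> f + d" if "a = b - c" "\<bar>c\<bar> \<le> d" "\<bar>b\<bar> \<le> f" for a b c d f :: real
    using that by linarith
  ultimately have "\<bar>\<Sum>j=1..n. c' j * u j\<bar> \<le> e * P / \<epsilon> + (A - H)"
    by blast
  also have "\<dots> \<le> e * P / \<epsilon> + 4 * (e * P) / \<epsilon>"
    using AH by (rule add_left_mono)
  finally have "\<bar>\<Sum>j=1..n. c' j * u j\<bar> \<le> e * P / \<epsilon> + 4 * (e * P) / \<epsilon>" .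
  then show "\<bar>\<Sum>j=\<nu>+1..n. c j * ((real j / real n - z0) / h)\<bar> \<le> 5 * e / \<epsilon> * P"
    unfolding c'n u_def by (simp add: add_divide_distrib[symmetric])
qed

end

section \<open>Error decomposition\<close>

text \<open>Since 1 - s^2 \<le> 1 \<le> 2(1 - e), this holds on every realisation; the noise weights
  inherit a sure bound on their sum of squares.\<close>

lemma threshold_ge:
  assumes "0 < \<epsilon>" "\<epsilon> < 1" "0 < h" "0 < n" "0 \<le> eps_tilde n h \<alpha>" "eps_tilde n h \<alpha> \<le> 1 / 2"
  shows "real n * h \<le> threshold z0 \<epsilon> n h \<alpha> y"
proof -
  define s where "s = S_tilde z0 \<epsilon> n h \<alpha> y"
  have "\<bar>s\<bar> \<le> 1 - \<epsilon>"
    using assms unfolding s_def S_tilde_def by linarith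
  then have "\<bar>s\<bar>\<^sup>2 < 1\<^sup>2"
    using assms by (intro power_strict_mono) auto
  then have d: "0 < 1 - s\<^sup>2" "1 - s\<^sup>2 \<le> 1" by auto
  have "1 - s\<^sup>2 \<le> 2 * (1 - eps_tilde n h \<alpha>)"
  proof -
    have "1 \<le> 2 * (1 - eps_tilde n h \<alpha>)" using assms by simp
    with d(2) show ?thesis by (rule order_trans)
  qed
  then have "1 \<le> 2 * (1 - eps_tilde n h \<alpha>) / (1 - s\<^sup>2)"
    using d by (simp add: pos_le_divide_eq)
  then have "1 * (real n * h) \<le> 2 * (1 - eps_tilde n h \<alpha>) / (1 - s\<^sup>2) * (real n * h)"
    using assms by (intro mult_right_mono) auto
  then show ?thesis
    by (simp add: threshold_def s_def mult.assoc)
qed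

lemma nu_less:
  assumes "0 < h" "0 < z0 - h" "z0 + h \<le> 1" "0 < n" "0 \<le> eps_tilde n h \<alpha>" "eps_tilde n h \<alpha> \<le> 1 / 2"
    "10 \<le> real n * h"
  shows "nu z0 n h \<alpha> < n"
proof -
  define P where "P = real n * h"
  define e where "e = eps_tilde n h \<alpha>"
  have "0 < real n * (z0 - h)" using assms by (intro mult_pos_pos) auto
  then have 1: "P < real n * z0" by (simp add: P_def algebra_simps)
  have "real n * (z0 + h) \<le> real n * 1" using assms by (intro mult_left_mono) auto
  then have 2: "real n * z0 + P \<le> real n" by (simp add: P_def algebra_simps)
  have eP: "0 \<le> e * P" "e * P \<le> 1 / 2 * P"
    using assms mult_right_mono[of e "1/2" P] by (auto simp: P_def e_def)
  have "real (k_star z0 n h) \<le> real n * z0 - P + 1"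
    using 1 unfolding k_star_def P_def by linarith
  moreover have "iota n h \<alpha> = nat \<lfloor>e * P\<rfloor> + 1"
    unfolding iota_def e_def P_def by (simp add: mult.assoc)
  then have "real (iota n h \<alpha>) \<le> e * P + 1"
    using eP(1) by linarith
  moreover have "10 \<le> P" using assms by (simp add: P_def)
  ultimately have "real (nu z0 n h \<alpha>) < real n"
    using 2 eP unfolding nu_def of_nat_add by linarith
  then show ?thesis by simp
qed

text \<open>Whether the threshold is reached by time \<open>n\<close> is not consulted: that depends
  on the whole sample and would destroy predictability.\<close>

definition noise_weight ::
    "real \<Rightarrow> real \<Rightarrow> nat \<Rightarrow> real \<Rightarrow> real \<Rightarrow> (nat \<Rightarrow> real) \<Rightarrow> nat \<Rightarrow> real" where
  "noise_weight z0 \<epsilon> n h \<alpha> y k =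
     (if nu z0 n h \<alpha> < k
      then clip z0 n h y (nu z0 n h \<alpha>) (threshold z0 \<epsilon> n h \<alpha> y) k
             / (y (k - 1) * threshold z0 \<epsilon> n h \<alpha> y)
      else 0)"

text \<open>As the clipped weight at \<open>k\<close> is at most \<open>(y (k - 1))\<^sup>2\<close>,
  each square is at most that weight divided by H^2, and the clipped weights sum to at most
  \<open>H\<close>.\<close>

lemma sum_noise_weight_square:
  assumes T: "0 < T" "T \<le> threshold z0 \<epsilon> n h \<alpha> y" and \<nu>: "nu z0 n h \<alpha> \<le> n"
  shows "(\<Sum>k=1..n. (noise_weight z0 \<epsilon> n h \<alpha> y k)\<^sup>2) \<le> 1 / T"
proof -
  define \<nu> where "\<nu> = nu z0 n h \<alpha>"
  define H where "H = threshold z0 \<epsilon> n h \<alpha> y"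
  define c where "c = clip z0 n h y \<nu> H"
  have H: "0 < H" "T \<le> H" using T by (auto simp: H_def)
  have "(\<Sum>k=1..n. (noise_weight z0 \<epsilon> n h \<alpha> y k)\<^sup>2) = (\<Sum>k=\<nu>+1..n. (c k / (y (k - 1) * H))\<^sup>2)"
    by (intro sum.mono_neutral_cong_right) (auto simp: noise_weight_def \<nu>_def c_def H_def)
  also have "\<dots> \<le> (\<Sum>k=\<nu>+1..n. c k / H\<^sup>2)"
  proof (rule sum_mono)
    fix k
    have c: "0 \<le> c k" by (simp add: c_def)
    have "c k \<le> kern z0 n h k * (y (k - 1))\<^sup>2" unfolding c_def by (rule clip_le)
    also have "\<dots> \<le> 1 * (y (k - 1))\<^sup>2" by (intro mult_right_mono) auto
    finally have "c k * c k \<le> c k * (y (k - 1))\<^sup>2"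
      using c by (intro mult_left_mono) auto
    then have "(c k)\<^sup>2 / (y (k - 1))\<^sup>2 \<le> c k"
      using c by (cases "y (k - 1) = 0") (simp_all add: power2_eq_square[of "c k"] pos_divide_le_eq)
    then have "(c k)\<^sup>2 / (y (k - 1))\<^sup>2 / H\<^sup>2 \<le> c k / H\<^sup>2"
      by (intro divide_right_mono) auto
    then show "(c k / (y (k - 1) * H))\<^sup>2 \<le> c k / H\<^sup>2"
      by (simp add: power_divide power_mult_distrib)
  qed
  also have "\<dots> = (\<Sum>k=\<nu>+1..n. c k) / H\<^sup>2" by (simp add: sum_divide_distrib)
  also have "\<dots> \<le> H / H\<^sup>2"
    using sum_clip[of H \<nu> n z0 n h y] H \<nu> by (intro divide_right_mono) (auto simp: c_def \<nu>_def)
  also have "\<dots> = 1 / H" using H by (simp add: power2_eq_square)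
  also have "\<dots> \<le> 1 / T" using H T by (intro divide_left_mono) auto
  finally show ?thesis .
qed

context regression_window
begin

lemma S_star_error_decomp:
  fixes \<alpha> :: real
  defines "\<nu> \<equiv> nu z0 n h \<alpha>" and "H \<equiv> threshold z0 \<epsilon> n h \<alpha> y"
  defines "c \<equiv> clip z0 n h y \<nu> H"
  assumes \<nu>: "\<nu> < n" and H: "0 < H" and full: "H \<le> energy z0 n h y \<nu> n"
  shows "S_star z0 \<epsilon> n h \<alpha> y - S z0 = (\<Sum>j=\<nu>+1..n. c j * (S (real j / real n) - S z0)) / H
           + (\<Sum>k=1..n. noise_weight z0 \<epsilon> n h \<alpha> y k * z k)"
    and "(\<Sum>j=\<nu>+1..n. c j) = H"
proof -
  show sumc: "(\<Sum>j=\<nu>+1..n. c j) = H"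
    using sum_clip[of H \<nu> n z0 n h y] full H \<nu> by (simp add: c_def)
  have "(\<Sum>k=1..n. noise_weight z0 \<epsilon> n h \<alpha> y k * z k) = (\<Sum>k=\<nu>+1..n. c k / y (k - 1) * z k / H)"
    by (intro sum.mono_neutral_cong_right) (auto simp: noise_weight_def \<nu>_def c_def H_def)
  moreover have "c j / y (j - 1) * y j = c j * (S (real j / real n) - S z0) + S z0 * c j + c j / y (j - 1) * z j"
    if "j \<in> {\<nu>+1..n}" for j
  proof -
    have "j \<in> {1..n}" using that by auto
    note y = y_rec[OF this]
    show ?thesis
    proof (cases "y (j - 1) = 0")
      case True
      then have "c j = 0"
        using clip_le[of z0 n h y \<nu> H j] clip_nonneg[of z0 n h y \<nu> H j] by (simp add: c_def)
      then show ?thesis by simp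
    next
      case False
      then show ?thesis unfolding y by (simp add: field_simps)
    qed
  qed
  then have "(\<Sum>j=\<nu>+1..n. c j / y (j - 1) * y j)
      = (\<Sum>j=\<nu>+1..n. c j * (S (real j / real n) - S z0)) + S z0 * (\<Sum>j=\<nu>+1..n. c j)
        + (\<Sum>j=\<nu>+1..n. c j / y (j - 1) * z j)"
    by (simp add: sum.distrib sum_distrib_left)
  moreover have "S_star z0 \<epsilon> n h \<alpha> y = (\<Sum>j=\<nu>+1..n. c j / y (j - 1) * y j) / H"
    using S_star_eq_clip[of z0 n h \<alpha> \<epsilon> y] \<nu> H full by (simp add: \<nu>_def H_def c_def)
  ultimately show "S_star z0 \<epsilon> n h \<alpha> y - S z0 = (\<Sum>j=\<nu>+1..n. c j * (S (real j / real n) - S z0)) / H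
           + (\<Sum>k=1..n. noise_weight z0 \<epsilon> n h \<alpha> y k * z k)"
    using H unfolding sumc by (simp add: add_divide_distrib sum_divide_distrib)
qed

text \<open>Meant for the exceptional event, where nothing is known about the energies. If the
  threshold is missed the estimator is 0; otherwise its bias averages differences S(x_j) - S(z0),
  each at most 2.\<close>

lemma S_star_error_crude:
  assumes "nu z0 n h \<alpha> < n" "0 < threshold z0 \<epsilon> n h \<alpha> y"
  shows "\<bar>S_star z0 \<epsilon> n h \<alpha> y - S z0\<bar> \<le> 2 + \<bar>\<Sum>k=1..n. noise_weight z0 \<epsilon> n h \<alpha> y k * z k\<bar>"
proof (cases "threshold z0 \<epsilon> n h \<alpha> y \<le> energy z0 n h y (nu z0 n h \<alpha>) n")
  case False
  then have "S_star z0 \<epsilon> n h \<alpha> y = 0" by (intro S_star_zero) auto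
  then show ?thesis using S_bound[OF z0_in] eps by simp
next
  case True
  define \<nu> where "\<nu> = nu z0 n h \<alpha>"
  define H where "H = threshold z0 \<epsilon> n h \<alpha> y"
  define c where "c = clip z0 n h y \<nu> H"
  have H: "0 < H" using assms by (simp add: H_def)
  note dec = S_star_error_decomp[OF assms True, folded \<nu>_def H_def, folded c_def]
  have "\<bar>\<Sum>j=\<nu>+1..n. c j * (S (real j / real n) - S z0)\<bar> \<le> (\<Sum>j=\<nu>+1..n. c j * 2)"
  proof (rule order_trans[OF sum_abs sum_mono])
    fix j assume "j \<in> {\<nu>+1..n}"
    then have "real j / real n \<in> {0..1}" by auto
    from S_bound[OF this] have "\<bar>S (real j / real n) - S z0\<bar> \<le> 2"
      using S_bound[OF z0_in] eps by linarith
    then show "\<bar>c j * (S (real j / real n) - S z0)\<bar> \<le> c j * 2"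
      by (simp add: abs_mult c_def mult_left_mono)
  qed
  also have "\<dots> = H * 2" by (simp add: sum_distrib_right[symmetric] dec(2)[simplified])
  finally have "\<bar>(\<Sum>j=\<nu>+1..n. c j * (S (real j / real n) - S z0)) / H\<bar> \<le> 2"
    using H by (simp add: abs_divide pos_divide_le_eq mult.commute)
  then show ?thesis unfolding dec(1) by linarith
qed

text \<open>The clipped weights sum to \<open>H\<close>, so Taylor expansion at z0 splits the bias
  into the slope times the nearly cancelling linear sum and a remainder of order h powr \<beta>, the
  weights outside the window being 0. The linear sum is small relative to P, hence relative to
  \<open>H\<close>, which is at least P.\<close>

lemma S_star_error:
  fixes \<alpha> r e \<beta> Ls D :: real
  defines "e \<equiv> eps_tilde n h \<alpha>" and "\<nu> \<equiv> nu z0 n h \<alpha>"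
  assumes small: "4 * Y + r + 10 \<le> \<epsilon> / 50 * e\<^sup>2 * P" "L * h \<le> \<epsilon> / 50 * e"
    and e: "0 < e" "e \<le> 1 / 2"
    and R1: "\<bar>R q\<bar> \<le> r"
    and R2: "\<bar>R (\<lambda>j. q j * of_bool (j \<le> \<nu>))\<bar> \<le> r"
    and R3: "\<bar>R (\<lambda>j. q j * ((real j / real n - z0) / h))\<bar> \<le> r"
    and R4: "\<bar>\<Sum>j=1..n. q j * of_bool (j \<le> \<nu>) * y (j - 1) * z j\<bar> \<le> r"
    and taylor: "\<And>x. x \<in> {0..1} \<Longrightarrow> \<bar>S x - S z0 - (x - z0) * D\<bar> \<le> Ls * \<bar>x - z0\<bar> powr \<beta>"
    and D: "\<bar>D\<bar> \<le> L" and Ls: "0 \<le> Ls" and \<beta>: "0 \<le> \<beta>"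
  shows "\<bar>S_star z0 \<epsilon> n h \<alpha> y - S z0\<bar>
    \<le> 5 * L / \<epsilon> * (h * e) + Ls * h powr \<beta> + \<bar>\<Sum>k=1..n. noise_weight z0 \<epsilon> n h \<alpha> y k * z k\<bar>"
proof -
  define H where "H = threshold z0 \<epsilon> n h \<alpha> y"
  define c where "c = clip z0 n h y \<nu> H"
  define u where "u j = (real j / real n - z0) / h" for j
  note win = sequential_estimator_window[of r \<alpha>, folded e_def, folded \<nu>_def H_def, folded c_def,
      OF small e R1 R2 R3 R4, folded u_def]
  have P10: "10 \<le> P"
    using weighted_energy_q(1)[OF small e refl R1] .
  have PH: "P \<le> H"
    unfolding H_def P_def using e n h eps by (intro threshold_ge) (auto simp: e_def)
  have H: "0 < H" using P10 PH by linarith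
  have \<nu>: "\<nu> < n"
    unfolding \<nu>_def using e h n P10 by (intro nu_less) (auto simp: e_def P_def)
  note dec = S_star_error_decomp[of \<alpha>, folded \<nu>_def H_def, folded c_def, OF \<nu> H win(1)]
  define \<rho> where "\<rho> j = S (real j / real n) - S z0 - (real j / real n - z0) * D" for j
  have c0: "0 \<le> c j" for j by (simp add: c_def)
  have "(\<Sum>j=\<nu>+1..n. c j * (S (real j / real n) - S z0))
      = (\<Sum>j=\<nu>+1..n. D * h * (c j * u j) + c j * \<rho> j)"
  proof (rule sum.cong[OF refl])
    fix j
    have "h * u j = real j / real n - z0" using h by (simp add: u_def)
    then have "S (real j / real n) - S z0 = D * (h * u j) + \<rho> j" by (simp add: \<rho>_def)
    then show "c j * (S (real j / real n) - S z0) = D * h * (c j * u j) + c j * \<rho> j"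
      by (simp add: algebra_simps)
  qed
  also have "\<dots> = D * h * (\<Sum>j=\<nu>+1..n. c j * u j) + (\<Sum>j=\<nu>+1..n. c j * \<rho> j)"
    by (simp add: sum.distrib sum_distrib_left)
  finally have eq: "(\<Sum>j=\<nu>+1..n. c j * (S (real j / real n) - S z0))
      = D * h * (\<Sum>j=\<nu>+1..n. c j * u j) + (\<Sum>j=\<nu>+1..n. c j * \<rho> j)" .
  have "\<bar>D * h * (\<Sum>j=\<nu>+1..n. c j * u j)\<bar> = (\<bar>D\<bar> * h) * \<bar>\<Sum>j=\<nu>+1..n. c j * u j\<bar>"
    using h by (simp add: abs_mult)
  also have "\<dots> \<le> (L * h) * (5 * e / \<epsilon> * P)"
    using win(2) D h L by (intro mult_mono mult_right_mono) auto
  also have "\<dots> \<le> (L * h) * (5 * e / \<epsilon> * H)"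
    using PH L h e eps by (intro mult_left_mono) auto
  finally have b1: "\<bar>D * h * (\<Sum>j=\<nu>+1..n. c j * u j)\<bar> \<le> 5 * L / \<epsilon> * (h * e) * H"
    by (simp add: algebra_simps)
  have "\<bar>\<Sum>j=\<nu>+1..n. c j * \<rho> j\<bar> \<le> (\<Sum>j=\<nu>+1..n. c j * (Ls * h powr \<beta>))"
  proof (rule order_trans[OF sum_abs sum_mono])
    fix j assume j: "j \<in> {\<nu>+1..n}"
    show "\<bar>c j * \<rho> j\<bar> \<le> c j * (Ls * h powr \<beta>)"
    proof (cases "lo \<le> j \<and> j \<le> hi")
      case True
      have "real j / real n \<in> {0..1}" using j by auto
      from taylor[OF this] have "\<bar>\<rho> j\<bar> \<le> Ls * \<bar>real j / real n - z0\<bar> powr \<beta>"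
        by (simp add: \<rho>_def)
      also have "\<dots> \<le> Ls * h powr \<beta>"
        using True window_dist[of j] Ls \<beta> by (intro mult_left_mono powr_mono2) auto
      finally show ?thesis using c0[of j] by (simp add: abs_mult mult_left_mono)
    next
      case False
      then have "kern z0 n h j = 0" using q_eq[of j] by (auto simp: q_def)
      then have "c j = 0"
        using clip_le[of z0 n h y \<nu> H j] clip_nonneg[of z0 n h y \<nu> H j] by (simp add: c_def)
      then show ?thesis by simp
    qed
  qed
  also have "\<dots> = Ls * h powr \<beta> * H"
    by (simp add: sum_distrib_right[symmetric] dec(2)[simplified] mult.commute)
  finally have b2: "\<bar>\<Sum>j=\<nu>+1..n. c j * \<rho> j\<bar> \<le> Ls * h powr \<beta> * H" .
  have "\<bar>(\<Sum>j=\<nu>+1..n. c j * (S (real j / real n) - S z0)) / H\<bar> \<le> 5 * L / \<epsilon> * (h * e) + Ls * h powr \<beta>"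
  proof -
    have "\<bar>\<Sum>j=\<nu>+1..n. c j * (S (real j / real n) - S z0)\<bar> \<le> (5 * L / \<epsilon> * (h * e) + Ls * h powr \<beta>) * H"
      unfolding eq distrib_right by (rule order_trans[OF abs_triangle_ineq add_mono[OF b1 b2]])
    then show ?thesis using H by (simp add: abs_divide pos_divide_le_eq)
  qed
  then show ?thesis unfolding dec(1) by linarith
qed

end

section \<open>Boundedness and predictability of the observations\<close>

lemma obs_cong:
  "(\<And>i. i \<in> {1..k} \<Longrightarrow> w i = w' i) \<Longrightarrow> obs S y0 n w k = obs S y0 n w' k"
  by (induction k) auto

text \<open>The recursion preserves the bound because (1 - \<epsilon>) |c| / \<epsilon> + |c| = |c|
  / \<epsilon>.\<close>

lemma obs_bound:
  assumes S: "\<And>x. x \<in> {0..1} \<Longrightarrow> \<bar>S x\<bar> \<le> 1 - \<epsilon>" and eps: "0 < \<epsilon>" "\<epsilon> < 1" and k: "k \<le> n"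
    and w: "\<And>i. i \<in> {1..n} \<Longrightarrow> \<bar>w i\<bar> \<le> c"
  shows "\<bar>obs S y0 n w k\<bar> \<le> \<bar>y0\<bar> + \<bar>c\<bar> / \<epsilon>"
  using k
proof (induction k)
  case 0
  then show ?case using eps by simp
next
  case (Suc k)
  let ?b = "\<bar>y0\<bar> + \<bar>c\<bar> / \<epsilon>"
  have "real (Suc k) / real n \<in> {0..1}" using Suc.prems by auto
  from S[OF this] have "\<bar>S (real (Suc k) / real n) * obs S y0 n w k\<bar> \<le> (1 - \<epsilon>) * ?b"
    using Suc eps unfolding abs_mult by (intro mult_mono) auto
  moreover have "\<bar>w (Suc k)\<bar> \<le> \<bar>c\<bar>" using w[of "Suc k"] Suc.prems by simp
  moreover have "(1 - \<epsilon>) * ?b + \<bar>c\<bar> \<le> ?b"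
  proof -
    have "(1 - \<epsilon>) * ?b + \<bar>c\<bar> = ?b - \<epsilon> * \<bar>y0\<bar>"
      using eps by (simp add: field_simps)
    then show ?thesis using eps by simp
  qed
  ultimately show ?case unfolding obs.simps by linarith
qed

lemma measurable_obs:
  "k \<le> n \<Longrightarrow> (\<lambda>w. obs S y0 n w k) \<in> borel_measurable (PiM {1..n} (\<lambda>_. borel))"
proof (induction k)
  case (Suc k)
  then have "(\<lambda>w. w (Suc k)) \<in> borel_measurable (PiM {1..n} (\<lambda>_. borel :: real measure))"
    by (intro measurable_component_singleton) auto
  then show ?case using Suc by simp
qed simp

lemma predictable_obs: "predictable n (\<lambda>k w. g k * obs S y0 n w (k - 1))"
  unfolding predictable_def
  by (intro ballI conjI borel_measurable_times borel_measurable_const measurable_obs allI impI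
      arg_cong2[where f = "(*)"] obs_cong refl) auto

lemma energy_cong: "(\<And>i. i < m \<Longrightarrow> y i = y' i) \<Longrightarrow> energy z0 n h y k m = energy z0 n h y' k m"
  unfolding energy_def by (intro sum.cong) auto

lemma threshold_cong:
  assumes "\<And>i. i \<le> nu z0 n h \<alpha> \<Longrightarrow> y i = y' i"
  shows "threshold z0 \<epsilon> n h \<alpha> y = threshold z0 \<epsilon> n h \<alpha> y'"
proof -
  have "S_hat z0 n h \<alpha> y = S_hat z0 n h \<alpha> y'"
    unfolding S_hat_def using assms
    by (intro arg_cong2[where f = "(/)"] energy_cong sum.cong arg_cong2[where f = "(*)"] refl) auto
  then show ?thesis by (simp add: threshold_def S_tilde_def)
qed

lemma measurable_energy_obs:
  "m \<le> n \<Longrightarrow> (\<lambda>w. energy z0 n h (obs S y0 n w) k m) \<in> borel_measurable (PiM {1..n} (\<lambda>_. borel))"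
  unfolding energy_def
  by (intro borel_measurable_sum borel_measurable_times borel_measurable_power borel_measurable_const
      measurable_obs) auto

lemma measurable_threshold_obs:
  assumes "nu z0 n h \<alpha> \<le> n"
  shows "(\<lambda>w. threshold z0 \<epsilon> n h \<alpha> (obs S y0 n w)) \<in> borel_measurable (PiM {1..n} (\<lambda>_. borel))"
  unfolding threshold_def S_tilde_def S_hat_def using assms
  by (intro borel_measurable_sum borel_measurable_times borel_measurable_power borel_measurable_const
      borel_measurable_divide borel_measurable_diff borel_measurable_min borel_measurable_max
      measurable_energy_obs measurable_obs) auto

text \<open>The threshold is computed from the observations up to \<nu>, and the weight is 0 for k
  \<le> \<nu>; the clip at a later \<open>k\<close> uses \<open>y (k - 1)\<close> and an energy that
  stops at \<open>y (k - 2)\<close>.\<close>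

lemma predictable_noise_weight:
  assumes \<nu>: "nu z0 n h \<alpha> \<le> n"
  shows "predictable n (\<lambda>k w. noise_weight z0 \<epsilon> n h \<alpha> (obs S y0 n w) k)"
  unfolding predictable_def
proof (intro ballI conjI allI impI)
  fix k assume k: "k \<in> {1..n}"
  show "(\<lambda>w. noise_weight z0 \<epsilon> n h \<alpha> (obs S y0 n w) k) \<in> borel_measurable (PiM {1..n} (\<lambda>_. borel))"
  proof (cases "nu z0 n h \<alpha> < k")
    case True
    show ?thesis
      unfolding noise_weight_def clip_def if_P[OF True] using \<nu> k
      by (intro borel_measurable_times borel_measurable_power borel_measurable_const
        borel_measurable_divide borel_measurable_diff borel_measurable_min borel_measurable_max
        measurable_energy_obs measurable_obs measurable_threshold_obs) auto
  qed (simp add: noise_weight_def)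
  fix w w' :: "nat \<Rightarrow> real" assume eq: "\<forall>i\<in>{1..<k}. w i = w' i"
  have o: "obs S y0 n w i = obs S y0 n w' i" if "i < k" for i
    using eq that by (intro obs_cong) auto
  show "noise_weight z0 \<epsilon> n h \<alpha> (obs S y0 n w) k = noise_weight z0 \<epsilon> n h \<alpha> (obs S y0 n w') k"
  proof (cases "nu z0 n h \<alpha> < k")
    case True
    have "threshold z0 \<epsilon> n h \<alpha> (obs S y0 n w) = threshold z0 \<epsilon> n h \<alpha> (obs S y0 n w')"
      using True by (intro threshold_cong o) auto
    moreover have "energy z0 n h (obs S y0 n w) m (k - 1) = energy z0 n h (obs S y0 n w') m (k - 1)" for m
      by (intro energy_cong o) auto
    moreover have "obs S y0 n w (k - 1) = obs S y0 n w' (k - 1)" using k by (intro o) auto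
    ultimately show ?thesis by (simp add: noise_weight_def clip_def)
  qed (simp add: noise_weight_def)
qed

section \<open>Exceptional events for one bandwidth\<close>

context regression_window
begin

lemma sum_q_le: "(\<Sum>j=1..n. q j) \<le> 2 * P + 1"
proof -
  have "(\<Sum>j=1..n. q j) = (\<Sum>j=lo..hi. (1::real))"
    using lo_bounds(3) hi_bounds(3) by (intro sum.mono_neutral_cong_right) (auto simp: q_eq)
  also have "\<dots> \<le> 2 * P + 1"
    using lo_bounds hi_bounds P_pos by (cases "lo \<le> hi") (auto simp: of_nat_diff)
  finally show ?thesis .
qed

text \<open>One bound for all the noise sums to be controlled: 2 (2q)^2 Y = 8 Y q, and at most 2P +
  1 indices lie in the window.\<close>

lemma lin_quad_var_le:
  assumes c: "\<And>k. k \<in> {1..n} \<Longrightarrow> \<bar>c k\<bar> \<le> 2 * q k" and b: "\<And>k. k \<in> {1..n} \<Longrightarrow> \<bar>b k\<bar> \<le> q k"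
  shows "(\<Sum>k=1..n. 2 * (c k * y (k - 1))\<^sup>2 + 16 * (b k)\<^sup>2) \<le> (2 * P + 1) * (8 * Y + 16)"
proof -
  have Y0: "0 \<le> Y" using y_bound[of 0] by (metis le0 order_trans zero_le_power2)
  have "2 * (c k * y (k - 1))\<^sup>2 + 16 * (b k)\<^sup>2 \<le> q k * (8 * Y + 16)" if k: "k \<in> {1..n}" for k
  proof -
    have qq: "(q k)\<^sup>2 = q k" by (simp add: q_eq)
    have "\<bar>c k\<bar>\<^sup>2 \<le> (2 * q k)\<^sup>2" using c[OF k] by (intro power_mono) auto
    then have "(c k)\<^sup>2 * (y (k - 1))\<^sup>2 \<le> 4 * q k * Y"
      using y_bound[of "k - 1"] k by (intro mult_mono) (auto simp: power_mult_distrib qq q_eq)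
    moreover have "\<bar>b k\<bar>\<^sup>2 \<le> (q k)\<^sup>2" using b[OF k] by (intro power_mono) auto
    ultimately show ?thesis by (simp add: power_mult_distrib qq algebra_simps)
  qed
  then have "(\<Sum>k=1..n. 2 * (c k * y (k - 1))\<^sup>2 + 16 * (b k)\<^sup>2) \<le> (\<Sum>k=1..n. q k * (8 * Y + 16))"
    by (rule sum_mono)
  also have "\<dots> = (\<Sum>k=1..n. q k) * (8 * Y + 16)" by (simp add: sum_distrib_right)
  also have "\<dots> \<le> (2 * P + 1) * (8 * Y + 16)"
    using sum_q_le Y0 by (intro mult_right_mono) auto
  finally show ?thesis .
qed

end

text \<open>The last condition is the first part of \<open>small\<close> in
  \<open>sequential_estimator_window\<close>, with \<open>r\<close> the deviation 3 sqrt (V ln n) of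
  \<open>lin_quad_tail_sqrt\<close> and V the bound of \<open>lin_quad_var_le\<close>.\<close>

definition admissible :: "real \<Rightarrow> real \<Rightarrow> real \<Rightarrow> real \<Rightarrow> nat \<Rightarrow> real \<Rightarrow> real \<Rightarrow> bool" where
  "admissible z0 \<epsilon> L Y n h \<alpha> \<longleftrightarrow>
     0 < h \<and> 0 < z0 - h \<and> z0 + h \<le> 1 \<and>
     0 < eps_tilde n h \<alpha> \<and> eps_tilde n h \<alpha> \<le> 1 / 2 \<and> L * h \<le> \<epsilon> / 50 * eps_tilde n h \<alpha> \<and>
     4 * Y + 3 * sqrt ((2 * (real n * h) + 1) * (8 * Y + 16) * ln (real n)) + 10
       \<le> \<epsilon> / 50 * (eps_tilde n h \<alpha>)\<^sup>2 * (real n * h)"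

lemma admissible_nh:
  assumes "admissible z0 \<epsilon> L Y n h \<alpha>" "0 < \<epsilon>" "\<epsilon> < 1" "0 \<le> Y" "1 < n"
  shows "10 \<le> real n * h"
proof -
  define e where "e = eps_tilde n h \<alpha>"
  have e: "0 < e" "e \<le> 1 / 2" "0 < h" using assms by (auto simp: admissible_def e_def)
  have "10 \<le> 4 * Y + 3 * sqrt ((2 * (real n * h) + 1) * (8 * Y + 16) * ln (real n)) + 10"
    using assms e by (simp add: add_nonneg_nonneg)
  also have "\<dots> \<le> \<epsilon> / 50 * e\<^sup>2 * (real n * h)"
    using assms by (auto simp: admissible_def e_def)
  also have "\<dots> \<le> 1 * 1\<^sup>2 * (real n * h)"
    using e assms by (intro mult_mono power_mono) auto
  finally show ?thesis by simp
qed

lemma stable_window: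
  assumes S: "S \<in> stable_set \<epsilon> L" and eps: "0 < \<epsilon>" "\<epsilon> < 1" and L: "0 \<le> L"
    and h: "0 < h" "0 < z0 - h" "z0 + h \<le> 1" and n: "0 < n"
    and y: "\<And>k. k \<le> n \<Longrightarrow> (obs S y0 n w k)\<^sup>2 \<le> Y"
  shows "regression_window z0 \<epsilon> L h Y n S (obs S y0 n w) w"
proof
  fix x :: real assume x: "x \<in> {0..1}"
  show "\<bar>S x\<bar> \<le> 1 - \<epsilon>" using S x by (auto simp: stable_set_def)
  show "\<bar>S x - S z0\<bar> \<le> L * \<bar>x - z0\<bar>"
    using h by (intro stable_lipschitz[OF S x]) auto
next
  fix j assume "j \<in> {1..n}"
  then show "obs S y0 n w j = S (real j / real n) * obs S y0 n w (j - 1) + w j"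
    by (cases j) auto
qed (use assms in auto)

context gaussian_noise
begin

lemma noise_bound_event:
  assumes n: "1 < n"
  defines "B \<equiv> \<Union>k\<in>{1..n}. {w \<in> space M. sqrt (24 * ln (real n)) \<le> \<bar>\<xi> k w\<bar>}"
  shows "B \<in> sets M" "emeasure M B \<le> ennreal (2 / (real n)\<^sup>2)"
proof -
  \<comment> \<open>With c = 1 the exponent in \<open>lin_tail\<close> is x^2 / 8, so this level
    gives 2 n^(-3) for one variable and 2 n^(-2) after the union.\<close>
  let ?x = "sqrt (24 * ln (real n))"
  define A where "A k = {w \<in> space M. ?x \<le> \<bar>lin_quad n (\<lambda>j w. of_bool (j = k)) (\<lambda>_. 0) (noise w)\<bar>}" for k
  have ln0: "0 < ln (real n)" using n by simp
  have Aeq: "A k = {w \<in> space M. ?x \<le> \<bar>\<xi> k w\<bar>}" if "k \<in> {1..n}" for k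
  proof -
    have "lin_quad n (\<lambda>j w. of_bool (j = k)) (\<lambda>_. 0) w = w k" for w
      using that by (simp add: lin_quad_def of_bool_def if_distrib[of "\<lambda>x. x * _"] sum.delta cong: if_cong)
    then show ?thesis by (simp add: A_def)
  qed
  have A: "A k \<in> sets M" "emeasure M (A k) \<le> ennreal (2 / (real n) ^ 3)" if k: "k \<in> {1..n}" for k
  proof -
    have p: "predictable n (\<lambda>j w. of_bool (j = k))" by (simp add: predictable_def)
    have v: "(\<Sum>j=1..n. (of_bool (j = k))\<^sup>2) \<le> (1::real)"
      using k by (simp add: of_bool_def if_distrib[of "\<lambda>x. x\<^sup>2"] sum.delta cong: if_cong)
    have "exp (- ?x\<^sup>2 / (8 * 1)) = 1 / (real n) ^ 3"
    proof -
      have "- ?x\<^sup>2 / (8 * 1) = - (3 * ln (real n))" using ln0 by simp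
      also have "\<dots> = - ln ((real n) ^ 3)" using n by (simp add: ln_realpow)
      finally show ?thesis using n by (simp add: exp_minus inverse_eq_divide)
    qed
    then show "A k \<in> sets M" "emeasure M (A k) \<le> ennreal (2 / (real n) ^ 3)"
      using lin_tail[OF p, of 1 ?x] v ln0 by (auto simp: A_def)
  qed
  have BA: "B = (\<Union>k\<in>{1..n}. A k)" by (simp add: B_def Aeq)
  show "B \<in> sets M" unfolding BA using A by (intro sets.finite_UN) auto
  have "emeasure M B \<le> (\<Sum>k=1..n. emeasure M (A k))"
    unfolding BA using A by (intro emeasure_subadditive_finite) auto
  also have "\<dots> \<le> (\<Sum>k=1..n. ennreal (2 / (real n) ^ 3))" using A by (intro sum_mono) auto
  also have "\<dots> = ennreal (real n * (2 / (real n) ^ 3))"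
    by (subst sum_ennreal) auto
  also have "real n * (2 / (real n) ^ 3) = 2 / (real n)\<^sup>2"
    using n by (simp add: power2_eq_square power3_eq_cube)
  finally show "emeasure M B \<le> ennreal (2 / (real n)\<^sup>2)" .
qed

text \<open>The bound on the observations is a premise rather than part of the event because all
  bandwidths share it. It bounds the compensators of the noise sums by the constant V, and 8 ln n
  \<le> Y supplies the condition 64 l \<le> V of \<open>lin_quad_tail_sqrt\<close>.\<close>

lemma window_event:
  assumes S: "S \<in> holder_class z0 \<beta> \<epsilon> L Ls" and eps: "0 < \<epsilon>" "\<epsilon> < 1" and L: "0 \<le> L"
    and Ls: "0 \<le> Ls" and \<beta>: "1 < \<beta>" and n: "1 < n" and Y: "8 * ln (real n) \<le> Y"
    and adm: "admissible z0 \<epsilon> L Y n h \<alpha>"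
  shows "\<exists>B\<in>sets M. emeasure M B \<le> ennreal (8 / (real n)\<^sup>2) \<and>
    (\<forall>w\<in>space M - B. (\<forall>k\<le>n. (obs S y0 n (noise w) k)\<^sup>2 \<le> Y) \<longrightarrow>
      \<bar>S_star z0 \<epsilon> n h \<alpha> (obs S y0 n (noise w)) - S z0\<bar>
      \<le> 5 * L / \<epsilon> * (h * eps_tilde n h \<alpha>) + Ls * h powr \<beta>
        + \<bar>lin_quad n (\<lambda>k w. noise_weight z0 \<epsilon> n h \<alpha> (obs S y0 n w) k) (\<lambda>_. 0) (noise w)\<bar>)"
proof -
  define l where "l = ln (real n)"
  have l: "0 < l" using n by (simp add: l_def)
  define V where "V = (2 * (real n * h) + 1) * (8 * Y + 16)"
  define r where "r = 3 * sqrt (V * l)"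
  define \<nu> where "\<nu> = nu z0 n h \<alpha>"
  define q where "q = kern z0 n h"
  have h: "0 < h" "0 < z0 - h" "z0 + h \<le> 1" using adm by (auto simp: admissible_def)
  have Y0: "0 \<le> Y" using Y l by (simp add: l_def)
  have "1 * (64 * l) \<le> (2 * (real n * h) + 1) * (8 * Y + 16)"
    using Y l h by (intro mult_mono) (auto simp: l_def)
  then have V: "64 * l \<le> V" by (simp add: V_def)
  have el: "exp (- 2 * l) = 1 / (real n)\<^sup>2"
    using n by (simp add: l_def exp_minus inverse_eq_divide exp_double)
  let ?s = "\<lambda>k. S (real k / real n)"
  let ?u = "\<lambda>j. (real j / real n - z0) / h"
  \<comment> \<open>The indices 0, 1, 2 belong to the energy of the whole window, of the preliminary
    stretch, and with linear weights; index 3 below is the noise of \<open>S_hat\<close>.\<close>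
  define g where "g i = (if i = (0::nat) then q else if i = 1 then (\<lambda>j. q j * of_bool (j \<le> \<nu>))
      else (\<lambda>j. q j * ?u j))" for i
  define c where "c i = (if i < 3 then (\<lambda>k. 2 * g i k * ?s k) else (\<lambda>k. q k * of_bool (k \<le> \<nu>)))" for i
  define b where "b i = (if i < 3 then g i else (\<lambda>_. 0))" for i
  define a where "a i = (\<lambda>k w. c i k * obs S y0 n w (k - 1))" for i
  define B where "B i = {w\<in>space M. r \<le> \<bar>lin_quad n (a i) (b i) (noise w)\<bar> \<and> lin_quad_var n (a i) (b i) (noise w) \<le> V}" for i
  have Sst: "S \<in> stable_set \<epsilon> L" using S by (simp add: holder_class_def)
  have u1: "\<bar>q j * ?u j\<bar> \<le> q j" for j
    by (auto simp: q_def kern_def indicator_def abs_mult)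
  have g1: "\<bar>g i k\<bar> \<le> q k" for i k
    using u1[of k] by (auto simp: g_def q_def)
  have b1: "\<bar>b i k\<bar> \<le> q k" for i k
    using g1[of i k] by (auto simp: b_def q_def)
  have c1: "\<bar>c i k\<bar> \<le> 2 * q k" if "k \<in> {1..n}" for i k
  proof (cases "i < 3")
    case True
    have "real k / real n \<in> {0..1}" using that by auto
    then have "\<bar>?s k\<bar> \<le> 1 - \<epsilon>" using Sst by (simp add: stable_set_def)
    then have "\<bar>g i k\<bar> * \<bar>?s k\<bar> \<le> q k * 1"
      using g1[of i k] eps by (intro mult_mono) (auto simp: q_def)
    then show ?thesis using True by (simp add: c_def abs_mult)
  next
    case False
    then show ?thesis using kern_nonneg[of z0 n h k] by (auto simp: c_def q_def)
  qed
  have B: "B i \<in> sets M" "emeasure M (B i) \<le> ennreal (2 / (real n)\<^sup>2)" for i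
  proof -
    have p: "predictable n (a i)" unfolding a_def by (rule predictable_obs)
    have b': "\<bar>b i k\<bar> \<le> 1" for k
      using b1[of i k] kern_le_1[of z0 n h k] unfolding q_def by linarith
    show "B i \<in> sets M" "emeasure M (B i) \<le> ennreal (2 / (real n)\<^sup>2)"
      using lin_quad_tail_sqrt[OF p b' l V] unfolding B_def r_def el by auto
  qed
  have "emeasure M (\<Union>i\<in>{..<4}. B i) \<le> (\<Sum>i<4. emeasure M (B i))"
    using B by (intro emeasure_subadditive_finite) auto
  also have "\<dots> \<le> (\<Sum>i<(4::nat). ennreal (2 / (real n)\<^sup>2))" using B by (intro sum_mono) auto
  also have "\<dots> = ennreal (8 / (real n)\<^sup>2)"
    by (subst sum_ennreal) auto
  finally have mB: "emeasure M (\<Union>i\<in>{..<4}. B i) \<le> ennreal (8 / (real n)\<^sup>2)" .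
  show ?thesis
  proof (intro bexI[of _ "\<Union>i\<in>{..<4}. B i"] conjI ballI impI mB)
    show "(\<Union>i\<in>{..<4}. B i) \<in> sets M" using B by auto
    fix w assume w: "w \<in> space M - (\<Union>i\<in>{..<4}. B i)" and yb: "\<forall>k\<le>n. (obs S y0 n (noise w) k)\<^sup>2 \<le> Y"
    interpret W: regression_window z0 \<epsilon> L h Y n S "obs S y0 n (noise w)" "noise w"
      using n yb by (intro stable_window Sst eps L h) auto
    have qW: "W.q = q" and PW: "W.P = real n * h" by (simp_all add: W.q_def q_def W.P_def)
    have lq: "\<bar>lin_quad n (a i) (b i) (noise w)\<bar> \<le> r" if "i < 4" for i
    proof -
      have "lin_quad_var n (a i) (b i) (noise w) \<le> V"
        unfolding lin_quad_var_def a_def V_def PW[symmetric]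
        using c1 b1 by (intro W.lin_quad_var_le) (auto simp: qW)
      moreover have "w \<notin> B i" using w that by auto
      ultimately show ?thesis using w by (auto simp: B_def)
    qed
    have l0: "\<bar>W.R (g i)\<bar> \<le> r" if "i < 3" for i
      using lq[of i] that unfolding lin_quad_def a_def b_def c_def by simp
    have l3: "\<bar>\<Sum>j=1..n. q j * of_bool (j \<le> \<nu>) * obs S y0 n (noise w) (j - 1) * \<xi> j w\<bar> \<le> r"
      using lq[of 3] unfolding lin_quad_def a_def b_def c_def by simp
    have small: "4 * Y + r + 10 \<le> \<epsilon> / 50 * (eps_tilde n h \<alpha>)\<^sup>2 * W.P"
      "L * h \<le> \<epsilon> / 50 * eps_tilde n h \<alpha>" "0 < eps_tilde n h \<alpha>" "eps_tilde n h \<alpha> \<le> 1 / 2"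
      using adm unfolding admissible_def r_def V_def l_def PW by auto
    have "\<bar>S_star z0 \<epsilon> n h \<alpha> (obs S y0 n (noise w)) - S z0\<bar>
      \<le> 5 * L / \<epsilon> * (h * eps_tilde n h \<alpha>) + Ls * h powr \<beta>
        + \<bar>\<Sum>k=1..n. noise_weight z0 \<epsilon> n h \<alpha> (obs S y0 n (noise w)) k * noise w k\<bar>"
    proof (rule W.S_star_error[OF small])
      show "\<bar>W.R W.q\<bar> \<le> r" using l0[of 0] by (simp add: qW g_def)
      show "\<bar>W.R (\<lambda>j. W.q j * of_bool (j \<le> nu z0 n h \<alpha>))\<bar> \<le> r"
        using l0[of 1] by (simp add: qW g_def \<nu>_def)
      show "\<bar>W.R (\<lambda>j. W.q j * ?u j)\<bar> \<le> r" using l0[of 2] by (simp add: qW g_def)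
      show "\<bar>\<Sum>j=1..n. W.q j * of_bool (j \<le> nu z0 n h \<alpha>) * obs S y0 n (noise w) (j - 1) * \<xi> j w\<bar> \<le> r"
        using l3 by (simp add: qW \<nu>_def)
      show "\<bar>S x - S z0 - (x - z0) * deriv01 S z0\<bar> \<le> Ls * \<bar>x - z0\<bar> powr \<beta>" if "x \<in> {0..1}" for x
        by (rule holder_taylor[OF S W.z0_in that \<beta> Ls])
      show "\<bar>deriv01 S z0\<bar> \<le> L" using Sst W.z0_in by (auto simp: stable_set_def)
    qed (use Ls \<beta> in auto)
    then show "\<bar>S_star z0 \<epsilon> n h \<alpha> (obs S y0 n (noise w)) - S z0\<bar>
      \<le> 5 * L / \<epsilon> * (h * eps_tilde n h \<alpha>) + Ls * h powr \<beta>
        + \<bar>lin_quad n (\<lambda>k w. noise_weight z0 \<epsilon> n h \<alpha> (obs S y0 n w) k) (\<lambda>_. 0) (noise w)\<bar>"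
      by (simp add: lin_quad_def)
  qed
qed

end

section \<open>Rates, grids and the selection rule\<close>

lemma rate_exponent_diff:
  assumes "0 \<le> (a::real)" "0 \<le> b"
  shows "b / (2 * b + 1) - a / (2 * a + 1) = (b - a) / ((2 * a + 1) * (2 * b + 1))"
proof -
  have "2 * a + 1 \<noteq> 0" "2 * b + 1 \<noteq> 0" using assms by linarith+
  then show ?thesis by (simp add: field_simps)
qed

lemma rate_exponent_mono:
  assumes "0 \<le> (a::real)" "a \<le> b"
  shows "a / (2 * a + 1) \<le> b / (2 * b + 1)"
proof -
  have "0 \<le> (b - a) / ((2 * a + 1) * (2 * b + 1))"
    using assms by (intro divide_nonneg_nonneg mult_nonneg_nonneg) auto
  then show ?thesis using rate_exponent_diff[of a b] assms by linarith
qed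

lemma rate_pos: "0 < d_seq n \<Longrightarrow> 0 < rate n \<beta>"
  by (simp add: rate_def)

lemma rate_mono: "1 \<le> d_seq n \<Longrightarrow> 0 \<le> a \<Longrightarrow> a \<le> b \<Longrightarrow> rate n a \<le> rate n b"
  unfolding rate_def by (intro powr_mono rate_exponent_mono)

lemma rate_quotient:
  assumes "1 \<le> d_seq n" "0 \<le> a" "0 \<le> b"
  shows "rate n b / rate n a = exp (ln (d_seq n) * ((b - a) / ((2 * a + 1) * (2 * b + 1))))"
  unfolding rate_exponent_diff[OF assms(2,3), symmetric] rate_def
  using assms by (simp add: powr_def exp_diff[symmetric] right_diff_distrib mult.commute)

lemma rate_quotient_le:
  assumes d: "1 \<le> d_seq n" and a: "0 \<le> a" "a \<le> b" and K: "ln (d_seq n) * (b - a) \<le> K"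
  shows "rate n b / rate n a \<le> exp K"
proof -
  have "0 \<le> ln (d_seq n)" using d by simp
  moreover have "1 * 1 \<le> (2 * a + 1) * (2 * b + 1)"
    using a by (intro mult_mono) auto
  then have "(b - a) / ((2 * a + 1) * (2 * b + 1)) \<le> (b - a) / 1"
    using a by (intro divide_left_mono) auto
  ultimately have "ln (d_seq n) * ((b - a) / ((2 * a + 1) * (2 * b + 1))) \<le> ln (d_seq n) * (b - a)"
    by (intro mult_left_mono) auto
  then show ?thesis
    using assms by (subst rate_quotient) auto
qed

lemma bandwidth_powr:
  assumes "0 < d_seq n" "0 \<le> b"
  shows "(d_seq n powr (- 1 / (2 * b + 1))) powr b = 1 / rate n b"
proof -
  have "(d_seq n powr (- 1 / (2 * b + 1))) powr b = d_seq n powr (- (b / (2 * b + 1)))"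
    by (simp add: powr_powr)
  then show ?thesis by (simp add: rate_def powr_minus_divide)
qed

text \<open>A bandwidth tuned to a smaller b gains the factor d^(-(\<beta> - b)/(2b + 1)) over the
  inverse of its own rate; the 5 bounds 2b + 1.\<close>

lemma bandwidth_powr_le:
  assumes d: "1 \<le> d_seq n" and b: "0 \<le> b" "b \<le> 2" and K: "K \<le> ln (d_seq n) * (\<beta> - b)" "0 \<le> K"
  shows "(d_seq n powr (- 1 / (2 * b + 1))) powr \<beta> \<le> exp (- K / 5) / rate n b"
proof -
  have "(d_seq n powr (- 1 / (2 * b + 1))) powr \<beta>
      = d_seq n powr (- ((\<beta> - b) / (2 * b + 1))) * d_seq n powr (- (b / (2 * b + 1)))"
    unfolding powr_powr powr_add[symmetric] using b
    by (intro arg_cong2[where f = "(powr)"] refl) (simp add: field_simps)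
  also have "d_seq n powr (- ((\<beta> - b) / (2 * b + 1))) = exp (- (ln (d_seq n) * (\<beta> - b) / (2 * b + 1)))"
    using d by (simp add: powr_def mult.commute)
  also have "\<dots> \<le> exp (- K / 5)"
  proof -
    have "K / 5 \<le> K / (2 * b + 1)"
      using b K by (intro divide_left_mono) auto
    also have "\<dots> \<le> ln (d_seq n) * (\<beta> - b) / (2 * b + 1)"
      using b K by (intro divide_right_mono) auto
    finally show ?thesis by simp
  qed
  also have "exp (- K / 5) * d_seq n powr (- (b / (2 * b + 1))) = exp (- K / 5) / rate n b"
    by (simp add: rate_def powr_minus_divide)
  finally show ?thesis by (simp add: mult_right_mono)
qed

text \<open>The logarithm in d_n at work: the noise part at this bandwidth has standard deviation at
  most 1/(N sqrt (ln n)), so that a threshold of order 1/N exceeds it by the factor sqrt (ln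
  n).\<close>

lemma bandwidth_effective_size:
  assumes n: "1 < n" and b: "0 \<le> b"
  shows "real n * d_seq n powr (- 1 / (2 * b + 1)) = (rate n b)\<^sup>2 * ln (real n)"
proof -
  have ln0: "0 < ln (real n)" using n by simp
  then have d: "0 < d_seq n" using n by (simp add: d_seq_def)
  have "real n = ln (real n) * d_seq n powr 1" using ln0 d by (simp add: d_seq_def)
  then have "real n * d_seq n powr (- 1 / (2 * b + 1))
      = (ln (real n) * d_seq n powr 1) * d_seq n powr (- 1 / (2 * b + 1))"
    by (rule arg_cong[where f = "\<lambda>t. t * d_seq n powr (- 1 / (2 * b + 1))"])
  also have "\<dots> = ln (real n) * (d_seq n powr 1 * d_seq n powr (- 1 / (2 * b + 1)))"
    by (rule mult.assoc)
  also have "d_seq n powr 1 * d_seq n powr (- 1 / (2 * b + 1)) = d_seq n powr (2 * (b / (2 * b + 1)))"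
    unfolding powr_add[symmetric]
    using b by (intro arg_cong2[where f = "(powr)"] refl) (simp add: field_simps)
  also have "\<dots> = (rate n b)\<^sup>2"
  proof -
    have "(rate n b)\<^sup>2 = rate n b powr 2" using rate_pos[OF d, of b] by (simp add: powr_numeral)
    then show ?thesis by (simp add: rate_def powr_powr mult.commute)
  qed
  finally show ?thesis by (simp add: mult.commute)
qed

lemma grid_size_bounds:
  assumes "1 \<le> d_seq n"
  shows "0 < grid_size n" "ln (d_seq n) \<le> real (grid_size n)" "real (grid_size n) \<le> ln (d_seq n) + 1"
proof -
  have "0 \<le> ln (d_seq n)" using assms by simp
  then show "0 < grid_size n" "ln (d_seq n) \<le> real (grid_size n)" "real (grid_size n) \<le> ln (d_seq n) + 1"
    unfolding grid_size_def by linarith+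
qed

lemma grid_range:
  assumes "a \<le> b" "k \<le> grid_size n"
  shows "a \<le> grid a b n k" "grid a b n k \<le> b"
proof -
  have "real k / real (grid_size n) * (b - a) \<le> 1 * (b - a)"
    using assms by (intro mult_right_mono) (auto simp: divide_le_eq_1)
  then show "a \<le> grid a b n k" "grid a b n k \<le> b"
    using assms by (auto simp: grid_def)
qed

lemma grid_mono: "a \<le> b \<Longrightarrow> j \<le> k \<Longrightarrow> grid a b n j \<le> grid a b n k"
  by (simp add: grid_def divide_right_mono mult_right_mono)

lemma beta_grid_eq: "beta_grid al au n k = 1 + grid al au n k"
  by (simp add: beta_grid_def grid_def algebra_simps)

lemma grid_0 [simp]: "grid a b n 0 = a"
  by (simp add: grid_def)

text \<open>Backing off from \<open>\<beta>\<close> by \<open>K / ln d\<close> costs only a constant factor in the rate,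
  but makes the bias smaller than any prescribed fraction of it.\<close>

lemma grid_below:
  assumes ab: "a < b" "b - a \<le> 1" and \<beta>: "a \<le> \<beta>" "\<beta> \<le> b" and d: "1 < d_seq n" and K: "0 \<le> K"
  shows "\<exists>k\<le>grid_size n. grid a b n k \<le> \<beta> \<and> (k = 0 \<or> K \<le> ln (d_seq n) * (\<beta> - grid a b n k))
    \<and> ln (d_seq n) * (\<beta> - grid a b n k) \<le> K + 1"
proof -
  define D where "D = ln (d_seq n)"
  have D: "0 < D" using d by (simp add: D_def)
  define m where "m = real (grid_size n)"
  have m: "D \<le> m" "0 < m" using grid_size_bounds[of n] d by (auto simp: D_def m_def)
  \<comment> \<open>Rounding \<beta> - K/D down to the grid loses at most one mesh, (b - a)/m \<le>
    1/D, whence K + 1. If \<beta> - K/D lies below \<open>a\<close>, the grid point 0 is already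
    within K/D.\<close>
  define t where "t = \<beta> - a - K / D"
  show ?thesis
  proof (cases "t < 0")
    case True
    then have "\<beta> - a \<le> K / D" by (simp add: t_def)
    then have "D * (\<beta> - a) \<le> K" using D by (simp add: pos_le_divide_eq mult.commute)
    then show ?thesis using \<beta> by (intro exI[of _ 0]) (auto simp: D_def)
  next
    case False
    define x where "x = m * t / (b - a)"
    have x0: "0 \<le> x" using False m ab by (simp add: x_def)
    have "0 \<le> K / D" using K D by simp
    then have "t \<le> b - a" using \<beta> by (simp add: t_def)
    then have "t / (b - a) \<le> 1" using ab by simp
    then have "m * (t / (b - a)) \<le> m * 1" using m by (intro mult_left_mono) auto
    then have xm: "x \<le> m" by (simp add: x_def)
    define k where "k = nat \<lfloor>x\<rfloor>"
    have k: "real k \<le> x" "x < real k + 1" using x0 unfolding k_def by linarith+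
    have km: "k \<le> grid_size n" using k xm unfolding m_def by linarith
    have g: "grid a b n k = a + real k * ((b - a) / m)" by (simp add: grid_def m_def)
    have xt: "x * ((b - a) / m) = t" using ab m by (simp add: x_def)
    have c: "0 \<le> (b - a) / m" using ab m by simp
    have "real k * ((b - a) / m) \<le> x * ((b - a) / m)" using k c by (intro mult_right_mono) auto
    then have le: "grid a b n k \<le> \<beta> - K / D" unfolding g xt by (simp add: t_def)
    have "x * ((b - a) / m) \<le> (real k + 1) * ((b - a) / m)" using k c by (intro mult_right_mono) auto
    then have "\<beta> - grid a b n k \<le> K / D + (b - a) / m" unfolding g xt distrib_right by (simp add: t_def)
    also have "(b - a) / m \<le> 1 / D" using ab m D by (intro frac_le) auto
    finally have ge: "\<beta> - grid a b n k \<le> (K + 1) / D" by (simp add: add_divide_distrib)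
    have "K \<le> D * (\<beta> - grid a b n k)"
    proof -
      have "K / D \<le> \<beta> - grid a b n k" using le by simp
      then show ?thesis using D by (simp add: pos_divide_le_eq mult.commute)
    qed
    moreover have "D * (\<beta> - grid a b n k) \<le> K + 1"
      using ge D by (simp add: pos_le_divide_eq mult.commute)
    moreover have "grid a b n k \<le> \<beta>" using le \<open>0 \<le> K / D\<close> by linarith
    ultimately show ?thesis using km unfolding D_def by blast
  qed
qed

section \<open>Lepski's selection for a fixed realisation\<close>

context
  fixes z0 \<epsilon> al au lam \<theta> :: real and n :: nat and y :: "nat \<Rightarrow> real"
  assumes d: "1 \<le> d_seq n" and a: "0 < al" "al \<le> au" and lam: "0 \<le> lam"
begin

private abbreviation "T \<equiv> S_check z0 \<epsilon> al au n y"
private abbreviation "N j \<equiv> rate n (beta_grid al au n j)"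
private abbreviation "om \<equiv> omega_check z0 \<epsilon> al au lam n y"
private abbreviation "kc \<equiv> k_check z0 \<epsilon> al au lam n y"

private lemma N_pos: "0 < N j"
  using d by (intro rate_pos) auto

private lemma N_mono: "j \<le> k \<Longrightarrow> lam / N k \<le> lam / N j"
  using d a lam N_pos grid_mono[of al au] unfolding beta_grid_eq
  by (intro divide_left_mono rate_mono) (auto simp: beta_grid_eq grid_def)

private lemma om_le_iff: "om k \<le> lam / N k \<longleftrightarrow> (\<forall>j\<le>k. \<bar>T j - T k\<bar> \<le> lam / N j + lam / N k)"
  unfolding omega_check_def by (subst Max_le_iff) (auto simp: algebra_simps)

private lemma k_check_in: "kc \<in> {k. k \<le> grid_size n \<and> om k \<le> lam / N k}"
proof -
  let ?K = "{k. k \<le> grid_size n \<and> om k \<le> lam / N k}"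
  \<comment> \<open>The index 0 is compared only with itself, so the maximum defining
    \<open>k_check\<close> is over a nonempty set.\<close>
  have "0 \<in> ?K" using lam N_pos[of 0] by (auto simp: om_le_iff)
  moreover have "finite ?K" by simp
  ultimately show ?thesis unfolding k_check_def by (intro Max_in) auto
qed

text \<open>Every accepted index has been compared with 0. This holds on every realisation and is
  the fallback where the oracle bound fails.\<close>

lemma adaptive_error_at_zero:
  "\<bar>S_adaptive z0 \<epsilon> al au lam n y - \<theta>\<bar> \<le> \<bar>T 0 - \<theta>\<bar> + 2 * lam / N 0"
proof -
  have "\<bar>T 0 - T kc\<bar> \<le> lam / N 0 + lam / N kc"
    using k_check_in om_le_iff[of kc] by auto
  also have "\<dots> \<le> 2 * lam / N 0" using N_mono[of 0 kc] by simp
  finally show ?thesis unfolding S_adaptive_def by linarith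
qed

text \<open>If all estimators up to \<open>k\<close> are close to the target, they are close to each
  other and \<open>k\<close> is accepted. The selected index is then at least \<open>k\<close> and,
  being accepted itself, has been compared with \<open>k\<close>.\<close>

lemma adaptive_error_oracle:
  assumes k: "k \<le> grid_size n" and err: "\<And>j. j \<le> k \<Longrightarrow> \<bar>T j - \<theta>\<bar> \<le> lam / N j"
  shows "\<bar>S_adaptive z0 \<epsilon> al au lam n y - \<theta>\<bar> \<le> 3 * lam / N k"
proof -
  have "om k \<le> lam / N k"
    unfolding om_le_iff
  proof (intro allI impI)
    fix j assume "j \<le> k"
    then show "\<bar>T j - T k\<bar> \<le> lam / N j + lam / N k"
      using err[of j] err[of k] by linarith
  qed
  then have "k \<le> kc"
    unfolding k_check_def using k by (intro Max_ge) auto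
  then have "\<bar>T k - T kc\<bar> \<le> lam / N k + lam / N kc"
    using k_check_in om_le_iff[of kc] by auto
  also have "\<dots> \<le> 2 * lam / N k" using N_mono[OF \<open>k \<le> kc\<close>] by simp
  finally have "\<bar>T kc - \<theta>\<bar> \<le> 2 * lam / N k + lam / N k"
    using err[of k] by linarith
  then show ?thesis unfolding S_adaptive_def by (simp add: add_divide_distrib[symmetric])
qed

end

section \<open>The risk of the adaptive estimator\<close>

lemma ennreal_indicator_combination:
  fixes a b c d e :: real
  assumes "0 \<le> a" "0 \<le> b" "0 \<le> c" "0 \<le> d" "0 \<le> e"
  shows "ennreal a + ennreal b * indicator A w + ennreal c * indicator B w + ennreal d * ennreal e
    = ennreal (a + b * indicator A w + c * indicator B w + d * e)"
  using assms
  by (auto simp: indicator_def ennreal_plus[symmetric] ennreal_mult[symmetric] simp del: ennreal_plus)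

context gaussian_noise
begin

text \<open>On the good event the oracle bound loses the factor exp (K + 1) in the rate. Elsewhere
  the error is compared with that at grid point 0, and a measurable majorant is integrated term by
  term.\<close>

lemma adaptive_risk_bound:
  fixes z0 \<epsilon> L Ls al au lam y0 \<beta> K :: real and n :: nat and S :: "real \<Rightarrow> real"
  defines "p \<equiv> 9 * lam\<^sup>2 / 128" and "\<Delta> \<equiv> (au - al) / ((2 * (1 + al) + 1) * (2 * (1 + au) + 1))"
  assumes eps: "0 < \<epsilon>" "\<epsilon> < 1" and L: "0 \<le> L" and Ls: "0 \<le> Ls" and a: "0 < al" "al < au" "au < 1"
    and lam: "0 < lam" and K: "0 \<le> K" "Ls * exp (- K / 5) \<le> lam / 8"
    and n: "1 < n" "1 \<le> ln (real n)" and d: "1 < d_seq n"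
    and adm: "\<And>k. k \<le> grid_size n \<Longrightarrow> admissible z0 \<epsilon> L ((2 * y0\<^sup>2 + 48 / \<epsilon>\<^sup>2 + 8) * ln (real n)) n
                 (h_grid al au n k) (grid al au n k)"
    and nL: "40 * L \<le> \<epsilon> * lam * ln (real n)" and nm: "grid_size n + 1 \<le> n"
    and np: "real n powr (2 * \<Delta> - p) * (2 * (real (grid_size n) + 1)) \<le> 1"
    and \<beta>: "\<beta> \<in> {1 + al..1 + au}" and S: "S \<in> holder_class z0 \<beta> \<epsilon> L Ls"
  shows "ennreal (rate n \<beta>) * abs_risk M \<xi> y0 z0 n (S_adaptive z0 \<epsilon> al au lam n) S
    \<le> ennreal ((3 * lam + Ls) * exp (K + 1) + 20 + (lam / 8 + Ls + 2 * lam + 1) * 11 + 4 * exp 2)"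
proof -
  define Y where "Y = (2 * y0\<^sup>2 + 48 / \<epsilon>\<^sup>2 + 8) * ln (real n)"
  define m where "m = grid_size n"
  define h where "h k = h_grid al au n k" for k
  define \<alpha> where "\<alpha> k = grid al au n k" for k
  define N where "N k = rate n (1 + \<alpha> k)" for k
  define P where "P k = real n * h k" for k
  define y where "y w = obs S y0 n (noise w)" for w
  define wt where "wt k = (\<lambda>j w. noise_weight z0 \<epsilon> n (h k) (\<alpha> k) (obs S y0 n w) j)" for k
  define s where "s k w = lin_quad n (wt k) (\<lambda>_. 0) (noise w)" for k w
  define err where "err k w = \<bar>S_check z0 \<epsilon> al au n (y w) k - S z0\<bar>" for k w
  define N\<beta> where "N\<beta> = rate n \<beta>"
  have d1: "1 \<le> d_seq n" and d0: "0 < d_seq n" using d by auto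
  have n0: "0 < n" using n by simp
  have \<alpha>: "al \<le> \<alpha> k" "\<alpha> k \<le> au" if "k \<le> m" for k
    using grid_range[of al au k n] a that by (auto simp: \<alpha>_def m_def)
  have \<alpha>0: "\<alpha> 0 = al" by (simp add: \<alpha>_def)
  have \<beta>1: "1 < \<beta>" "\<beta> \<le> 2" using \<beta> a by auto
  have hk: "h k = d_seq n powr (- 1 / (2 * (1 + \<alpha> k) + 1))" for k
    by (simp add: h_def h_grid_def beta_grid_eq \<alpha>_def)
  have N0: "0 < N k" for k unfolding N_def by (rule rate_pos[OF d0])
  have Nb: "N k = rate n (beta_grid al au n k)" for k
    by (simp add: N_def beta_grid_eq \<alpha>_def)
  have N\<beta>: "0 < N\<beta>" unfolding N\<beta>_def by (rule rate_pos[OF d0])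
  have ln0: "0 < ln (real n)" using n by simp
  have Y8: "8 * ln (real n) \<le> Y"
    unfolding Y_def using ln0 eps by (intro mult_right_mono) auto
  have Y0: "0 \<le> Y" using Y8 ln0 by linarith
  have adm': "admissible z0 \<epsilon> L Y n (h k) (\<alpha> k)" if "k \<le> m" for k
    using adm[of k] that by (simp add: Y_def h_def \<alpha>_def m_def)
  have PN: "P k = (N k)\<^sup>2 * ln (real n)" if "k \<le> m" for k
    unfolding P_def hk N_def using n a \<alpha>[OF that] by (intro bandwidth_effective_size) auto
  have P10: "10 \<le> P k" if "k \<le> m" for k
    unfolding P_def by (rule admissible_nh[OF adm'[OF that] eps Y0 n(1)])
  have hb: "0 < h k" "0 < z0 - h k" "z0 + h k \<le> 1" "0 < eps_tilde n (h k) (\<alpha> k)" "eps_tilde n (h k) (\<alpha> k) \<le> 1 / 2"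
    if "k \<le> m" for k
    using adm'[OF that] by (auto simp: admissible_def)
  have thr: "P k \<le> threshold z0 \<epsilon> n (h k) (\<alpha> k) v" if "k \<le> m" for k v
    unfolding P_def using hb[OF that] eps n0 by (intro threshold_ge) auto
  have \<nu>: "nu z0 n (h k) (\<alpha> k) < n" if "k \<le> m" for k
    using hb[OF that] P10[OF that] n0 by (intro nu_less) (auto simp: P_def)
  have pred: "predictable n (wt k)" if "k \<le> m" for k
    unfolding wt_def using \<nu>[OF that] by (intro predictable_noise_weight) auto
  have var: "(\<Sum>j=1..n. (wt k j w)\<^sup>2) \<le> 1 / P k" if "k \<le> m" for k w
    unfolding wt_def using \<nu>[OF that] thr[OF that] P10[OF that]
    by (intro sum_noise_weight_square) auto
  have Sst: "S \<in> stable_set \<epsilon> L" using S by (simp add: holder_class_def)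

  \<comment> \<open>Of the allowance \<lambda>/N the two bias terms take 1/8 each and the noise 3/4.
    As P = N^2 ln n, the tail exponent is (3/4)^2 \<lambda>^2 / 8 times ln n, that is p ln
    n.\<close>
  define U where "U k = {w \<in> space M. 3 * lam / 4 / N k \<le> \<bar>s k w\<bar>}" for k
  have U: "U k \<in> sets M" "emeasure M (U k) \<le> ennreal (2 * real n powr (- p))" if k: "k \<le> m" for k
  proof -
    have x: "0 < 3 * lam / 4 / N k" and c: "0 < 1 / P k" using lam N0[of k] P10[OF k] by auto
    have "- (3 * lam / 4 / N k)\<^sup>2 / (8 * (1 / P k)) = - (p * ln (real n))"
      unfolding PN[OF k] p_def using N0[of k] by (simp add: field_simps power2_eq_square)
    then have "exp (- (3 * lam / 4 / N k)\<^sup>2 / (8 * (1 / P k))) = real n powr (- p)"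
      using n0 by (simp add: powr_def)
    then show "U k \<in> sets M" "emeasure M (U k) \<le> ennreal (2 * real n powr (- p))"
      using lin_tail[OF pred[OF k] c x var[OF k]] by (auto simp: U_def s_def)
  qed

  obtain BW where BW: "\<And>k. k \<le> m \<Longrightarrow> BW k \<in> sets M" "\<And>k. k \<le> m \<Longrightarrow> emeasure M (BW k) \<le> ennreal (8 / (real n)\<^sup>2)"
    and BWe: "\<And>k w. k \<le> m \<Longrightarrow> w \<in> space M - BW k \<Longrightarrow> (\<forall>i\<le>n. (y w i)\<^sup>2 \<le> Y) \<Longrightarrow>
      err k w \<le> 5 * L / \<epsilon> * (h k * eps_tilde n (h k) (\<alpha> k)) + Ls * h k powr \<beta> + \<bar>s k w\<bar>"
  proof -
    have "\<forall>k. \<exists>B. k \<le> m \<longrightarrow> B \<in> sets M \<and> emeasure M B \<le> ennreal (8 / (real n)\<^sup>2) \<and>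
      (\<forall>w\<in>space M - B. (\<forall>i\<le>n. (y w i)\<^sup>2 \<le> Y) \<longrightarrow>
        err k w \<le> 5 * L / \<epsilon> * (h k * eps_tilde n (h k) (\<alpha> k)) + Ls * h k powr \<beta> + \<bar>s k w\<bar>)"
    proof
      fix k
      show "\<exists>B. k \<le> m \<longrightarrow> B \<in> sets M \<and> emeasure M B \<le> ennreal (8 / (real n)\<^sup>2) \<and>
        (\<forall>w\<in>space M - B. (\<forall>i\<le>n. (y w i)\<^sup>2 \<le> Y) \<longrightarrow>
          err k w \<le> 5 * L / \<epsilon> * (h k * eps_tilde n (h k) (\<alpha> k)) + Ls * h k powr \<beta> + \<bar>s k w\<bar>)"
      proof (cases "k \<le> m")
        case True
        show ?thesis
          using window_event[OF S eps L Ls \<beta>1(1) n(1) Y8 adm'[OF True], of y0]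
          unfolding y_def err_def s_def wt_def S_check_def h_def[symmetric] \<alpha>_def[symmetric] Bex_def by blast
      qed auto
    qed
    then obtain BW where "\<forall>k. k \<le> m \<longrightarrow> BW k \<in> sets M \<and> emeasure M (BW k) \<le> ennreal (8 / (real n)\<^sup>2) \<and>
      (\<forall>w\<in>space M - BW k. (\<forall>i\<le>n. (y w i)\<^sup>2 \<le> Y) \<longrightarrow>
        err k w \<le> 5 * L / \<epsilon> * (h k * eps_tilde n (h k) (\<alpha> k)) + Ls * h k powr \<beta> + \<bar>s k w\<bar>)"
      by metis
    then show thesis by (intro that[of BW]) blast+
  qed

  define BN where "BN = (\<Union>k\<in>{1..n}. {w \<in> space M. sqrt (24 * ln (real n)) \<le> \<bar>\<xi> k w\<bar>})"
  have BN: "BN \<in> sets M" "emeasure M BN \<le> ennreal (2 / (real n)\<^sup>2)"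
    unfolding BN_def by (rule noise_bound_event[OF n(1)])+
  \<comment> \<open>From |y| \<le> |y0| + sqrt (24 ln n) / \<epsilon> one gets y^2 \<le> 2 y0^2 + 48
    ln n / \<epsilon>^2, and ln n \<ge> 1 pulls out the logarithm: hence the constant in
    \<open>Y\<close>. Its summand 8 serves \<open>window_event\<close>.\<close>
  have yY: "(y w i)\<^sup>2 \<le> Y" if w: "w \<in> space M - BN" and i: "i \<le> n" for w i
  proof -
    let ?c = "sqrt (24 * ln (real n))"
    have "\<bar>y w i\<bar> \<le> \<bar>y0\<bar> + \<bar>?c\<bar> / \<epsilon>"
      unfolding y_def
    proof (rule obs_bound[OF _ eps i])
      fix j assume j: "j \<in> {1..n}"
      have "w \<notin> {w \<in> space M. ?c \<le> \<bar>\<xi> j w\<bar>}" using w j by (auto simp: BN_def)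
      then show "\<bar>\<xi> j w\<bar> \<le> ?c" using w by auto
    qed (use Sst in \<open>auto simp: stable_set_def\<close>)
    then have "\<bar>y w i\<bar>\<^sup>2 \<le> (\<bar>y0\<bar> + \<bar>?c\<bar> / \<epsilon>)\<^sup>2" by (intro power_mono) auto
    also have "\<dots> \<le> 2 * \<bar>y0\<bar>\<^sup>2 + 2 * (\<bar>?c\<bar> / \<epsilon>)\<^sup>2"
      using sum_squares_bound[of "\<bar>y0\<bar>" "\<bar>?c\<bar> / \<epsilon>"] by (simp add: power2_sum)
    also have "\<dots> = 2 * y0\<^sup>2 * 1 + 48 / \<epsilon>\<^sup>2 * ln (real n)"
      using ln0 by (simp add: power_divide)
    also have "\<dots> \<le> 2 * y0\<^sup>2 * ln (real n) + 48 / \<epsilon>\<^sup>2 * ln (real n)"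
      using n(2) by (intro add_right_mono mult_left_mono) auto
    also have "\<dots> \<le> Y" unfolding Y_def using ln0 by (simp add: algebra_simps)
    finally show ?thesis by simp
  qed

  \<comment> \<open>\<open>B0\<close> is rare enough (\<open>O(1/n)\<close>) for the trivial error bound there; on \<open>bad - B0\<close> the error at grid
    point \<open>0\<close> must still be of the order of its rate.\<close>
  define B0 where "B0 = BN \<union> (\<Union>k\<in>{..m}. BW k)"
  define bad where "bad = B0 \<union> (\<Union>k\<in>{..m}. U k)"
  have B0 [measurable]: "B0 \<in> sets M" using BN BW by (auto simp: B0_def)
  have bad [measurable]: "bad \<in> sets M" using B0 U by (auto simp: bad_def)
  have mB0: "emeasure M B0 \<le> ennreal (10 / real n)"
  proof -
    have "emeasure M B0 \<le> emeasure M BN + emeasure M (\<Union>k\<in>{..m}. BW k)"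
      unfolding B0_def using BN BW by (intro emeasure_subadditive) auto
    also have "\<dots> \<le> ennreal (2 / (real n)\<^sup>2) + (\<Sum>k\<le>m. ennreal (8 / (real n)\<^sup>2))"
    proof (rule add_mono)
      have "emeasure M (\<Union>k\<in>{..m}. BW k) \<le> (\<Sum>k\<le>m. emeasure M (BW k))"
        using BW by (intro emeasure_subadditive_finite) auto
      also have "\<dots> \<le> (\<Sum>k\<le>m. ennreal (8 / (real n)\<^sup>2))" using BW by (intro sum_mono) auto
      finally show "emeasure M (\<Union>k\<in>{..m}. BW k) \<le> (\<Sum>k\<le>m. ennreal (8 / (real n)\<^sup>2))" .
    qed (rule BN)
    also have "\<dots> = ennreal (2 / (real n)\<^sup>2 + (\<Sum>k\<le>m. 8 / (real n)\<^sup>2))"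
      by (subst sum_ennreal) (auto simp: ennreal_plus[symmetric] simp del: ennreal_plus)
    also have "\<dots> \<le> ennreal (10 / real n)"
    proof (rule ennreal_leI)
      have "2 / (real n)\<^sup>2 + (\<Sum>k\<le>m. 8 / (real n)\<^sup>2) = (2 + 8 * (real m + 1)) / (real n)\<^sup>2"
        by (simp add: add_divide_distrib algebra_simps)
      also have "\<dots> \<le> (10 * real n) / (real n)\<^sup>2"
        using nm n0 by (intro divide_right_mono) (auto simp: m_def)
      also have "\<dots> = 10 / real n" using n0 by (simp add: power2_eq_square)
      finally show "2 / (real n)\<^sup>2 + (\<Sum>k\<le>m. 8 / (real n)\<^sup>2) \<le> 10 / real n" .
    qed
    finally show ?thesis .
  qed
  have mbad: "emeasure M bad \<le> ennreal (10 / real n + 2 * (real m + 1) * real n powr (- p))"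
  proof -
    have "emeasure M bad \<le> emeasure M B0 + emeasure M (\<Union>k\<in>{..m}. U k)"
      unfolding bad_def using B0 U by (intro emeasure_subadditive) auto
    also have "\<dots> \<le> ennreal (10 / real n) + (\<Sum>k\<le>m. ennreal (2 * real n powr (- p)))"
    proof (rule add_mono[OF mB0])
      have "emeasure M (\<Union>k\<in>{..m}. U k) \<le> (\<Sum>k\<le>m. emeasure M (U k))"
        using U by (intro emeasure_subadditive_finite) auto
      also have "\<dots> \<le> (\<Sum>k\<le>m. ennreal (2 * real n powr (- p)))" using U by (intro sum_mono) auto
      finally show "emeasure M (\<Union>k\<in>{..m}. U k) \<le> (\<Sum>k\<le>m. ennreal (2 * real n powr (- p)))" .
    qed
    also have "\<dots> = ennreal (10 / real n + (\<Sum>k\<le>m. 2 * real n powr (- p)))"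
      by (subst sum_ennreal) (auto simp: ennreal_plus[symmetric] simp del: ennreal_plus)
    also have "(\<Sum>k\<le>m. 2 * real n powr (- p)) = 2 * (real m + 1) * real n powr (- p)"
      by (simp add: algebra_simps)
    finally show ?thesis .
  qed

  have err_crude: "err 0 w \<le> 2 + \<bar>s 0 w\<bar>" for w
  proof -
    \<comment> \<open>Every realisation is bounded by the sum of its squares, and the size of this
      bound does not enter the crude estimate.\<close>
    interpret W: regression_window z0 \<epsilon> L "h 0" "\<Sum>i\<le>n. (y w i)\<^sup>2" n S "obs S y0 n (noise w)" "noise w"
    proof (rule stable_window[OF Sst eps L])
      fix k assume "k \<le> n"
      then show "(obs S y0 n (noise w) k)\<^sup>2 \<le> (\<Sum>i\<le>n. (y w i)\<^sup>2)"
        unfolding y_def by (intro member_le_sum) auto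
    qed (use hb[of 0] n0 in auto)
    show ?thesis
      using W.S_star_error_crude[of "\<alpha> 0"] \<nu>[of 0] thr[of 0 "obs S y0 n (noise w)"] P10[of 0]
      by (simp add: err_def S_check_def s_def lin_quad_def wt_def y_def h_def \<alpha>_def)
  qed
  have err_good: "err k w \<le> lam / 8 / N k + Ls * h k powr \<beta> + \<bar>s k w\<bar>"
    if w: "w \<in> space M - B0" and k: "k \<le> m" for w k
  proof -
    have "err k w \<le> 5 * L / \<epsilon> * (h k * eps_tilde n (h k) (\<alpha> k)) + Ls * h k powr \<beta> + \<bar>s k w\<bar>"
      using w k by (intro BWe yY allI impI) (auto simp: B0_def)
    \<comment> \<open>At a grid point h powr (1 + \<alpha>) is exactly 1/N; the factor 1 / ln n in
      \<open>eps_tilde\<close> then brings the term below \<lambda>/(8N) by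
      \<open>nL\<close>.\<close>
    moreover have "5 * L / \<epsilon> * (h k * eps_tilde n (h k) (\<alpha> k)) \<le> lam / 8 / N k"
    proof -
      have "h k * eps_tilde n (h k) (\<alpha> k) = h k powr (1 + \<alpha> k) / ln (real n)"
        using hb(1)[OF k] by (simp add: eps_tilde_def powr_add)
      also have "h k powr (1 + \<alpha> k) = 1 / N k"
        unfolding hk N_def using d0 a \<alpha>[OF k] by (intro bandwidth_powr) auto
      finally have "5 * L / \<epsilon> * (h k * eps_tilde n (h k) (\<alpha> k)) = 5 * L / (\<epsilon> * ln (real n)) / N k"
        by simp
      also have "\<dots> \<le> lam / 8 / N k"
      proof (rule divide_right_mono)
        show "5 * L / (\<epsilon> * ln (real n)) \<le> lam / 8"
          using nL eps ln0 by (simp add: pos_divide_le_eq mult_ac)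
      qed (use N0[of k] in simp)
      finally show ?thesis .
    qed
    ultimately show ?thesis by linarith
  qed
  have bias0: "h 0 powr \<beta> \<le> 1 / N 0"
  proof -
    have "h 0 powr \<beta> \<le> exp (- 0 / 5) / rate n (1 + \<alpha> 0)"
      unfolding hk using d1 a \<beta> by (intro bandwidth_powr_le) (auto simp: \<alpha>0)
    then show ?thesis by (simp add: N_def)
  qed
  have at0: "\<bar>S_adaptive z0 \<epsilon> al au lam n (y w) - S z0\<bar> \<le> err 0 w + 2 * lam / N 0" for w
    unfolding err_def Nb using d1 a lam by (intro adaptive_error_at_zero) auto

  define C1 where "C1 = (3 * lam + Ls) * exp (K + 1)"
  define C2 where "C2 = lam / 8 + Ls + 2 * lam + 1"
  define Q where "Q = (N\<beta> / N 0)\<^sup>2"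
  have C2: "0 \<le> C2" using lam Ls by (simp add: C2_def)
  have C10: "0 \<le> C1" using lam Ls by (simp add: C1_def)
  obtain k0 where k0: "k0 \<le> m" "1 + \<alpha> k0 \<le> \<beta>"
    "k0 = 0 \<or> K \<le> ln (d_seq n) * (\<beta> - (1 + \<alpha> k0))" "ln (d_seq n) * (\<beta> - (1 + \<alpha> k0)) \<le> K + 1"
    using grid_below[of "1 + al" "1 + au" \<beta> n K] a \<beta> d K
    unfolding m_def \<alpha>_def beta_grid_eq[symmetric] beta_grid_def[symmetric] by auto
  have Nk0: "N\<beta> / N k0 \<le> exp (K + 1)"
    unfolding N\<beta>_def N_def using d1 a \<alpha>[OF k0(1)] k0 by (intro rate_quotient_le) auto
  have good: "N\<beta> * \<bar>S_adaptive z0 \<epsilon> al au lam n (y w) - S z0\<bar> \<le> C1" if w: "w \<in> space M - bad" for w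
  proof -
    have wB: "w \<in> space M - B0" using w by (auto simp: bad_def)
    have sk: "\<bar>s k w\<bar> \<le> 3 * lam / 4 / N k" if "k \<le> m" for k
    proof -
      have "w \<notin> U k" using w that by (auto simp: bad_def)
      then show ?thesis using w by (auto simp: U_def)
    qed
    \<comment> \<open>At \<open>k0 = 0\<close> the Hoelder term is only known to be at most Ls/N,
      without the small factor exp (-K/5), so the comparison with grid point 0 replaces the oracle
      bound.\<close>
    have "\<bar>S_adaptive z0 \<epsilon> al au lam n (y w) - S z0\<bar> \<le> (3 * lam + Ls) / N k0"
    proof (cases "k0 = 0")
      case True
      have "err 0 w \<le> lam / 8 / N 0 + Ls / N 0 + 3 * lam / 4 / N 0"
        using err_good[OF wB, of 0] sk[of 0] mult_left_mono[OF bias0 Ls] by simp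
      then have "\<bar>S_adaptive z0 \<epsilon> al au lam n (y w) - S z0\<bar> \<le> (lam / 8 + Ls + 3 * lam / 4 + 2 * lam) / N 0"
        using at0[of w] unfolding add_divide_distrib by linarith
      also have "\<dots> \<le> (3 * lam + Ls) / N 0"
        using lam N0[of 0] by (intro divide_right_mono) auto
      finally show ?thesis using True by simp
    next
      case False
      have "err j w \<le> lam / N j" if j: "j \<le> k0" for j
      proof -
        have jm: "j \<le> m" using j k0 by simp
        have "\<alpha> j \<le> \<alpha> k0" unfolding \<alpha>_def using a j by (intro grid_mono) auto
        then have "ln (d_seq n) * (\<beta> - (1 + \<alpha> k0)) \<le> ln (d_seq n) * (\<beta> - (1 + \<alpha> j))"
          using d by (intro mult_left_mono) auto
        then have "h j powr \<beta> \<le> exp (- K / 5) / N j"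
          unfolding hk N_def using d1 a \<alpha>[OF jm] k0(3) False K by (intro bandwidth_powr_le) auto
        then have "Ls * h j powr \<beta> \<le> Ls * (exp (- K / 5) / N j)" using Ls by (intro mult_left_mono)
        also have "\<dots> = Ls * exp (- K / 5) / N j" by simp
        also have "\<dots> \<le> lam / 8 / N j" using K N0[of j] by (intro divide_right_mono) auto
        finally have "err j w \<le> lam / 8 / N j + lam / 8 / N j + 3 * lam / 4 / N j"
          using err_good[OF wB jm] sk[OF jm] by linarith
        also have "\<dots> = lam / N j" by (simp add: field_simps)
        finally show ?thesis .
      qed
      then have "\<bar>S_adaptive z0 \<epsilon> al au lam n (y w) - S z0\<bar> \<le> 3 * lam / N k0"
        unfolding err_def Nb using d1 a lam k0(1) unfolding m_def
        by (intro adaptive_error_oracle) auto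
      also have "\<dots> \<le> (3 * lam + Ls) / N k0" using Ls N0[of k0] by (intro divide_right_mono) auto
      finally show ?thesis .
    qed
    then have "N\<beta> * \<bar>S_adaptive z0 \<epsilon> al au lam n (y w) - S z0\<bar> \<le> N\<beta> * ((3 * lam + Ls) / N k0)"
      using N\<beta> by (intro mult_left_mono) auto
    also have "\<dots> = (3 * lam + Ls) * (N\<beta> / N k0)" by simp
    also have "\<dots> \<le> C1" unfolding C1_def using Nk0 lam Ls by (intro mult_left_mono) auto
    finally show ?thesis .
  qed

  have N0\<beta>: "1 \<le> N\<beta> / N 0"
    using N0[of 0] rate_mono[OF d1, of "1 + al" \<beta>] a \<beta> by (simp add: N\<beta>_def N_def \<alpha>0)
  have Q1: "N\<beta> / N 0 \<le> Q" unfolding Q_def using N0\<beta> by (intro self_le_power) auto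
  have bnd: "N\<beta> * \<bar>S_adaptive z0 \<epsilon> al au lam n (y w) - S z0\<bar>
      \<le> C1 + 2 * N\<beta> * indicator B0 w + C2 * Q * indicator bad w + (N 0)\<^sup>2 * (s 0 w)\<^sup>2"
    if w: "w \<in> space M" for w
  proof (cases "w \<in> bad")
    case False
    then have "w \<notin> B0" by (auto simp: bad_def)
    then show ?thesis using good[of w] w False by (simp add: add_increasing2)
  next
    case True
    have "err 0 w \<le> 2 * indicator B0 w + (lam / 8 + Ls) / N 0 + \<bar>s 0 w\<bar>"
    proof (cases "w \<in> B0")
      case True
      have "0 \<le> (lam / 8 + Ls) / N 0" using lam Ls N0[of 0] by simp
      then show ?thesis using True err_crude[of w] by simp
    next
      case False
      then show ?thesis
        using err_good[of w 0] w mult_left_mono[OF bias0 Ls] by (simp add: add_divide_distrib)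
    qed
    then have "\<bar>S_adaptive z0 \<epsilon> al au lam n (y w) - S z0\<bar>
        \<le> 2 * indicator B0 w + (lam / 8 + Ls + 2 * lam) / N 0 + \<bar>s 0 w\<bar>"
      using at0[of w] unfolding add_divide_distrib by linarith
    then have "N\<beta> * \<bar>S_adaptive z0 \<epsilon> al au lam n (y w) - S z0\<bar>
        \<le> N\<beta> * (2 * indicator B0 w + (lam / 8 + Ls + 2 * lam) / N 0 + \<bar>s 0 w\<bar>)"
      using N\<beta> by (intro mult_left_mono) auto
    also have "\<dots> = 2 * N\<beta> * indicator B0 w + (C2 - 1) * (N\<beta> / N 0) + (N\<beta> / N 0) * (N 0 * \<bar>s 0 w\<bar>)"
      using N0[of 0] by (simp add: C2_def field_simps)
    also have "\<dots> \<le> 2 * N\<beta> * indicator B0 w + (C2 - 1) * Q + (Q + (N 0)\<^sup>2 * (s 0 w)\<^sup>2)"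
    proof (intro add_mono order_refl)
      show "(C2 - 1) * (N\<beta> / N 0) \<le> (C2 - 1) * Q"
        using Q1 lam Ls by (intro mult_left_mono) (auto simp: C2_def)
      \<comment> \<open>Splitting into squares separates the ratio of rates, to be weighed against
        the probability of \<open>bad\<close>, from the normalised noise, whose second moment is
        bounded. It squares the ratio, whence 2\<Delta> in the condition on p.\<close>
      have "2 * ((N\<beta> / N 0) * (N 0 * \<bar>s 0 w\<bar>)) \<le> (N\<beta> / N 0)\<^sup>2 + (N 0 * \<bar>s 0 w\<bar>)\<^sup>2"
        using sum_squares_bound[of "N\<beta> / N 0" "N 0 * \<bar>s 0 w\<bar>"] by (simp only: mult.assoc)
      moreover have "0 \<le> (N\<beta> / N 0) * (N 0 * \<bar>s 0 w\<bar>)" using N\<beta> N0[of 0] by simp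
      moreover have "(N 0 * \<bar>s 0 w\<bar>)\<^sup>2 = (N 0)\<^sup>2 * (s 0 w)\<^sup>2" by (simp add: power_mult_distrib)
      ultimately show "(N\<beta> / N 0) * (N 0 * \<bar>s 0 w\<bar>) \<le> Q + (N 0)\<^sup>2 * (s 0 w)\<^sup>2"
        unfolding Q_def by linarith
    qed
    also have "\<dots> \<le> C1 + 2 * N\<beta> * indicator B0 w + C2 * Q * indicator bad w + (N 0)\<^sup>2 * (s 0 w)\<^sup>2"
      using True C10 by (simp add: algebra_simps)
    finally show ?thesis .
  qed

  have sm [measurable]: "s 0 \<in> borel_measurable M"
    using measurable_lin_quad[OF pred[of 0], of "\<lambda>_. 0"] unfolding s_def[abs_def] by simp
  let ?G = "\<lambda>w. ennreal C1 + ennreal (2 * N\<beta>) * indicator B0 w + ennreal (C2 * Q) * indicator bad w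
      + ennreal ((N 0)\<^sup>2) * ennreal ((s 0 w)\<^sup>2)"
  have Q0: "0 \<le> Q" by (simp add: Q_def)
  have "abs_risk M \<xi> y0 z0 n (S_adaptive z0 \<epsilon> al au lam n) S \<le> (\<integral>\<^sup>+w. ennreal (1 / N\<beta>) * ?G w \<partial>M)"
    unfolding abs_risk_def y_def[symmetric]
  proof (rule nn_integral_mono)
    fix w assume w: "w \<in> space M"
    let ?g = "C1 + 2 * N\<beta> * indicator B0 w + C2 * Q * indicator bad w + (N 0)\<^sup>2 * (s 0 w)\<^sup>2"
    have "\<bar>S_adaptive z0 \<epsilon> al au lam n (y w) - S z0\<bar> \<le> 1 / N\<beta> * ?g"
      using bnd[OF w] N\<beta> by (simp add: pos_le_divide_eq mult.commute)
    then have "ennreal \<bar>S_adaptive z0 \<epsilon> al au lam n (y w) - S z0\<bar> \<le> ennreal (1 / N\<beta> * ?g)"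
      by (rule ennreal_leI)
    also have "\<dots> = ennreal (1 / N\<beta>) * ennreal ?g"
      using N\<beta> C10 C2 Q0 by (intro ennreal_mult add_nonneg_nonneg mult_nonneg_nonneg) auto
    also have "ennreal ?g = ?G w"
      using N\<beta> C10 C2 Q0 by (intro ennreal_indicator_combination[symmetric]) auto
    finally show "ennreal \<bar>S_adaptive z0 \<epsilon> al au lam n (y w) - S z0\<bar> \<le> ennreal (1 / N\<beta>) * ?G w" .
  qed
  also have "\<dots> = ennreal (1 / N\<beta>) * (\<integral>\<^sup>+w. ?G w \<partial>M)"
    by (rule nn_integral_cmult) measurable
  finally have "ennreal N\<beta> * abs_risk M \<xi> y0 z0 n (S_adaptive z0 \<epsilon> al au lam n) S
      \<le> ennreal N\<beta> * (ennreal (1 / N\<beta>) * (\<integral>\<^sup>+w. ?G w \<partial>M))"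
    by (intro mult_left_mono) auto
  also have "\<dots> = (\<integral>\<^sup>+w. ?G w \<partial>M)"
    using N\<beta> by (simp add: mult.assoc[symmetric] ennreal_mult[symmetric])
  also have "\<dots> = ennreal C1 + ennreal (2 * N\<beta>) * emeasure M B0 + ennreal (C2 * Q) * emeasure M bad
      + ennreal ((N 0)\<^sup>2) * (\<integral>\<^sup>+w. ennreal ((s 0 w)\<^sup>2) \<partial>M)"
    by (simp add: nn_integral_add nn_integral_cmult emeasure_space_1)
  also have "\<dots> \<le> ennreal C1 + ennreal (2 * N\<beta>) * ennreal (10 / real n)
      + ennreal (C2 * Q) * ennreal (10 / real n + 2 * (real m + 1) * real n powr (- p))
      + ennreal ((N 0)\<^sup>2) * ennreal (4 * exp 2 * (1 / P 0))"
  proof (intro add_mono mult_left_mono order_refl mB0 mbad)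
    show "(\<integral>\<^sup>+w. ennreal ((s 0 w)\<^sup>2) \<partial>M) \<le> ennreal (4 * exp 2 * (1 / P 0))"
      unfolding s_def using P10[of 0] by (intro lin_second_moment pred var) auto
  qed auto
  also have "\<dots> = ennreal (C1 + 2 * N\<beta> * (10 / real n)
      + C2 * Q * (10 / real n + 2 * (real m + 1) * real n powr (- p))
      + (N 0)\<^sup>2 * (4 * exp 2 * (1 / P 0)))"
    using N\<beta> C10 C2 Q0 P10[of 0]
    by (simp add: ennreal_mult[symmetric] ennreal_plus[symmetric] del: ennreal_plus)
  \<comment> \<open>The 20 comes from \<open>B0\<close>, as the rate is at most n. The 11 is 10 for
    the share of \<open>B0\<close> in \<open>bad\<close>, where Q \<le> n because 2\<Delta> \<le> 1,
    plus 1 for the large noise parts by \<open>np\<close>. The last term uses P = N^2 ln n at grid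
    point 0.\<close>
  also have "\<dots> \<le> ennreal (C1 + 20 + C2 * 11 + 4 * exp 2)"
  proof (intro ennreal_leI add_mono order_refl)
    have dn: "d_seq n \<le> real n"
      using n ln0 by (simp add: d_seq_def pos_divide_le_eq mult_le_cancel_left1)
    have "N\<beta> \<le> d_seq n powr 1"
      unfolding N\<beta>_def rate_def using d1 \<beta>1 by (intro powr_mono) (auto simp: divide_le_eq_1)
    also have "\<dots> \<le> real n" using dn d0 by simp
    finally show "2 * N\<beta> * (10 / real n) \<le> 20" using n0 by (simp add: divide_le_eq)
    have "N\<beta> / N 0 \<le> rate n (1 + au) / rate n (1 + al)"
      unfolding N\<beta>_def N_def \<alpha>0 using rate_pos[OF d0] d1 a \<beta>
      by (intro divide_right_mono rate_mono) (auto simp: less_imp_le)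
    also have "\<dots> = exp (ln (d_seq n) * \<Delta>)"
      using rate_quotient[OF d1, of "1 + al" "1 + au"] a by (simp add: \<Delta>_def)
    also have "\<dots> = d_seq n powr \<Delta>" using d0 by (simp add: powr_def mult.commute)
    also have "\<dots> \<le> real n powr \<Delta>"
      using dn d0 a by (intro powr_mono2) (auto simp: \<Delta>_def)
    finally have "Q \<le> (real n powr \<Delta>)\<^sup>2"
      unfolding Q_def using N0\<beta> by (intro power_mono) auto
    also have "\<dots> = real n powr (2 * \<Delta>)"
      using n0 by (simp add: power2_eq_square powr_add[symmetric])
    finally have Qn: "Q \<le> real n powr (2 * \<Delta>)" .
    have \<Delta>1: "2 * \<Delta> \<le> 1"
    proof -
      have "2 * 1 \<le> (2 * (1 + al) + 1) * (2 * (1 + au) + 1)"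
        using a by (intro mult_mono) auto
      then show ?thesis unfolding \<Delta>_def using a by (simp add: divide_le_eq)
    qed
    have "Q * (10 / real n) \<le> 10"
    proof -
      have "real n powr (2 * \<Delta>) \<le> real n powr 1" using \<Delta>1 n0 by (intro powr_mono) auto
      then have "Q \<le> real n" using Qn n0 by simp
      then show ?thesis using n0 by (simp add: divide_le_eq)
    qed
    moreover have "Q * (2 * (real m + 1) * real n powr (- p)) \<le> 1"
    proof -
      have "Q * (2 * (real m + 1) * real n powr (- p))
          \<le> real n powr (2 * \<Delta>) * (2 * (real m + 1) * real n powr (- p))"
        using Qn by (intro mult_right_mono) auto
      also have "\<dots> = real n powr (2 * \<Delta> - p) * (2 * (real m + 1))"
        using n0 by (simp add: powr_diff powr_minus_divide)
      also have "\<dots> \<le> 1" using np by (simp add: m_def)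
      finally show ?thesis .
    qed
    ultimately have "Q * (10 / real n + 2 * (real m + 1) * real n powr (- p)) \<le> 11"
      unfolding distrib_left by linarith
    then show "C2 * Q * (10 / real n + 2 * (real m + 1) * real n powr (- p)) \<le> C2 * 11"
      unfolding mult.assoc using C2 by (intro mult_left_mono) auto
    have "(N 0)\<^sup>2 * (4 * exp 2 * (1 / P 0)) = 4 * exp 2 / ln (real n)"
      unfolding PN[of 0, simplified] using N0[of 0] by simp
    also have "\<dots> \<le> 4 * exp 2" using n(2) by (simp add: divide_le_eq mult_le_cancel_left1)
    finally show "(N 0)\<^sup>2 * (4 * exp 2 * (1 / P 0)) \<le> 4 * exp 2" .
  qed
  finally show ?thesis by (simp add: N\<beta>_def C1_def C2_def)
qed

end

section \<open>Admissibility of all grid bandwidths for large n\<close>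

text \<open>The conditions \<open>bias\<close> and \<open>noise\<close> are stated with \<gamma>, a
  lower bound for (1 - \<alpha>)/(3 + 2\<alpha>) from \<alpha> \<le> au and 3 + 2\<alpha> \<le> 5,
  so that they do not depend on \<alpha> and serve the whole grid at once.\<close>

lemma bandwidth_admissible:
  fixes z0 \<epsilon> L C \<alpha> au :: real and n :: nat
  defines "\<gamma> \<equiv> (1 - au) / 5" and "D \<equiv> 4 * C + 3 * sqrt (24 * C + 48) + 10"
    and "h \<equiv> d_seq n powr (- 1 / (2 * (1 + \<alpha>) + 1))"
  assumes \<alpha>: "0 \<le> \<alpha>" "\<alpha> \<le> au" and au: "au < 1" and eps: "0 < \<epsilon>" and C: "0 \<le> C" and L: "0 \<le> L"
    and n: "2 \<le> ln (real n)" and d: "1 \<le> d_seq n"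
    and z0: "d_seq n powr (- (1 / 5)) < min z0 (1 - z0)"
    and bias: "L * ln (real n) * d_seq n powr (- \<gamma>) \<le> \<epsilon> / 50"
    and noise: "D * ln (real n) ^ 3 \<le> \<epsilon> / 50 * d_seq n powr \<gamma>"
  shows "admissible z0 \<epsilon> L (C * ln (real n)) n h \<alpha>"
proof -
  define l where "l = ln (real n)"
  define d' where "d' = d_seq n"
  define P where "P = real n * h"
  have l: "2 \<le> l" using n by (simp add: l_def)
  have n0: "0 < real n"
  proof (rule ccontr)
    assume "\<not> 0 < real n"
    then have "n = 0" by simp
    then show False using n by simp
  qed
  have d1: "1 \<le> d'" using d by (simp add: d'_def)
  have dn: "d' \<le> real n"
    using l n0 unfolding d'_def d_seq_def l_def[symmetric]
    by (simp add: pos_divide_le_eq mult_le_cancel_left1)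
  have hd: "h = d' powr (- (1 / (3 + 2 * \<alpha>)))"
    by (simp add: h_def d'_def algebra_simps)
  have h0: "0 < h" using d1 by (simp add: hd)
  have h1: "h \<le> 1"
    using powr_mono[of "- (1 / (3 + 2 * \<alpha>))" 0 d'] d1 \<alpha> unfolding hd by simp
  have "h \<le> d' powr (- (1 / 5))"
    unfolding hd using d1 \<alpha> au by (intro powr_mono) (auto simp: field_simps)
  then have hz: "h < z0" "h < 1 - z0" using z0 by (auto simp: d'_def)
  define e where "e = h powr \<alpha> / l"
  have e_eq: "eps_tilde n h \<alpha> = e" by (simp add: eps_tilde_def e_def l_def)
  have e0: "0 < e" using h0 l by (simp add: e_def)
  have "h powr \<alpha> \<le> 1" using h0 h1 \<alpha> by (simp add: powr_le1)
  then have "h powr \<alpha> / l \<le> 1 / 2" using l by (intro frac_le) auto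
  then have e2: "e \<le> 1 / 2" by (simp add: e_def)
  have \<gamma>: "\<gamma> \<le> (1 - \<alpha>) / (3 + 2 * \<alpha>)"
    unfolding \<gamma>_def using \<alpha> au by (intro frac_le) auto
  have b1: "L * h \<le> \<epsilon> / 50 * e"
  proof -
    have "h powr (1 - \<alpha>) = d' powr (- ((1 - \<alpha>) / (3 + 2 * \<alpha>)))"
      by (simp add: hd powr_powr)
    also have "\<dots> \<le> d' powr (- \<gamma>)" using d1 \<gamma> by (intro powr_mono) auto
    finally have "L * l * h powr (1 - \<alpha>) \<le> L * l * d' powr (- \<gamma>)"
      using L l by (intro mult_left_mono) auto
    also have "\<dots> \<le> \<epsilon> / 50" using bias by (simp add: l_def d'_def)
    finally have "L * l * h powr (1 - \<alpha>) * e \<le> \<epsilon> / 50 * e"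
      using e0 by (intro mult_right_mono) auto
    moreover have "L * l * h powr (1 - \<alpha>) * e = L * h"
      using l h0 by (simp add: e_def powr_diff)
    ultimately show ?thesis by simp
  qed
  have dh: "1 \<le> d' * h"
  proof -
    have "d' * h = d' powr (1 + - (1 / (3 + 2 * \<alpha>)))"
      using d1 unfolding powr_add by (simp add: hd)
    also have "\<dots> \<ge> 1" using d1 \<alpha> by (intro ge_one_powr_ge_zero) (auto simp: field_simps)
    finally show ?thesis .
  qed
  have Pdh: "d' * h \<le> P" unfolding P_def using dn h0 by (intro mult_right_mono) auto
  then have P1: "1 \<le> P" using dh by linarith
  \<comment> \<open>One logarithm arises here; two more come from the square of e = h powr \<alpha>
    / l, which accounts for the third power in \<open>noise\<close>.\<close>
  have root: "sqrt ((2 * P + 1) * (8 * (C * l) + 16) * l) \<le> sqrt P * l * sqrt (24 * C + 48)"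
  proof -
    have "8 * (C * l) + 16 \<le> (8 * C + 16) * l" using l by (simp add: algebra_simps)
    then have "(2 * P + 1) * (8 * (C * l) + 16) * l \<le> (3 * P) * ((8 * C + 16) * l) * l"
      using P1 C l by (intro mult_right_mono mult_mono) auto
    also have "\<dots> = P * l\<^sup>2 * (24 * C + 48)" by (simp add: power2_eq_square algebra_simps)
    finally have "sqrt ((2 * P + 1) * (8 * (C * l) + 16) * l) \<le> sqrt (P * l\<^sup>2 * (24 * C + 48))"
      by (rule real_sqrt_le_mono)
    then show ?thesis using l by (simp add: real_sqrt_mult)
  qed
  have sP: "1 \<le> sqrt P" using P1 by simp
  have one: "1 \<le> sqrt P * l" using mult_mono[of 1 "sqrt P" 1 l] sP l by simp
  have "C * l \<le> C * (sqrt P * l)"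
    using C l sP by (intro mult_left_mono) (auto simp: mult_le_cancel_right1)
  then have "4 * (C * l) + 3 * sqrt ((2 * P + 1) * (8 * (C * l) + 16) * l) + 10
      \<le> 4 * (C * (sqrt P * l)) + 3 * (sqrt P * l * sqrt (24 * C + 48)) + 10 * (sqrt P * l)"
    using root one by linarith
  also have "\<dots> = D * (sqrt P * l)" by (simp add: D_def algebra_simps)
  also have "\<dots> \<le> \<epsilon> / 50 * e\<^sup>2 * P"
  proof -
    have "d' powr \<gamma> \<le> d' powr ((1 - \<alpha>) / (3 + 2 * \<alpha>))" using d1 \<gamma> by (intro powr_mono) auto
    \<comment> \<open>The exponent is rewritten as that of sqrt (d h) times h powr (2\<alpha>), with
      h = d^(-1/(3 + 2\<alpha>)).\<close>
    also have "\<dots> = d' powr (1 / 2 * (1 + - (1 / (3 + 2 * \<alpha>))) + - (1 / (3 + 2 * \<alpha>)) * (2 * \<alpha>))"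
    proof (intro arg_cong2[where f = "(powr)"] refl)
      define i where "i = 1 / (3 + 2 * \<alpha>)"
      have "(3 + 2 * \<alpha>) * i = 1" using \<alpha> by (simp add: i_def)
      then have "(1 - \<alpha>) * i = 1 / 2 * (1 + - i) + - i * (2 * \<alpha>)"
        by (simp add: algebra_simps)
      moreover have "(1 - \<alpha>) / (3 + 2 * \<alpha>) = (1 - \<alpha>) * i" by (simp add: i_def)
      ultimately show "(1 - \<alpha>) / (3 + 2 * \<alpha>)
          = 1 / 2 * (1 + - (1 / (3 + 2 * \<alpha>))) + - (1 / (3 + 2 * \<alpha>)) * (2 * \<alpha>)"
        unfolding i_def[symmetric] by (simp only:)
    qed
    also have "\<dots> = (d' * h) powr (1 / 2) * h powr (2 * \<alpha>)"
    proof -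
      have A: "(d' * h) powr (1 / 2) = d' powr (1 / 2 * (1 + - (1 / (3 + 2 * \<alpha>))))"
        using d1 unfolding mult.commute[of "1 / 2"] powr_powr[symmetric] powr_add by (simp add: hd)
      have B: "h powr (2 * \<alpha>) = d' powr (- (1 / (3 + 2 * \<alpha>)) * (2 * \<alpha>))"
        by (simp only: hd powr_powr)
      show ?thesis unfolding A B by (rule powr_add)
    qed
    also have "\<dots> \<le> P powr (1 / 2) * h powr (2 * \<alpha>)"
      using Pdh dh by (intro mult_right_mono powr_mono2) auto
    also have "\<dots> = sqrt P * (h powr \<alpha>)\<^sup>2"
      using P1 h0 by (simp add: powr_half_sqrt power2_eq_square powr_add[symmetric])
    finally have g: "d' powr \<gamma> \<le> sqrt P * (h powr \<alpha>)\<^sup>2" .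
    have "D * l ^ 3 \<le> \<epsilon> / 50 * d' powr \<gamma>" using noise by (simp add: l_def d'_def)
    also have "\<dots> \<le> \<epsilon> / 50 * (sqrt P * (h powr \<alpha>)\<^sup>2)" using eps g by (intro mult_left_mono) auto
    also have "\<dots> = \<epsilon> / 50 * sqrt P * e\<^sup>2 * l\<^sup>2"
      using l by (simp add: e_def power_divide)
    finally have "(D * l) * l\<^sup>2 \<le> (\<epsilon> / 50 * sqrt P * e\<^sup>2) * l\<^sup>2"
      by (simp add: power2_eq_square power3_eq_cube mult.assoc)
    then have "D * l \<le> \<epsilon> / 50 * sqrt P * e\<^sup>2" using l by simp
    then have "sqrt P * (D * l) \<le> sqrt P * (\<epsilon> / 50 * sqrt P * e\<^sup>2)"
      using sP by (intro mult_left_mono) auto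
    also have "\<dots> = \<epsilon> / 50 * e\<^sup>2 * (sqrt P * sqrt P)" by (simp only: mult_ac)
    also have "sqrt P * sqrt P = P" using P1 by simp
    finally show ?thesis by (simp only: mult_ac)
  qed
  finally show ?thesis
    unfolding admissible_def e_eq l_def[symmetric] P_def[symmetric]
    using h0 hz e0 e2 b1 by auto
qed

theorem theorem3p6:
  fixes M :: "'a measure" and \<xi> :: "nat \<Rightarrow> 'a \<Rightarrow> real"
    and y0 z0 \<epsilon> L Ls al au bl bu lam :: real
  assumes "prob_space M"
    and "prob_space.indep_vars M (\<lambda>_. borel) \<xi> {1..}"
    and "\<And>k. 1 \<le> k \<Longrightarrow> distributed M lborel (\<xi> k) (\<lambda>x. ennreal (std_normal_density x))"
    and "0 < z0" "z0 < 1"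
    and "0 < \<epsilon>" "\<epsilon> < 1"
    and "0 < L" "0 < Ls"
    and "0 < al" "al < au" "au < 1"
    and "bl = 1 + al" "bu = 1 + au"
    and "lam > 4 * sqrt 2 * sqrt ((bu - bl) / ((2 * bl + 1) * (2 * bu + 1)))"
  shows "limsup (\<lambda>n. SUP \<beta>\<in>{bl..bu}. SUP S\<in>holder_class z0 \<beta> \<epsilon> L Ls.
           ennreal (rate n \<beta>) * abs_risk M \<xi> y0 z0 n (S_adaptive z0 \<epsilon> al au lam n) S) < \<infinity>"
proof -
  interpret gaussian_noise M \<xi>
    using assms(1-3) by (intro gaussian_noise.intro gaussian_noise_axioms.intro)
  define \<Delta> where "\<Delta> = (au - al) / ((2 * (1 + al) + 1) * (2 * (1 + au) + 1))"
  define p where "p = 9 * lam\<^sup>2 / 128"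
  have \<Delta>: "0 < \<Delta>" unfolding \<Delta>_def using assms by (intro divide_pos_pos mult_pos_pos) auto
  have lam': "4 * sqrt 2 * sqrt \<Delta> < lam" using assms(13-15) by (simp add: \<Delta>_def)
  have lam: "0 < lam" using lam' \<Delta> by (intro less_trans[OF _ lam']) auto
  have "(4 * sqrt 2 * sqrt \<Delta>)\<^sup>2 < lam\<^sup>2" using lam' \<Delta> by (intro power_strict_mono) auto
  then have "32 * \<Delta> < lam\<^sup>2" using \<Delta> by (simp add: power_mult_distrib)
  then have c: "0 < p - 2 * \<Delta>" using \<Delta> by (simp add: p_def)
  \<comment> \<open>Backing off by K / ln d multiplies the bias by at most exp (-K/5), which has to
    bring the Hoelder constant below \<lambda>/8.\<close>
  obtain K where K: "0 \<le> K" "Ls * exp (- K / 5) \<le> lam / 8"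
  proof
    define K where "K = 5 * max 0 (ln (8 * Ls / lam))"
    show "0 \<le> K" by (simp add: K_def)
    have "exp (- K / 5) \<le> exp (- ln (8 * Ls / lam))" by (simp add: K_def)
    also have "\<dots> = lam / (8 * Ls)" using lam assms(9) by (simp add: exp_minus)
    finally have "Ls * exp (- K / 5) \<le> Ls * (lam / (8 * Ls))" using assms(9) by (intro mult_left_mono) auto
    then show "Ls * exp (- K / 5) \<le> lam / 8" using assms(9) by simp
  qed
  define C where "C = 2 * y0\<^sup>2 + 48 / \<epsilon>\<^sup>2 + 8"
  have C: "0 \<le> C" using assms by (simp add: C_def)
  define \<gamma> where "\<gamma> = (1 - au) / 5"
  have \<gamma>: "0 < \<gamma>" using assms by (simp add: \<gamma>_def)
  define D where "D = 4 * C + 3 * sqrt (24 * C + 48) + 10"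
  define Z where "Z = (3 * lam + Ls) * exp (K + 1) + 20 + (lam / 8 + Ls + 2 * lam + 1) * 11 + 4 * exp 2"
  have ev1: "\<forall>\<^sub>F n in sequentially. 2 \<le> ln (real n)" by real_asymp
  have ev2: "\<forall>\<^sub>F n in sequentially. 1 < d_seq n" unfolding d_seq_def by real_asymp
  have ev3: "\<forall>\<^sub>F n in sequentially. d_seq n powr (- (1 / 5)) < min z0 (1 - z0)"
  proof -
    have "(\<lambda>n. d_seq n powr (- (1 / 5))) \<longlonglongrightarrow> 0" unfolding d_seq_def by real_asymp
    then show ?thesis using assms by (intro order_tendstoD) auto
  qed
  have ev4: "\<forall>\<^sub>F n in sequentially. L * ln (real n) * d_seq n powr (- \<gamma>) < \<epsilon> / 50"
  proof -
    have "(\<lambda>n. ln (real n) * d_seq n powr (- \<gamma>)) \<longlonglongrightarrow> 0" unfolding d_seq_def using \<gamma> by real_asymp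
    from order_tendstoD(2)[OF tendsto_mult_left[OF this, of L], of "\<epsilon> / 50"] show ?thesis
      using assms(6) by (simp add: mult.assoc)
  qed
  have ev5: "\<forall>\<^sub>F n in sequentially. D * (ln (real n) ^ 3 * d_seq n powr (- \<gamma>)) < \<epsilon> / 50"
  proof -
    have "(\<lambda>n. ln (real n) ^ 3 * d_seq n powr (- \<gamma>)) \<longlonglongrightarrow> 0" unfolding d_seq_def using \<gamma> by real_asymp
    from order_tendstoD(2)[OF tendsto_mult_left[OF this, of D], of "\<epsilon> / 50"] show ?thesis
      using assms(6) by simp
  qed
  have ev6: "\<forall>\<^sub>F n in sequentially. 40 * L / (\<epsilon> * lam) \<le> ln (real n)" by real_asymp
  have ev7: "\<forall>\<^sub>F n in sequentially. ln (real n) + 2 \<le> real n" by real_asymp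
  \<comment> \<open>The grid has only logarithmically many points, so the union over them is
    absorbed by any positive power p - 2\<Delta> of n.\<close>
  have ev8: "\<forall>\<^sub>F n in sequentially. real n powr (- (p - 2 * \<Delta>)) * (2 * (ln (real n) + 2)) < 1"
  proof -
    have "(\<lambda>n. real n powr (- (p - 2 * \<Delta>)) * (2 * (ln (real n) + 2))) \<longlonglongrightarrow> 0" using c by real_asymp
    then show ?thesis by (intro order_tendstoD) auto
  qed
  \<comment> \<open>The eight conditions mention neither \<beta> nor S, so a single range of n
    serves the whole class.\<close>
  have "\<forall>\<^sub>F n in sequentially. (SUP \<beta>\<in>{bl..bu}. SUP S\<in>holder_class z0 \<beta> \<epsilon> L Ls.
           ennreal (rate n \<beta>) * abs_risk M \<xi> y0 z0 n (S_adaptive z0 \<epsilon> al au lam n) S) \<le> ennreal Z"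
    using ev1 ev2 ev3 ev4 ev5 ev6 ev7 ev8
  proof eventually_elim
    case (elim n)
    have n1: "1 < n"
    proof (rule ccontr)
      assume "\<not> 1 < n"
      then have "n = 0 \<or> n = 1" by auto
      then show False using elim(1) by auto
    qed
    have dn: "d_seq n \<le> real n"
    proof -
      have "0 < ln (real n)" using elim(1) by linarith
      then show ?thesis
        using n1 elim(1) by (simp add: d_seq_def pos_divide_le_eq mult_le_cancel_left1)
    qed
    have m: "real (grid_size n) \<le> ln (real n) + 1"
      using grid_size_bounds(3)[of n] elim(2) dn ln_mono[of "d_seq n" "real n"] by linarith
    show ?case
    proof (intro SUP_least)
      fix \<beta> S assume \<beta>: "\<beta> \<in> {bl..bu}" and S: "S \<in> holder_class z0 \<beta> \<epsilon> L Ls"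
      show "ennreal (rate n \<beta>) * abs_risk M \<xi> y0 z0 n (S_adaptive z0 \<epsilon> al au lam n) S \<le> ennreal Z"
        unfolding Z_def
      proof (rule adaptive_risk_bound[OF _ _ _ _ _ _ _ lam K n1 _ elim(2) _ _ _ _ _ S])
        fix k assume k: "k \<le> grid_size n"
        have \<alpha>: "al \<le> grid al au n k" "grid al au n k \<le> au"
          using grid_range[of al au k n] k assms by auto
        have "D * ln (real n) ^ 3 \<le> \<epsilon> / 50 * d_seq n powr \<gamma>"
          using elim(5) elim(2) by (simp add: powr_minus_divide field_simps)
        then have "admissible z0 \<epsilon> L (C * ln (real n)) n
            (d_seq n powr (- 1 / (2 * (1 + grid al au n k) + 1))) (grid al au n k)"
          using assms \<alpha> C elim(1-4) unfolding \<gamma>_def D_def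
          by (intro bandwidth_admissible[where au = au]) auto
        then show "admissible z0 \<epsilon> L ((2 * y0\<^sup>2 + 48 / \<epsilon>\<^sup>2 + 8) * ln (real n)) n
            (h_grid al au n k) (grid al au n k)"
          by (simp add: C_def h_grid_def beta_grid_eq)
      next
        show "40 * L \<le> \<epsilon> * lam * ln (real n)"
          using elim(6) assms(6) lam by (simp add: pos_divide_le_eq mult_ac)
        show "grid_size n + 1 \<le> n" using m elim(7) by linarith
        have "real n powr (2 * \<Delta> - p) * (2 * (real (grid_size n) + 1))
            \<le> real n powr (- (p - 2 * \<Delta>)) * (2 * (ln (real n) + 2))"
          using m by (intro mult_mono) auto
        then show "real n powr (2 * ((au - al) / ((2 * (1 + al) + 1) * (2 * (1 + au) + 1))) - 9 * lam\<^sup>2 / 128)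
            * (2 * (real (grid_size n) + 1)) \<le> 1"
          using elim(8) by (simp add: \<Delta>_def p_def)
      qed (use assms elim \<beta> in auto)
    qed
  qed
  then have "limsup (\<lambda>n. SUP \<beta>\<in>{bl..bu}. SUP S\<in>holder_class z0 \<beta> \<epsilon> L Ls.
           ennreal (rate n \<beta>) * abs_risk M \<xi> y0 z0 n (S_adaptive z0 \<epsilon> al au lam n) S) \<le> ennreal Z"
    by (rule Limsup_bounded)
  also have "\<dots> < \<infinity>" by simp
  finally show ?thesis .
qed

end
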